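(* There exist absolute constants $c,C_0<\infty$ such that the following holds. Let $s,m,n\in\mathbb{Z}_+$, $s\ge1$, $m\ge cs^2\log(s+1)$, $\varkappa\ge0$, $\sigma>0$, $D_n=\{-n+m,\dots,n+m\}$ and $\kappa_{m,n}=\sqrt{\frac{2n+1}{2m+1}}$. (i) Let $\bar\varrho=Cs^2\log m$ with a constant $C\ge C_0$, and let $\widehat x_{\rm con}=\widehat\varphi_{\rm con}*\Delta^my$, where $\widehat\varphi_{\rm con}$ is an optimal solution to $$\min_{\phi\in\mathbb{C}_m(\mathbb{Z})}\|\Delta^{-m}(y-\phi*\Delta^my)\|_{n,2}^2\quad\text{subject to}\quad\|F_m[\phi]\|_1\le\frac{\bar\varrho}{\sqrt{2m+1}} .$$ Then for any $\alpha\in(0,1/2]$, with a constant $C'$ depending only on $C$, $$\mathrm{Risk}_{D_n,2,\alpha}(\widehat x_{\rm con}|\mathcal H_{m,n}(s,\varkappa))\le C'\chi^\alpha_{m,n}(\sigma,s,\varkappa),$$ $$\chi^\alpha_{m,n}(\sigma,s,\varkappa)=\sigma s^2\log[m]\big(\kappa_{m,n}\sqrt{\log[1/\alpha]}+\varkappa\big)+\sigma s(\kappa_{m,n}+1)\sqrt{\log[m]\log[(m+n)/\alpha]} .$$ (ii) Let $\alpha\in(0,1/2]$, $\lambda=Q_1^{1/2}$ with $Q_1=(\kappa_{m,n}^2+1)\log[(m+n)/\alpha]+\varkappa\sqrt{\log[1/\alpha]}+1$, and let $\widehat x_{\rm pen}=\widehat\varphi_{\rm pen}*\Delta^my$, where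 $\widehat\varphi_{\rm pen}$ is an optimal solution to $$\min_{\phi\in\mathbb{C}_m(\mathbb{Z})}\|\Delta^{-m}(y-\phi*\Delta^my)\|_{n,2}^2+\sigma^2\lambda^2(m+1)\|F_m[\phi]\|_1^2 .$$ Then, with an absolute constant $C''$, $$\mathrm{Risk}_{D_n,2,\alpha}(\widehat x_{\rm pen}|\mathcal H_{m,n}(s,\varkappa))\le C''\widetilde\chi^\alpha_{m,n}(\sigma,s,\varkappa),$$ $$\widetilde\chi^\alpha_{m,n}(\sigma,s,\varkappa)=\sigma s^2\log[m]\Big((\kappa_{m,n}+1)\sqrt{\log[(m+n)/\alpha]}+\varkappa\Big).$$
   Context: $\mathbb{Z}_+$ is the set of nonnegative integers. $\mathbb{C}(\mathbb{Z})$ is the space of two-sided complex sequences; $\mathbb{C}_m(\mathbb{Z})$ is the subspace of sequences vanishing outside $\{-m,\dots,m\}$ (its elements are called filters). Convolution: $[\varphi*y]_t=\sum_{\tau\in\mathbb{Z}}\varphi_\tau y_{t-\tau}$. Shift: $[\Delta x]_t=x_{t-1}$, with inverse $\Delta^{-1}$. Semi-norm: $\|x\|_{n,2}=\big(\sum_{|\tau|\le n}|x_\tau|^2\big)^{1/2}$. The unitary DFT $F_m:\mathbb{C}_m(\mathbb{Z})\to\mathbb{C}^{2m+1}$ is $(F_m[x])_k=\frac{1}{\sqrt{2m+1}}\sum_{|\tau|\le m}\exp\big(-\frac{2\pi i k\tau}{2m+1}\big)x_\tau$, $1\le k\le 2m+1$, and $\|\cdot\|_1$ on $\mathbb{C}^{2m+1}$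 is the $\ell_1$-norm. Observations: $y_\tau=x_\tau+\sigma\zeta_\tau$ for $|\tau|\le m+n$, where $x\in\mathbb{C}(\mathbb{Z})$ is a deterministic unknown signal and the $\zeta_\tau$ are i.i.d. standard complex Gaussian, i.e. $\zeta_\tau=\zeta_\tau^1+i\zeta_\tau^2$ with $\zeta^1_\tau,\zeta^2_\tau$ i.i.d. $\mathcal{N}(0,1)$. For $\omega\in[0,2\pi)^s$ (entries may repeat), $\mathcal H_s[\omega]$ is the set of all $x\in\mathbb{C}(\mathbb{Z})$ with $p(\Delta)x=0$, $p(z)=\prod_{k=1}^s(1-e^{i\omega_k}z)$ (generalized harmonic oscillations: sums of sinusoids $e^{i\theta t}$ modulated by polynomials of degree less than the multiplicity of $\theta$ in $\omega$). $\mathcal H_s=\bigcup_{\omega\in[0,2\pi)^s}\mathcal H_s[\omega]$. The class $\mathcal H_{m,n}(s,\varkappa)$ is the set of $x\in\mathbb{C}(\mathbb{Z})$ that decompose as $x=x^{\mathcal H}+\varepsilon$ with $x^{\mathcal H}\in\mathcal H_s$ and $\|\Delta^{-\tau}\varepsilon\|_{n,2}\le\varkappa\sigma$ for all $|\tau|\le m$. Integral $\alpha$-risk of an estimate $\widehat x$ over a class $\mathcal X$ on a finite set $D$: $$\mathrm{Risk}_{D,2,\alpha}(\widehat x|\mathcal X)=\inf\Big\{r:\ \sup_{x\in\mathcal X}\mathrm{Prob}\Big\{\Big(\sum_{t\in D}|[\widehat x-x]_t|^2\Big)^{1/2}\ge r\Big\}\le\alpha\Big\}.$$ *)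

theory Defs
  imports "HOL-Probability.Probability" "HOL-Computational_Algebra.Polynomial"
begin

type_synonym signal = "int \<Rightarrow> complex"

definition filters :: "nat \<Rightarrow> signal set" where
  "filters m = {\<phi>. \<forall>\<tau>. \<tau> \<notin> {- int m..int m} \<longrightarrow> \<phi> \<tau> = 0}"

definition convolution :: "signal \<Rightarrow> signal \<Rightarrow> signal" where
  "convolution \<phi> y = (\<lambda>t. \<Sum>\<^sub>\<infinity>\<tau>\<in>UNIV. \<phi> \<tau> * y (t - \<tau>))"

(* shift k is the k-th power of the one-step shift [shift 1 x]_t = x_(t-1), for any integer k *)
definition shift :: "int \<Rightarrow> signal \<Rightarrow> signal" where
  "shift k x = (\<lambda>t. x (t - k))"

definition seminorm2 :: "nat \<Rightarrow> signal \<Rightarrow> real" where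
  "seminorm2 n x = sqrt (\<Sum>\<tau>\<in>{- int n..int n}. (cmod (x \<tau>))\<^sup>2)"

definition dft :: "nat \<Rightarrow> signal \<Rightarrow> nat \<Rightarrow> complex" where
  "dft m x k = complex_of_real (1 / sqrt (2 * real m + 1)) *
     (\<Sum>\<tau>\<in>{- int m..int m}.
        exp (- (2 * complex_of_real pi * \<i> * of_nat k * of_int \<tau> / of_nat (2 * m + 1))) * x \<tau>)"

definition dft_norm1 :: "nat \<Rightarrow> signal \<Rightarrow> real" where
  "dft_norm1 m x = (\<Sum>k=1..2 * m + 1. cmod (dft m x k))"

definition poly_shift :: "complex poly \<Rightarrow> signal \<Rightarrow> signal" where
  "poly_shift p x = (\<lambda>t. \<Sum>j\<le>degree p. coeff p j * shift (int j) x t)"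

definition harmonic_osc_at :: "nat \<Rightarrow> (nat \<Rightarrow> real) \<Rightarrow> signal set" where
  "harmonic_osc_at s \<omega> = {x. poly_shift (\<Prod>k=1..s. [:1, - exp (\<i> * complex_of_real (\<omega> k)):]) x = (\<lambda>t. 0)}"

definition harmonic_osc :: "nat \<Rightarrow> signal set" where
  "harmonic_osc s = (\<Union>\<omega>\<in>{\<omega>. \<forall>k\<in>{1..s}. 0 \<le> \<omega> k \<and> \<omega> k < 2 * pi}. harmonic_osc_at s \<omega>)"

definition nearly_harmonic :: "real \<Rightarrow> nat \<Rightarrow> nat \<Rightarrow> nat \<Rightarrow> real \<Rightarrow> signal set" where
  "nearly_harmonic \<sigma> m n s \<kappa> =
     {x. \<exists>xH \<epsilon>. x = (\<lambda>t. xH t + \<epsilon> t) \<and> xH \<in> harmonic_osc s \<and>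
           (\<forall>\<tau>\<in>{- int m..int m}. seminorm2 n (shift (- \<tau>) \<epsilon>) \<le> \<kappa> * \<sigma>)}"

definition complex_gaussian :: "complex measure" where
  "complex_gaussian =
     distr (density lborel std_normal_density \<Otimes>\<^sub>M density lborel std_normal_density) borel
       (\<lambda>(a, b). Complex a b)"

definition noise :: "nat \<Rightarrow> nat \<Rightarrow> signal measure" where
  "noise m n = PiM {- int (m + n)..int (m + n)} (\<lambda>_. complex_gaussian)"

(* Only the samples with |\<tau>| \<le> m + n are observed; the value 0 elsewhere is a convention
   that keeps estimates from depending on unobserved values of the signal. *)
definition observe :: "nat \<Rightarrow> nat \<Rightarrow> real \<Rightarrow> signal \<Rightarrow> signal \<Rightarrow> signal" where
  "observe m n \<sigma> x \<zeta> =
     (\<lambda>\<tau>. if \<tau> \<in> {- int (m + n)..int (m + n)} then x \<tau> + complex_of_real \<sigma> * \<zeta> \<tau> else 0)"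

(* An estimate maps the observed sequence to a signal. The risk is extended-real-valued, so that
   the infimum over an empty set of levels r is infinity. *)
definition risk ::
    "nat \<Rightarrow> nat \<Rightarrow> real \<Rightarrow> int set \<Rightarrow> real \<Rightarrow> (signal \<Rightarrow> signal) \<Rightarrow> signal set \<Rightarrow> ereal" where
  "risk m n \<sigma> D \<alpha> xhat X =
     Inf {ereal r | r.
       (SUP x\<in>X. emeasure (noise m n)
          {\<zeta> \<in> space (noise m n).
             sqrt (\<Sum>t\<in>D. (cmod (xhat (observe m n \<sigma> x \<zeta>) t - x t))\<^sup>2) \<ge> r}) \<le> ennreal \<alpha>}"

definition residual :: "nat \<Rightarrow> nat \<Rightarrow> signal \<Rightarrow> signal \<Rightarrow> real" where
  "residual m n y \<phi> =
     seminorm2 n (shift (- int m) (\<lambda>t. y t - convolution \<phi> (shift (int m) y) t))"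

definition con_solution :: "nat \<Rightarrow> nat \<Rightarrow> real \<Rightarrow> signal \<Rightarrow> signal \<Rightarrow> bool" where
  "con_solution m n \<rho> y =
     is_arg_min (\<lambda>\<phi>. (residual m n y \<phi>)\<^sup>2)
       (\<lambda>\<phi>. \<phi> \<in> filters m \<and> dft_norm1 m \<phi> \<le> \<rho> / sqrt (2 * real m + 1))"

definition pen_solution :: "nat \<Rightarrow> nat \<Rightarrow> real \<Rightarrow> real \<Rightarrow> signal \<Rightarrow> signal \<Rightarrow> bool" where
  "pen_solution m n \<sigma> lam y =
     is_arg_min (\<lambda>\<phi>. (residual m n y \<phi>)\<^sup>2 + \<sigma>\<^sup>2 * lam\<^sup>2 * (real m + 1) * (dft_norm1 m \<phi>)\<^sup>2)
       (\<lambda>\<phi>. \<phi> \<in> filters m)"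

(* The estimate phihat * shift^m y built from a data-driven choice of filter. For minimizers of the
   two problems above, its values on the window below are uniquely determined by y and depend
   continuously on y (even though the minimizing filter need not be unique), so the error events in
   the risk are measurable for every choice of minimizer. *)
definition filter_estimate :: "nat \<Rightarrow> (signal \<Rightarrow> signal) \<Rightarrow> signal \<Rightarrow> signal" where
  "filter_estimate m \<phi>hat y = convolution (\<phi>hat y) (shift (int m) y)"

definition window :: "nat \<Rightarrow> nat \<Rightarrow> int set" where
  "window m n = {- int n + int m..int n + int m}"

definition kap :: "nat \<Rightarrow> nat \<Rightarrow> real" where
  "kap m n = sqrt ((2 * real n + 1) / (2 * real m + 1))"

definition chi_con :: "nat \<Rightarrow> nat \<Rightarrow> real \<Rightarrow> real \<Rightarrow> nat \<Rightarrow> real \<Rightarrow> real" where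
  "chi_con m n \<alpha> \<sigma> s \<kappa> =
     \<sigma> * (real s)\<^sup>2 * ln (real m) * (kap m n * sqrt (ln (1 / \<alpha>)) + \<kappa>)
     + \<sigma> * real s * (kap m n + 1) * sqrt (ln (real m) * ln (real (m + n) / \<alpha>))"

definition chi_pen :: "nat \<Rightarrow> nat \<Rightarrow> real \<Rightarrow> real \<Rightarrow> nat \<Rightarrow> real \<Rightarrow> real" where
  "chi_pen m n \<alpha> \<sigma> s \<kappa> =
     \<sigma> * (real s)\<^sup>2 * ln (real m) * ((kap m n + 1) * sqrt (ln (real (m + n) / \<alpha>)) + \<kappa>)"

definition Q1 :: "nat \<Rightarrow> nat \<Rightarrow> real \<Rightarrow> real \<Rightarrow> real" where
  "Q1 m n \<alpha> \<kappa> = ((kap m n)\<^sup>2 + 1) * ln (real (m + n) / \<alpha>) + \<kappa> * sqrt (ln (1 / \<alpha>)) + 1"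

end

theory Submission
  imports Defs
begin

text \<open>
  Oracle filter: for every unimodular \<open>w\<close> there is a polynomial \<open>h\<close> of degree \<open>d\<close> with
  \<open>h(0) = 1\<close>, a zero at \<open>1/w\<close>, and modulus at most \<open>1 + O(log d / d)\<close> on the unit circle. The product
  \<open>Q\<close> of \<open>s\<close> of these, with \<open>d = m div s\<close>, is divisible by \<open>p\<close>, and \<open>Q(0) = 1\<close> together with the sup bound
  gives \<open>q = 1 - Q\<close> squared mean \<open>O(s\<^sup>2 log m / m)\<close> over the roots of unity of order \<open>2m + 1\<close>. The
  coefficients of \<open>q\<^sup>2\<close>, recentred, form a filter that reproduces the harmonic part, and its DFT has
  \<open>\<ell>\<^sub>1\<close>-norm \<open>O(s\<^sup>2 log m / sqrt (2m + 1))\<close>.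

  Risk bound: compare the minimizer with this filter in the basic inequality. The cross term with the
  noise splits according to signal, perturbation and noise. The harmonic part of the difference of the two
  estimates lies in a fixed space of dimension at most \<open>s\<close>, so only the projection of the noise onto it matters. The
  other two parts are expanded over the DFT atoms, which costs the \<open>\<ell>\<^sub>1\<close>-norm of the DFT times a maximum over
  \<open>2m + 1\<close> frequencies. The delay by \<open>m\<close> makes each filter causal: up to a diagonal
  term, the form quadratic in the noise is a martingale, controlled by its exponential supermartingale.
\<close>

section \<open>Polynomials with a prescribed zero and small sup norm\<close>

text \<open>The reproducing filter is a square because of the norm in play: at a root of unity the
  DFT of \<open>R = q\<^sup>2\<close> has modulus |q|^2 / sqrt (2m + 1), so an l1-norm in frequency
  becomes a squared l2-norm, which can be computed. Since Q(0) = 1, the mean of Q over the roots is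
  1, and the mean of |1 - Q|^2 is the mean of |Q|^2 minus 1: only the excess of |Q| over 1 is paid
  for. Each of the s factors contributes about log d / d with d near m / s, hence s^2 log m / m in
  total. The lower bound on m keeps this ratio bounded.

  The obstacle in the risk bound is that the fitted filter depends on the noise it is applied to. So
  every random event concerns objects fixed before the noise is drawn (frame, atoms, oracle filter,
  perturbation), and the fitted filter enters deterministically, through its norm. In (i) the
  constraint caps that norm. In (ii) it has no a priori bound, and the terms linear in it are
  absorbed by the penalty, whose weight \<open>Q1\<close> is shaped to match them.\<close>

lemma cmod_one_minus_scaled_ge:
  fixes z :: complex and \<delta> :: real
  assumes "cmod z = 1" "0 \<le> \<delta>"
  shows "(1 + \<delta>) * cmod (1 - z) \<le> 2 * cmod (1 - of_real \<delta> * z)"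
proof (rule power2_le_imp_le)
  obtain c d where z: "z = Complex c d" by (cases z)
  have cd: "c\<^sup>2 + d\<^sup>2 = 1" using assms(1) z by (simp add: cmod_def)
  have c1: "-1 \<le> c" using abs_le_square_iff[of c 1] cd by (simp add: abs_le_iff) (smt (verit) zero_le_power2)
  have "(2 * cmod (1 - of_real \<delta> * z))\<^sup>2 - ((1 + \<delta>) * cmod (1 - z))\<^sup>2
     = 4 * ((1 - \<delta> * c)\<^sup>2 + (\<delta> * d)\<^sup>2) - (1 + \<delta>)\<^sup>2 * ((1 - c)\<^sup>2 + d\<^sup>2)"
    by (simp add: z cmod_power2 power_mult_distrib)
  also have "\<dots> = 4 * (1 - 2 * \<delta> * c + \<delta>\<^sup>2 * (c\<^sup>2 + d\<^sup>2)) - (1 + \<delta>)\<^sup>2 * (1 - 2 * c + (c\<^sup>2 + d\<^sup>2))"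
    by (simp add: power2_eq_square algebra_simps)
  \<comment> \<open>For \<delta> \<noteq> 1 this vanishes only at z = -1, so 2 / (1 + \<delta>) is
    the maximum of |1 - z| / |1 - \<delta> z| on the unit circle, attained there.\<close>
  also have "\<dots> = 2 * (1 - \<delta>)\<^sup>2 * (1 + c)"
    unfolding cd by (simp add: power2_eq_square algebra_simps)
  also have "\<dots> \<ge> 0" using c1 by simp
  finally show "((1 + \<delta>) * cmod (1 - z))\<^sup>2 \<le> (2 * cmod (1 - of_real \<delta> * z))\<^sup>2" by simp
qed simp

text \<open>The series (1 - z) / (1 - \<delta> z) = 1 - (1 - \<delta>) (z + \<delta> z^2 + ...), cut
  after degree d and renormalized by 1 - \<delta>^d so that the zero at 1 survives the
  truncation.\<close>

definition halasz_poly :: "real \<Rightarrow> nat \<Rightarrow> complex poly" where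
  "halasz_poly \<delta> d = 1 - smult (of_real ((1 - \<delta>) / (1 - \<delta> ^ d))) (\<Sum>j<d. monom (of_real (\<delta> ^ j)) (Suc j))"

lemma degree_halasz_poly: "degree (halasz_poly \<delta> d) \<le> d"
proof -
  have "degree (\<Sum>j<d. monom (of_real (\<delta> ^ j) :: complex) (Suc j)) \<le> d"
    by (rule degree_sum_le) (auto intro: order.trans[OF degree_monom_le])
  then show ?thesis unfolding halasz_poly_def
    by (intro degree_diff_le) (auto intro: order.trans[OF degree_smult_le])
qed

lemma poly_halasz_poly_0: "poly (halasz_poly \<delta> d) 0 = 1"
  by (simp add: halasz_poly_def poly_sum poly_monom)

text \<open>A geometric sum with denominators cleared. The last term is the truncation error; its
  factor 1 - \<delta> will cancel against |1 - \<delta> z| \<ge> 1 - \<delta>.\<close>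

lemma poly_halasz_poly:
  assumes "0 < \<delta>" "\<delta> < 1" "0 < d"
  shows "(1 - of_real \<delta> * z) * of_real (1 - \<delta> ^ d) * poly (halasz_poly \<delta> d) z
    = of_real (1 - \<delta> ^ d) * (1 - z) + of_real (\<delta> ^ d * (1 - \<delta>)) * z * (z ^ d - 1)"
proof -
  have D: "(1::real) - \<delta> ^ d \<noteq> 0" using assms by (simp add: power_strict_decreasing[of 0 d \<delta>] power_less_one_iff less_imp_neq)
  have S: "(1 - of_real \<delta> * z) * (\<Sum>j<d. (of_real \<delta> * z) ^ j) = 1 - (of_real \<delta> * z) ^ d"
    by (simp add: one_diff_power_eq)
  have P: "poly (halasz_poly \<delta> d) z = 1 - of_real ((1 - \<delta>) / (1 - \<delta> ^ d)) * (z * (\<Sum>j<d. (of_real \<delta> * z) ^ j))"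
    by (simp add: halasz_poly_def poly_sum poly_monom sum_distrib_left power_mult_distrib mult_ac)
  have "(1 - of_real \<delta> * z) * of_real (1 - \<delta> ^ d) * poly (halasz_poly \<delta> d) z
     = (1 - of_real \<delta> * z) * of_real (1 - \<delta> ^ d)
       - of_real ((1 - \<delta> ^ d) * ((1 - \<delta>) / (1 - \<delta> ^ d))) * z * ((1 - of_real \<delta> * z) * (\<Sum>j<d. (of_real \<delta> * z) ^ j))"
    unfolding P of_real_mult by (simp add: algebra_simps)
  also have "(1 - \<delta> ^ d) * ((1 - \<delta>) / (1 - \<delta> ^ d)) = 1 - \<delta>" using D by simp
  finally show ?thesis unfolding S by (simp add: algebra_simps power_mult_distrib)
qed

lemma poly_halasz_poly_1:
  assumes "0 < \<delta>" "\<delta> < 1" "0 < d"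
  shows "poly (halasz_poly \<delta> d) 1 = 0"
proof -
  have "\<delta> ^ d < 1" using assms by (simp add: power_less_one_iff)
  then have "(1 - of_real \<delta>) * of_real (1 - \<delta> ^ d) \<noteq> (0::complex)"
    using assms by (metis diff_gt_0_iff_gt less_irrefl mult_eq_0_iff of_real_1 of_real_diff of_real_eq_0_iff)
  then show ?thesis using poly_halasz_poly[OF assms, of 1] by simp
qed

lemma cmod_halasz_poly_le:
  assumes "0 < \<delta>" "\<delta> < 1" "0 < d" "cmod z = 1"
  shows "cmod (poly (halasz_poly \<delta> d) z) \<le> 2 / (1 + \<delta>) + 2 * \<delta> ^ d / (1 - \<delta> ^ d)"
proof -
  define D where "D = \<delta> ^ d"
  have D: "0 < D" "D < 1" using assms by (auto simp: D_def power_less_one_iff)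
  define a where "a = cmod (1 - of_real \<delta> * z)"
  have "1 - \<delta> \<le> a" unfolding a_def using norm_triangle_ineq2[of 1 "of_real \<delta> * z"] assms
    by (simp add: norm_mult)
  then have a: "1 - \<delta> \<le> a" "0 < a" using assms by auto
  have b: "cmod (1 - z) \<le> 2 / (1 + \<delta>) * a"
    using cmod_one_minus_scaled_ge[of z \<delta>] assms by (simp add: a_def field_simps)
  have zd: "cmod (z ^ d - 1) \<le> 2"
    using norm_triangle_ineq4[of "z ^ d" 1] assms by (simp add: norm_power)
  have "a * (1 - D) * cmod (poly (halasz_poly \<delta> d) z)
      = cmod ((1 - of_real \<delta> * z) * of_real (1 - D) * poly (halasz_poly \<delta> d) z)"
    using D by (simp add: norm_mult a_def del: of_real_diff)
  also have "\<dots> = cmod (of_real (1 - D) * (1 - z) + of_real (D * (1 - \<delta>)) * z * (z ^ d - 1))"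
    unfolding D_def by (subst poly_halasz_poly) (use assms in auto)
  also have "\<dots> \<le> (1 - D) * cmod (1 - z) + D * (1 - \<delta>) * cmod (z ^ d - 1)"
    by (rule order.trans[OF norm_triangle_ineq]) (use D assms in \<open>simp add: norm_mult del: of_real_diff of_real_mult\<close>)
  also have "\<dots> \<le> (1 - D) * (2 / (1 + \<delta>) * a) + D * a * 2"
    using D assms a b zd by (intro add_mono mult_mono mult_left_mono) auto
  also have "D * a * 2 = a * (1 - D) * (2 * D / (1 - D))"
    using D by simp
  also have "(1 - D) * (2 / (1 + \<delta>) * a) + a * (1 - D) * (2 * D / (1 - D)) = a * (1 - D) * (2 / (1 + \<delta>) + 2 * D / (1 - D))"
    unfolding distrib_left by (simp only: mult_ac)
  finally have "a * (1 - D) * cmod (poly (halasz_poly \<delta> d) z) \<le> a * (1 - D) * (2 / (1 + \<delta>) + 2 * D / (1 - D))" .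
  then show ?thesis using a D by (simp add: D_def)
qed

lemma halasz:
  assumes "2 \<le> d"
  obtains h :: "complex poly" where "degree h \<le> d" "poly h 0 = 1" "poly h 1 = 0"
    "\<And>z. cmod z = 1 \<Longrightarrow> cmod (poly h z) \<le> 1 + 7 * ln (real d) / real d"
proof -
  \<comment> \<open>With \<delta> = 1 - e this choice makes \<delta>^d at most 1 / d, while the main
    term 2 / (2 - e) stays below 1 + e. The final 7 is 1 from the main term and 6 from the
    truncation.\<close>
  define e where "e = ln (real d) / real d"
  have e: "0 < e" "e < 1" using assms ln_less_self[of "real d"] by (auto simp: e_def)
  have "(1 - e) ^ d \<le> exp (- e) ^ d" using e exp_ge_add_one_self[of "-e"] by (intro power_mono) auto
  also have "\<dots> = exp (- ln (real d))" using assms by (simp add: e_def flip: exp_of_nat_mult)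
  also have "\<dots> = 1 / real d" using assms by (simp add: exp_minus inverse_eq_divide)
  finally have D: "(1 - e) ^ d \<le> 1 / real d" .
  have "2 / (1 + (1 - e)) \<le> 1 + e"
    using e mult_strict_left_mono[of e 1 e] by (simp add: field_simps)
  moreover have "2 * (1 - e) ^ d / (1 - (1 - e) ^ d) \<le> 2 * (1 / real d) / (1 - 1 / real d)"
    using D assms e by (intro frac_le) auto
  moreover have "2 * (1 / real d) / (1 - 1 / real d) \<le> 4 / real d"
    using assms by (simp add: field_simps)
  moreover have "4 / real d \<le> 6 * e"
  proof -
    have "ln 2 \<le> ln (real d)" using assms by simp
    with ln2_ge_two_thirds have "2/3 \<le> ln (real d)" by linarith
    then show ?thesis using assms by (simp add: e_def field_simps)
  qed
  ultimately have "2 / (1 + (1 - e)) + 2 * (1 - e) ^ d / (1 - (1 - e) ^ d) \<le> 1 + 7 * e" by linarith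
  then show ?thesis
    using that[of "halasz_poly (1 - e) d"] degree_halasz_poly poly_halasz_poly_0
      poly_halasz_poly_1[of "1 - e" d] cmod_halasz_poly_le[of "1 - e" d] e assms
    by (force simp: e_def)
qed

text \<open>One copy of the polynomial per factor, rotated so that its zero moves from 1 to the
  inverse of \<open>w k\<close>. Repeated frequencies produce repeated factors, so multiplicities
  are covered.\<close>

lemma halasz_product:
  assumes "2 \<le> d"
  obtains Q :: "complex poly" where "degree Q \<le> s * d" "poly Q 0 = 1"
    "(\<Prod>k=1..s. [:1, - exp (\<i> * complex_of_real (\<omega> k)):]) dvd Q"
    "\<And>z. cmod z = 1 \<Longrightarrow> cmod (poly Q z) \<le> (1 + 7 * ln (real d) / real d) ^ s"
proof -
  obtain h :: "complex poly" where h: "degree h \<le> d" "poly h 0 = 1" "poly h 1 = 0"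
    "\<And>z. cmod z = 1 \<Longrightarrow> cmod (poly h z) \<le> 1 + 7 * ln (real d) / real d"
    using halasz[OF assms] by blast
  define w where "w k = exp (\<i> * complex_of_real (\<omega> k))" for k
  have w: "cmod (w k) = 1" for k by (simp add: w_def)
  define Q where "Q = (\<Prod>k=1..s. pcompose h [:0, w k:])"
  have "degree Q \<le> (\<Sum>k=1..s. degree (pcompose h [:0, w k:]))"
    using degree_prod_sum_le[of "{1..s}" "\<lambda>k. pcompose h [:0, w k:]"] by (simp add: Q_def o_def)
  also have "\<dots> \<le> (\<Sum>k=1..s. d)"
    using h(1) by (intro sum_mono) (simp add: degree_pcompose)
  finally have 1: "degree Q \<le> s * d" by simp
  have 2: "poly Q 0 = 1" by (simp add: Q_def poly_prod poly_pcompose h)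
  have 3: "(\<Prod>k=1..s. [:1, - w k:]) dvd Q"
    unfolding Q_def
  proof (rule prod_dvd_prod)
    fix k
    obtain g where g: "h = [:-1, 1:] * g" using h(3) poly_eq_0_iff_dvd[of h 1] by (auto elim: dvdE)
    have "pcompose h [:0, w k:] = [:1, - w k:] * (- pcompose g [:0, w k:])"
      unfolding g pcompose_mult by (simp add: pcompose_pCons)
    then show "[:1, - w k:] dvd pcompose h [:0, w k:]" by (rule dvdI)
  qed
  have 4: "cmod (poly Q z) \<le> (1 + 7 * ln (real d) / real d) ^ s" if "cmod z = 1" for z
  proof -
    have "cmod (poly Q z) = (\<Prod>k=1..s. cmod (poly h (z * w k)))"
      by (simp add: Q_def poly_prod poly_pcompose prod_norm mult.commute)
    also have "\<dots> \<le> (\<Prod>k=1..s. 1 + 7 * ln (real d) / real d)"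
      using that w by (intro prod_mono) (auto intro!: h simp: norm_mult)
    finally show ?thesis by simp
  qed
  show ?thesis using that[OF 1 2] 3 4 by (simp add: w_def)
qed

section \<open>Roots of unity and averages of polynomials over them\<close>

definition unity_root :: "nat \<Rightarrow> int \<Rightarrow> complex" where
  "unity_root M j = exp (2 * complex_of_real pi * \<i> * of_int j / of_nat M)"

lemma unity_root_alt: "unity_root M j = cis (2 * pi * real_of_int j / real M)"
  by (simp add: unity_root_def cis_conv_exp mult_ac)

lemma cmod_unity_root [simp]: "cmod (unity_root M j) = 1"
  by (simp add: unity_root_alt)

lemma unity_root_add: "unity_root M (a + b) = unity_root M a * unity_root M b"
  by (simp add: unity_root_def exp_add ring_distribs add_divide_distrib)

lemma unity_root_power: "unity_root M a ^ n = unity_root M (int n * a)"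
  by (simp add: unity_root_def mult_ac flip: exp_of_nat_mult)

lemma sum_unity_root:
  assumes "0 < M"
  shows "(\<Sum>k=1..M. unity_root M (int k * j)) = (if int M dvd j then of_nat M else 0)"
proof -
  define w where "w = unity_root M j"
  have wM: "w ^ M = 1"
  proof -
    have "real M * (2 * pi * real_of_int j / real M) = 2 * pi * real_of_int j" using assms by simp
    then have "w ^ M = cis (2 * pi * real_of_int j)" by (simp add: w_def unity_root_alt Complex.DeMoivre)
    also have "\<dots> = 1" by (simp add: cis_multiple_2pi)
    finally show ?thesis .
  qed
  have w1: "w = 1 \<longleftrightarrow> int M dvd j"
  proof
    assume "w = 1"
    then obtain n :: int where "2 * pi * real_of_int j / real M = real_of_int (2 * n) * pi"
      unfolding w_def unity_root_alt cis_conv_exp exp_eq_1 by auto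
    then have "real_of_int j = real_of_int (int M * n)" using assms by (simp add: field_simps)
    then have "j = int M * n" using of_int_eq_iff by blast
    then show "int M dvd j" by simp
  next
    assume "int M dvd j"
    then obtain n where "j = int M * n" by blast
    then have "2 * pi * real_of_int j / real M = 2 * pi * real_of_int n" using assms by simp
    then show "w = 1" by (simp only: w_def unity_root_alt cis_multiple_2pi Ints_of_int)
  qed
  have "(\<Sum>k=1..M. unity_root M (int k * j)) = (\<Sum>k=1..M. w ^ k)"
    by (simp add: w_def unity_root_power)
  also have "\<dots> = (\<Sum>k<M. w ^ Suc k)"
    by (rule sum.reindex_bij_witness[of _ Suc "\<lambda>k. k - 1"]) auto
  also have "\<dots> = w * (\<Sum>k<M. w ^ k)" by (simp add: sum_distrib_left)
  also have "\<dots> = (if int M dvd j then of_nat M else 0)"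
  proof (cases "w = 1")
    case True then show ?thesis using w1 by simp
  next
    case False
    then have "(\<Sum>k<M. w ^ k) = 0" using wM by (simp add: geometric_sum)
    then show ?thesis using w1 False by simp
  qed
  finally show ?thesis .
qed

text \<open>A degree below M excludes aliasing: only the constant coefficient survives the
  averaging.\<close>

lemma sum_poly_unity_root:
  assumes "degree Q < M"
  shows "(\<Sum>k=1..M. poly Q (unity_root M (- int k))) = of_nat M * poly Q 0"
proof -
  have "(\<Sum>k=1..M. poly Q (unity_root M (- int k))) = (\<Sum>k=1..M. \<Sum>j\<le>degree Q. coeff Q j * unity_root M (int k * (- int j)))"
    by (simp add: poly_altdef unity_root_power mult.commute)
  also have "\<dots> = (\<Sum>j\<le>degree Q. coeff Q j * (\<Sum>k=1..M. unity_root M (int k * (- int j))))"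
    by (subst sum.swap) (simp add: sum_distrib_left)
  also have "\<dots> = (\<Sum>j\<le>degree Q. if j = 0 then coeff Q j * of_nat M else 0)"
  proof (rule sum.cong, simp)
    fix j assume j: "j \<in> {..degree Q}"
    have "M dvd j \<longleftrightarrow> j = 0" using j assms by (auto dest: dvd_imp_le)
    then have "int M dvd - int j \<longleftrightarrow> j = 0" by simp
    then show "coeff Q j * (\<Sum>k=1..M. unity_root M (int k * (- int j))) = (if j = 0 then coeff Q j * of_nat M else 0)"
      using sum_unity_root[of M "- int j"] assms by auto
  qed
  also have "\<dots> = of_nat M * poly Q 0" by (simp add: poly_0_coeff_0)
  finally show ?thesis .
qed

section \<open>The reproducing filter\<close>

lemma convolution_filter:
  assumes "\<phi> \<in> filters m"
  shows "convolution \<phi> y t = (\<Sum>\<tau>\<in>{- int m..int m}. \<phi> \<tau> * y (t - \<tau>))"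
proof -
  have "convolution \<phi> y t = (\<Sum>\<^sub>\<infinity>\<tau>\<in>{- int m..int m}. \<phi> \<tau> * y (t - \<tau>))"
    unfolding convolution_def using assms by (intro infsum_cong_neutral) (auto simp: filters_def)
  then show ?thesis by simp
qed

section \<open>Calculus of polynomials in the shift operator\<close>

lemma poly_shift_atMost:
  assumes "degree p \<le> N"
  shows "poly_shift p x t = (\<Sum>j\<le>N. coeff p j * x (t - int j))"
  unfolding poly_shift_def shift_def using assms
  by (intro sum.mono_neutral_left) (auto simp: coeff_eq_0)

lemma poly_shift_0 [simp]: "poly_shift 0 x = (\<lambda>t. 0)"
  by (simp add: poly_shift_def)

lemma poly_shift_pCons: "poly_shift (pCons a p) x t = a * x t + poly_shift p x (t - 1)"
proof -
  have "poly_shift (pCons a p) x t = (\<Sum>j\<le>Suc (degree p). coeff (pCons a p) j * x (t - int j))"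
    by (intro poly_shift_atMost degree_pCons_le)
  also have "\<dots> = a * x t + (\<Sum>j\<le>degree p. coeff p j * x (t - 1 - int j))"
    by (subst sum.atMost_Suc_shift) (simp add: algebra_simps)
  finally show ?thesis by (simp add: poly_shift_def shift_def)
qed

lemma poly_shift_1 [simp]: "poly_shift 1 x = x"
  by (auto simp: poly_shift_pCons one_pCons)

lemma poly_shift_add: "poly_shift (p + q) x t = poly_shift p x t + poly_shift q x t"
proof -
  define N where "N = max (degree p) (degree q)"
  have "degree (p + q) \<le> N" by (simp add: N_def degree_add_le_max)
  then show ?thesis
    by (simp add: poly_shift_atMost[of _ N] N_def ring_distribs sum.distrib)
qed

lemma poly_shift_smult: "poly_shift (smult a p) x t = a * poly_shift p x t"
  by (simp add: poly_shift_atMost[of "smult a p" "degree p"] poly_shift_atMost[of p "degree p"] sum_distrib_left mult.assoc)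

lemma poly_shift_add_signal: "poly_shift p (\<lambda>t. x t + y t) t = poly_shift p x t + poly_shift p y t"
  by (simp add: poly_shift_def shift_def ring_distribs sum.distrib)

lemma poly_shift_scale_signal: "poly_shift p (\<lambda>t. c * x t) t = c * poly_shift p x t"
  by (simp add: poly_shift_def shift_def sum_distrib_left mult.left_commute)

lemma poly_shift_sum_signal: "poly_shift p (\<lambda>t. \<Sum>i\<in>A. f i t) t = (\<Sum>i\<in>A. poly_shift p (f i) t)"
proof (induction A rule: infinite_finite_induct)
  case (insert a A)
  then show ?case using poly_shift_add_signal[of p "f a" "\<lambda>t. \<Sum>i\<in>A. f i t" t] by simp
qed (simp_all add: poly_shift_def shift_def)

lemma poly_shift_translate: "poly_shift p (\<lambda>t. x (t - k)) t = poly_shift p x (t - k)"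
  by (simp add: poly_shift_def shift_def algebra_simps)

lemma poly_shift_mult: "poly_shift (p * q) x t = poly_shift p (poly_shift q x) t"
proof (induction p arbitrary: t)
  case (pCons a p)
  then show ?case
    by (simp add: mult_pCons_left poly_shift_add poly_shift_smult poly_shift_pCons)
qed simp

lemma poly_shift_dvd_0:
  assumes "p dvd q" "poly_shift p x = (\<lambda>t. 0)"
  shows "poly_shift q x = (\<lambda>t. 0)"
proof -
  obtain r where "q = r * p" using assms(1) by (metis dvdE mult.commute)
  then have "poly_shift q x t = poly_shift r (\<lambda>t. 0) t" for t by (simp add: poly_shift_mult assms(2))
  then show ?thesis by (auto simp: poly_shift_def shift_def)
qed

text \<open>Combines 1 + a \<le> e^a with e^u - 1 \<le> u e^u. The cap b on u turns the factor into
  an absolute constant, leaving an excess linear in u.\<close>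

lemma power_one_plus_minus_one_le:
  fixes a u :: real
  assumes "0 \<le> a" "real n * a \<le> u" "u \<le> b"
  shows "(1 + a) ^ n - 1 \<le> exp b * u"
proof -
  have u: "0 \<le> u" using assms(1,2) by (meson mult_nonneg_nonneg of_nat_0_le_iff order.trans)
  have "(1 + a) ^ n \<le> exp a ^ n" using assms by (intro power_mono) auto
  also have "\<dots> = exp (real n * a)" by (simp add: exp_of_nat_mult)
  also have "\<dots> \<le> exp u" using assms by simp
  finally have "(1 + a) ^ n - 1 \<le> exp u * (1 - exp (- u))"
    by (simp add: algebra_simps flip: exp_add)
  also have "\<dots> \<le> exp u * u"
    using exp_ge_add_one_self[of "- u"] by (intro mult_left_mono) (linarith, simp)
  also have "\<dots> \<le> exp b * u"
    using assms u by (intro mult_right_mono) auto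
  finally show ?thesis .
qed

lemma reproducing_poly:
  assumes s: "1 \<le> s" and m: "2 * s \<le> m" and sm: "(real s)\<^sup>2 * ln (real m) \<le> real m"
  obtains q :: "complex poly" where "degree q \<le> m"
    "(\<Prod>k=1..s. [:1, - exp (\<i> * complex_of_real (\<omega> k)):]) dvd 1 - q"
    "(\<Sum>k=1..2*m+1. (cmod (poly q (unity_root (2*m+1) (- int k))))\<^sup>2) \<le> 84 * exp 28 * (real s)\<^sup>2 * ln (real m)"
proof -
  \<comment> \<open>The largest degree per factor for which s factors fit into degree m;
    \<open>2 * s \<le> m\<close> gives d \<ge> 2, as \<open>halasz_product\<close> requires.\<close>
  define d where "d = m div s"
  have d2: "2 \<le> d" using s m by (simp add: d_def less_eq_div_iff_mult_less_eq)
  have sd: "s * d \<le> m" by (simp add: d_def)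
  have ms: "real m \<le> 2 * real s * real d"
  proof -
    have "m mod s < s" using s by simp
    moreover have "s * d + m mod s = m" by (simp add: d_def)
    moreover have "s \<le> s * d" using d2 by simp
    ultimately have "m \<le> 2 * (s * d)" by linarith
    then have "real m \<le> real (2 * (s * d))" by linarith
    then show ?thesis by simp
  qed
  have dm: "d \<le> m" by (simp add: d_def)
  have m0: "0 < real m" using s m by auto
  obtain Q where Q: "degree Q \<le> s * d" "poly Q 0 = 1"
    "(\<Prod>k=1..s. [:1, - exp (\<i> * complex_of_real (\<omega> k)):]) dvd Q"
    "\<And>z. cmod z = 1 \<Longrightarrow> cmod (poly Q z) \<le> (1 + 7 * ln (real d) / real d) ^ s"
    using halasz_product[OF d2, of s \<omega>] by blast
  define M where "M = 2 * m + 1"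
  define q where "q = 1 - Q"
  define u where "u = (real s)\<^sup>2 * ln (real m) / real m"
  define a where "a = 7 * ln (real d) / real d"
  have a0: "0 \<le> a" using d2 by (simp add: a_def)
  \<comment> \<open>The exponent is 2 s because the modulus gets squared. The 28 below is 2 * 7 * 2,
    the last 2 from 1 / d \<le> 2 s / m.\<close>
  have "real (2 * s) * a = 7 * (2 * real s * ln (real d) / real d)" by (simp add: a_def)
  also have "2 * real s * ln (real d) / real d \<le> 2 * real s * ln (real m) / real d"
    using d2 dm by (intro divide_right_mono mult_left_mono) auto
  also have "\<dots> \<le> 4 * u"
  proof -
    have "2 * real s * ln (real m) * real m \<le> 2 * real s * ln (real m) * (2 * real s * real d)"
      using ms m0 m s by (intro mult_left_mono) auto
    then show ?thesis using d2 m0 by (simp add: u_def field_simps power2_eq_square)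
  qed
  finally have au: "real (2 * s) * a \<le> 28 * u" by simp
  have u1: "28 * u \<le> 28" using sm m0 by (simp add: u_def pos_divide_le_eq)
  have bnd: "(cmod (poly Q (unity_root M j)))\<^sup>2 \<le> 1 + exp 28 * (28 * u)" for j
  proof -
    have "(cmod (poly Q (unity_root M j)))\<^sup>2 \<le> ((1 + a) ^ s)\<^sup>2"
      unfolding a_def by (intro power_mono Q(4)) auto
    also have "\<dots> = (1 + a) ^ (2 * s)" by (simp add: power_mult mult.commute)
    also have "\<dots> \<le> 1 + exp 28 * (28 * u)"
      using power_one_plus_minus_one_le[OF a0 au u1] by simp
    finally show ?thesis .
  qed
  have degM: "degree Q < M" using Q(1) sd by (simp add: M_def)
  have sumQ: "(\<Sum>k=1..M. poly Q (unity_root M (- int k))) = of_nat M"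
    using sum_poly_unity_root[OF degM] Q(2) by simp
  have exp_sq: "(cmod (1 - z))\<^sup>2 = 1 - 2 * Re z + (cmod z)\<^sup>2" for z
    unfolding cmod_power2 by (simp add: power2_eq_square algebra_simps)
  have "(\<Sum>k=1..M. (cmod (poly q (unity_root M (- int k))))\<^sup>2)
      = (\<Sum>k=1..M. 1 - 2 * Re (poly Q (unity_root M (- int k))) + (cmod (poly Q (unity_root M (- int k))))\<^sup>2)"
    by (simp add: q_def exp_sq)
  also have "\<dots> = real M - 2 * Re (\<Sum>k=1..M. poly Q (unity_root M (- int k))) + (\<Sum>k=1..M. (cmod (poly Q (unity_root M (- int k))))\<^sup>2)"
    by (simp add: sum.distrib sum_subtractf sum_distrib_left)
  \<comment> \<open>M - 2 M + M cancels, so only the excess of |Q|^2 over 1 remains. Afterwards M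
    \<le> 3 m turns 28 into 84.\<close>
  also have "\<dots> \<le> real M - 2 * real M + (\<Sum>k=1..M. 1 + exp 28 * (28 * u))"
    unfolding sumQ using bnd by (intro add_mono sum_mono) auto
  also have "\<dots> = real M * exp 28 * (28 * u)" by (simp add: algebra_simps)
  also have "\<dots> \<le> (3 * real m) * exp 28 * (28 * u)"
    using m0 m s by (intro mult_right_mono) (auto simp: M_def u_def)
  also have "\<dots> = 84 * exp 28 * (real s)\<^sup>2 * ln (real m)"
    using m0 by (simp add: u_def)
  finally have 1: "(\<Sum>k=1..M. (cmod (poly q (unity_root M (- int k))))\<^sup>2) \<le> 84 * exp 28 * (real s)\<^sup>2 * ln (real m)" .
  have "degree q \<le> m" unfolding q_def using Q(1) sd by (intro degree_diff_le) auto
  then show ?thesis using that[of q] 1 Q(3) by (simp add: q_def M_def)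
qed

lemma dft_unity_root:
  "dft m x k = complex_of_real (1 / sqrt (2 * real m + 1)) * (\<Sum>\<tau>\<in>{- int m..int m}. unity_root (2*m+1) (- int k * \<tau>) * x \<tau>)"
proof -
  have "exp (- (2 * complex_of_real pi * \<i> * of_nat k * of_int \<tau> / of_nat (2 * m + 1))) = unity_root (2*m+1) (- int k * \<tau>)" for \<tau>
    by (simp add: unity_root_def mult.assoc)
  then show ?thesis by (simp add: dft_def)
qed

text \<open>The 2 m + 1 taps hold exactly a polynomial R of degree 2 m. The recentring by m is
  undone by the shift in the convolution, so the filter acts as R(\<Delta>), and this fixes x
  because p divides 1 - R = (1 - q) (1 + q).\<close>

lemma reproducing_filter:
  assumes s: "1 \<le> s" and m: "2 * s \<le> m" and sm: "(real s)\<^sup>2 * ln (real m) \<le> real m"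
  obtains \<phi> where "\<phi> \<in> filters m"
    "dft_norm1 m \<phi> \<le> 84 * exp 28 * (real s)\<^sup>2 * ln (real m) / sqrt (2 * real m + 1)"
    "\<And>x. x \<in> harmonic_osc_at s \<omega> \<Longrightarrow> convolution \<phi> (shift (int m) x) = x"
proof -
  define p where "p = (\<Prod>k=1..s. [:1, - exp (\<i> * complex_of_real (\<omega> k)):])"
  obtain q :: "complex poly" where q: "degree q \<le> m" "p dvd 1 - q"
    "(\<Sum>k=1..2*m+1. (cmod (poly q (unity_root (2*m+1) (- int k))))\<^sup>2) \<le> 84 * exp 28 * (real s)\<^sup>2 * ln (real m)"
    using reproducing_poly[OF assms, of \<omega>] unfolding p_def by blast
  define R where "R = q\<^sup>2"
  have degR: "degree R \<le> 2 * m"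
    unfolding R_def using q(1) degree_power_le[of q 2] by linarith
  have "1 - R = (1 - q) * (1 + q)" by (simp add: R_def power2_eq_square algebra_simps)
  then have pR: "p dvd 1 - R" using q(2) by simp
  define \<phi> where "\<phi> = (\<lambda>\<tau>. if \<bar>\<tau>\<bar> \<le> int m then coeff R (nat (\<tau> + int m)) else 0)"
  have F: "\<phi> \<in> filters m" by (auto simp: \<phi>_def filters_def)
  have reindex: "(\<Sum>\<tau>\<in>{- int m..int m}. f \<tau> * \<phi> \<tau>) = (\<Sum>j\<le>2*m. f (int j - int m) * coeff R j)" for f :: "int \<Rightarrow> complex"
    by (rule sum.reindex_bij_witness[of _ "\<lambda>j. int j - int m" "\<lambda>\<tau>. nat (\<tau> + int m)"]) (auto simp: \<phi>_def)
  \<comment> \<open>Recentring contributes only a unimodular phase.\<close>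
  have "cmod (dft m \<phi> k) = (cmod (poly q (unity_root (2*m+1) (- int k))))\<^sup>2 / sqrt (2 * real m + 1)" for k
  proof -
    have "(\<Sum>j\<le>2*m. unity_root (2*m+1) (- int k * (int j - int m)) * coeff R j)
      = unity_root (2*m+1) (int k * int m) * (\<Sum>j\<le>2*m. coeff R j * unity_root (2*m+1) (- int k) ^ j)"
      by (simp add: sum_distrib_left unity_root_power algebra_simps flip: unity_root_add)
    also have "(\<Sum>j\<le>2*m. coeff R j * unity_root (2*m+1) (- int k) ^ j) = poly R (unity_root (2*m+1) (- int k))"
      unfolding poly_altdef using degR by (intro sum.mono_neutral_right) (auto simp: coeff_eq_0)
    finally have "(\<Sum>j\<le>2*m. unity_root (2*m+1) (- int k * (int j - int m)) * coeff R j)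
      = unity_root (2*m+1) (int k * int m) * (poly q (unity_root (2*m+1) (- int k)))\<^sup>2"
      by (simp add: R_def)
    then show ?thesis
      by (simp add: dft_unity_root reindex norm_mult norm_power norm_divide)
  qed
  then have "dft_norm1 m \<phi> = (\<Sum>k=1..2*m+1. (cmod (poly q (unity_root (2*m+1) (- int k))))\<^sup>2) / sqrt (2 * real m + 1)"
    by (simp only: dft_norm1_def sum_divide_distrib)
  also have "\<dots> \<le> 84 * exp 28 * (real s)\<^sup>2 * ln (real m) / sqrt (2 * real m + 1)"
    by (intro divide_right_mono q) auto
  finally have N: "dft_norm1 m \<phi> \<le> 84 * exp 28 * (real s)\<^sup>2 * ln (real m) / sqrt (2 * real m + 1)" .
  have "convolution \<phi> (shift (int m) x) t = x t" if "x \<in> harmonic_osc_at s \<omega>" for x t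
  proof -
    have "poly_shift (1 - R) x = (\<lambda>t. 0)"
      using that poly_shift_dvd_0[OF pR] by (simp add: harmonic_osc_at_def p_def)
    then have "poly_shift R x t = poly_shift ((1 - R) + R) x t" by (simp only: poly_shift_add add_0)
    then have x: "poly_shift R x t = x t" by simp
    have "convolution \<phi> (shift (int m) x) t = (\<Sum>\<tau>\<in>{- int m..int m}. x (t - \<tau> - int m) * \<phi> \<tau>)"
      by (simp add: convolution_filter[OF F] shift_def mult.commute)
    also have "\<dots> = (\<Sum>j\<le>2*m. x (t - (int j - int m) - int m) * coeff R j)"
      by (rule reindex)
    also have "\<dots> = poly_shift R x t"
      by (simp add: poly_shift_atMost[OF degR] mult.commute)
    finally show ?thesis using x by simp
  qed
  then show ?thesis using that F N by blast
qed

definition dft_atom :: "nat \<Rightarrow> nat \<Rightarrow> signal" where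
  "dft_atom m k = (\<lambda>\<tau>. if \<bar>\<tau>\<bar> \<le> int m then unity_root (2*m+1) (int k * \<tau>) / of_real (sqrt (2 * real m + 1)) else 0)"

lemma dft_atom_in_filters: "dft_atom m k \<in> filters m"
  by (auto simp: dft_atom_def filters_def)

lemma cmod_dft_atom_le: "cmod (dft_atom m k \<tau>) \<le> 1 / sqrt (2 * real m + 1)"
  by (simp add: dft_atom_def norm_divide)

text \<open>The atoms are the columns of the inverse of the unitary DFT. Two indices in the band
  differ by at most 2 m, so the character sum over 2 m + 1 roots vanishes unless they
  coincide.\<close>

lemma dft_inversion:
  assumes "\<phi> \<in> filters m"
  shows "\<phi> \<tau> = (\<Sum>k=1..2*m+1. dft m \<phi> k * dft_atom m k \<tau>)"
proof (cases "\<bar>\<tau>\<bar> \<le> int m")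
  case False
  then have "\<tau> \<notin> {- int m..int m}" by auto
  then show ?thesis using assms False by (simp add: filters_def dft_atom_def)
next
  case True
  define M where "M = 2 * m + 1"
  define S where "S = complex_of_real (sqrt (2 * real m + 1))"
  have "S * S = of_real (2 * real m + 1)" unfolding S_def of_real_mult[symmetric] by simp
  then have SS: "S * S = of_nat M" by (simp add: M_def)
  have S0: "S \<noteq> 0" using SS by (auto simp: M_def simp del: of_nat_Suc)
  have dv: "int M dvd \<tau> - \<sigma> \<longleftrightarrow> \<sigma> = \<tau>" if "\<sigma> \<in> {- int m..int m}" for \<sigma>
  proof
    assume "int M dvd \<tau> - \<sigma>"
    moreover have "\<bar>\<tau> - \<sigma>\<bar> < int M" using that True by (auto simp: M_def)
    ultimately show "\<sigma> = \<tau>" using dvd_imp_le_int[of "\<tau> - \<sigma>" "int M"] by fastforce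
  qed simp
  have U: "unity_root M (int k * (\<tau> - \<sigma>)) = unity_root M (- int k * \<sigma>) * unity_root M (int k * \<tau>)" for k \<sigma>
    by (simp add: algebra_simps flip: unity_root_add)
  have "dft m \<phi> k * dft_atom m k \<tau> = (\<Sum>\<sigma>\<in>{- int m..int m}. \<phi> \<sigma> * unity_root M (int k * (\<tau> - \<sigma>)) / (S * S))" for k
  proof -
    have "dft m \<phi> k * dft_atom m k \<tau> = (\<Sum>\<sigma>\<in>{- int m..int m}. unity_root M (- int k * \<sigma>) * \<phi> \<sigma>) * (unity_root M (int k * \<tau>) / (S * S))"
      using True by (simp add: dft_unity_root dft_atom_def M_def S_def)
    then show ?thesis unfolding sum_distrib_right by (simp add: U mult_ac)
  qed
  then have "(\<Sum>k=1..M. dft m \<phi> k * dft_atom m k \<tau>)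
     = (\<Sum>k=1..M. \<Sum>\<sigma>\<in>{- int m..int m}. \<phi> \<sigma> * unity_root M (int k * (\<tau> - \<sigma>)) / (S * S))"
    by simp
  also have "\<dots> = (\<Sum>\<sigma>\<in>{- int m..int m}. \<phi> \<sigma> * (\<Sum>k=1..M. unity_root M (int k * (\<tau> - \<sigma>))) / (S * S))"
    by (subst sum.swap) (simp add: sum_distrib_left sum_divide_distrib)
  also have "\<dots> = (\<Sum>\<sigma>\<in>{- int m..int m}. if \<sigma> = \<tau> then \<phi> \<sigma> else 0)"
  proof (rule sum.cong[OF refl])
    fix \<sigma> assume "\<sigma> \<in> {- int m..int m}"
    moreover have "0 < M" by (simp add: M_def)
    ultimately have "(\<Sum>k=1..M. unity_root M (int k * (\<tau> - \<sigma>))) = (if \<sigma> = \<tau> then S * S else 0)"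
      using sum_unity_root[of M "\<tau> - \<sigma>"] dv[of \<sigma>] SS by simp
    then show "\<phi> \<sigma> * (\<Sum>k=1..M. unity_root M (int k * (\<tau> - \<sigma>))) / (S * S) = (if \<sigma> = \<tau> then \<phi> \<sigma> else 0)"
      using S0 by auto
  qed
  also have "\<dots> = \<phi> \<tau>" using True by auto
  finally show ?thesis by (simp add: M_def)
qed

text \<open>Supplies the tap bound that \<open>delay_tail\<close> needs for a filter known only
  through its norm.\<close>

lemma cmod_filter_le:
  assumes "\<phi> \<in> filters m"
  shows "cmod (\<phi> \<tau>) \<le> dft_norm1 m \<phi> / sqrt (2 * real m + 1)"
proof -
  have "cmod (\<phi> \<tau>) \<le> (\<Sum>k=1..2*m+1. cmod (dft m \<phi> k) * cmod (dft_atom m k \<tau>))"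
    unfolding dft_inversion[OF assms, of \<tau>] by (rule order.trans[OF norm_sum]) (simp add: norm_mult)
  also have "\<dots> \<le> (\<Sum>k=1..2*m+1. cmod (dft m \<phi> k) * (1 / sqrt (2 * real m + 1)))"
    by (intro sum_mono mult_left_mono cmod_dft_atom_le) auto
  finally show ?thesis by (simp only: dft_norm1_def sum_divide_distrib times_divide_eq_right mult_1_right)
qed

section \<open>The space of harmonic oscillations\<close>

text \<open>Variation of constants, normalized by B 0 = 0. Signals are two-sided, so the sum runs
  forwards for t > 0 and backwards for t < 0.\<close>

lemma finite_difference_exists:
  fixes w :: complex and b :: "int \<Rightarrow> complex"
  assumes "w \<noteq> 0"
  obtains B where "\<And>t. B t - w * B (t - 1) = b t"
proof -
  define B where "B t = (if t \<ge> 0 then w powi t * (\<Sum>j\<in>{1..t}. w powi (- j) * b j)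
     else - (w powi t * (\<Sum>j\<in>{t<..0}. w powi (- j) * b j)))" for t
  have pw: "w powi t = w * w powi (t - 1)" for t
    using assms by (simp add: power_int_diff)
  have "B t - w * B (t - 1) = b t" for t
  proof (cases "t \<ge> 1")
    case True
    then have "{1..t} = insert t {1..t-1}" by auto
    then have "B t = w powi t * (w powi (- t) * b t) + w powi t * (\<Sum>j\<in>{1..t-1}. w powi (- j) * b j)"
      using True by (simp add: B_def ring_distribs)
    moreover have "w powi t * w powi (- t) = 1" using assms by (simp add: power_int_minus)
    ultimately show ?thesis using True pw[of t] by (simp add: B_def mult.assoc[symmetric])
  next
    case False
    then have "{t-1<..0} = insert t {t<..0}" by auto
    then have "B (t - 1) = - (w powi (t - 1) * (w powi (- t) * b t + (\<Sum>j\<in>{t<..0}. w powi (- j) * b j)))"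
      using False by (simp add: B_def)
    then have "w * B (t - 1) = - (w powi t * w powi (- t) * b t) - w powi t * (\<Sum>j\<in>{t<..0}. w powi (- j) * b j)"
      unfolding pw[of t] by (simp add: ring_distribs mult.assoc)
    moreover have "w powi t * w powi (- t) = 1" using assms by (simp add: power_int_minus)
    ultimately show ?thesis using False by (simp add: B_def)
  qed
  then show ?thesis using that by blast
qed

lemma first_order_recurrence:
  fixes w :: complex
  assumes "w \<noteq> 0" "\<And>t. x t - w * x (t - 1) = 0"
  shows "x t = x 0 * w powi t"
proof -
  have pw: "w powi t = w * w powi (t - 1)" for t
    using assms by (simp add: power_int_diff)
  show ?thesis
  proof (induction t rule: int_induct[where k = 0])
    case base then show ?case by simp
  next
    case (step1 i)
    then show ?case using assms(2)[of "i + 1"] pw[of "i + 1"] by simp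
  next
    case (step2 i)
    then show ?case using assms(1) assms(2)[of i] pw[of i] by simp
  qed
qed

text \<open>Induction over the factors: the last first-order operator maps a solution into the span
  already found, each \<open>b i\<close> is lifted to \<open>B i\<close>, and the remainder solves a
  homogeneous first-order recurrence. Avoiding explicit signals t^j w^t means that coinciding
  frequencies need no separate case.\<close>

lemma kernel_spanned:
  fixes w :: "nat \<Rightarrow> complex" and s :: nat
  assumes "\<And>k. w k \<noteq> 0"
  shows "\<exists>b. \<forall>x. poly_shift (\<Prod>k=1..s. [:1, - w k:]) x = (\<lambda>t. 0) \<longrightarrow> (\<exists>c. \<forall>t. x t = (\<Sum>i<s. c i * b i t))"
proof (induction s)
  case 0
  then show ?case by simp
next
  case (Suc s)
  then obtain b where b: "\<And>x. poly_shift (\<Prod>k=1..s. [:1, - w k:]) x = (\<lambda>t. 0) \<Longrightarrow> \<exists>c. \<forall>t. x t = (\<Sum>i<s. c i * b i t)"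
    by blast
  define v where "v = w (Suc s)"
  have v: "v \<noteq> 0" using assms by (simp add: v_def)
  have "\<forall>i. \<exists>B. \<forall>t. B t - v * B (t - 1) = b i t" using finite_difference_exists[OF v] by metis
  then obtain B where B: "\<And>i t. B i t - v * B i (t - 1) = b i t" by metis
  define b' where "b' i = (if i < s then B i else (\<lambda>t. v powi t))" for i
  have "\<exists>c. \<forall>t. x t = (\<Sum>i<Suc s. c i * b' i t)"
    if x: "poly_shift (\<Prod>k=1..Suc s. [:1, - w k:]) x = (\<lambda>t. 0)" for x
  proof -
    have pr: "(\<Prod>k=1..Suc s. [:1, - w k:]) = (\<Prod>k=1..s. [:1, - w k:]) * [:1, - v:]"
      unfolding v_def by (subst prod.nat_ivl_Suc') (simp, rule mult.commute)
    have "poly_shift (\<Prod>k=1..s. [:1, - w k:]) (poly_shift [:1, - v:] x) = (\<lambda>t. 0)"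
      using x unfolding pr by (simp only: fun_eq_iff poly_shift_mult) simp
    then obtain c where c: "\<And>t. poly_shift [:1, - v:] x t = (\<Sum>i<s. c i * b i t)" using b by blast
    define y where "y t = x t - (\<Sum>i<s. c i * B i t)" for t
    have "y t - v * y (t - 1) = 0" for t
    proof -
      have "y t - v * y (t - 1) = (x t - v * x (t - 1)) - (\<Sum>i<s. c i * (B i t - v * B i (t - 1)))"
        by (simp add: y_def right_diff_distrib sum_subtractf sum_distrib_left mult.left_commute[of v])
      also have "\<dots> = 0" using c[of t] by (simp add: B poly_shift_pCons)
      finally show ?thesis .
    qed
    then have y: "y t = y 0 * v powi t" for t using first_order_recurrence[OF v] by blast
    have "x t = (\<Sum>i<s. c i * B i t) + y 0 * v powi t" for t
      unfolding y[of t, symmetric] by (simp add: y_def)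
    then have "x t = (\<Sum>i<Suc s. (c(s := y 0)) i * b' i t)" for t
      by (simp add: b'_def)
    then show ?thesis by blast
  qed
  then show ?case by blast
qed

section \<open>Inner products on finite windows and Parseval frames\<close>

definition ip :: "int set \<Rightarrow> signal \<Rightarrow> signal \<Rightarrow> complex" where
  "ip D u v = (\<Sum>t\<in>D. cnj (u t) * v t)"

definition nrm :: "int set \<Rightarrow> signal \<Rightarrow> real" where
  "nrm D v = L2_set (\<lambda>t. cmod (v t)) D"

lemma nrm_nonneg [simp]: "0 \<le> nrm D v"
  by (simp add: nrm_def)

lemma nrm_power2: "(nrm D v)\<^sup>2 = (\<Sum>t\<in>D. (cmod (v t))\<^sup>2)"
  by (simp add: nrm_def L2_set_def sum_nonneg)

lemma ip_self: "ip D v v = of_real ((nrm D v)\<^sup>2)"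
  by (simp add: ip_def nrm_power2 complex_norm_square mult.commute del: of_real_power)

lemma ip_add_right: "ip D u (\<lambda>t. v t + w t) = ip D u v + ip D u w"
  by (simp add: ip_def ring_distribs sum.distrib)

lemma ip_diff_right: "ip D u (\<lambda>t. v t - w t) = ip D u v - ip D u w"
  by (simp add: ip_def ring_distribs sum_subtractf)

lemma ip_scale_right: "ip D u (\<lambda>t. c * v t) = c * ip D u v"
  by (simp add: ip_def sum_distrib_left mult.left_commute)

lemma ip_sum_right: "ip D u (\<lambda>t. \<Sum>i\<in>A. f i t) = (\<Sum>i\<in>A. ip D u (f i))"
  unfolding ip_def sum_distrib_left by (rule sum.swap)

lemma cnj_ip: "cnj (ip D u v) = ip D v u"
  by (simp add: ip_def mult.commute)

lemma ip_cong: "(\<And>t. t \<in> D \<Longrightarrow> u t = u' t) \<Longrightarrow> (\<And>t. t \<in> D \<Longrightarrow> v t = v' t) \<Longrightarrow> ip D u v = ip D u' v'"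
  by (simp add: ip_def)

lemma nrm_cong: "(\<And>t. t \<in> D \<Longrightarrow> u t = u' t) \<Longrightarrow> nrm D u = nrm D u'"
  by (simp add: nrm_power2 L2_set_def nrm_def)

lemma nrm_triangle: "nrm D (\<lambda>t. u t + v t) \<le> nrm D u + nrm D v"
  unfolding nrm_def
  by (rule order.trans[OF L2_set_mono L2_set_triangle_ineq]) (auto intro: norm_triangle_ineq)

lemma nrm_scale: "nrm D (\<lambda>t. c * v t) = cmod c * nrm D v"
  unfolding nrm_def norm_mult using L2_set_right_distrib[of "cmod c" "\<lambda>t. cmod (v t)" D] by simp

lemma nrm_diff: "nrm D (\<lambda>t. u t - v t) \<le> nrm D u + nrm D v"
  using nrm_triangle[of D u "\<lambda>t. (-1) * v t"] nrm_scale[of D "-1" v] by simp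

lemma nrm_sum: "nrm D (\<lambda>t. \<Sum>i\<in>A. f i t) \<le> (\<Sum>i\<in>A. nrm D (f i))"
proof (induction A rule: infinite_finite_induct)
  case (insert a A)
  then show ?case using nrm_triangle[of D "f a" "\<lambda>t. \<Sum>i\<in>A. f i t"] by simp
qed (simp_all add: nrm_def L2_set_def)

text \<open>Gram--Schmidt in the form of a Parseval frame: vanishing remainders give zero
  vectors, so no linear independence is required.\<close>

lemma gram_schmidt_frame:
  fixes s :: nat
  assumes "finite D"
  shows "\<exists>e. (\<forall>i<s. nrm D (e i) \<le> 1) \<and> (\<forall>j<s. \<forall>t\<in>D. e j t = (\<Sum>i<s. ip D (e i) (e j) * e i t))
    \<and> (\<forall>j<s. \<forall>t\<in>D. b j t = (\<Sum>i<s. ip D (e i) (b j) * e i t))"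
proof (induction s)
  case 0
  then show ?case by simp
next
  case (Suc s)
  then obtain e where e0: "\<forall>i<s. nrm D (e i) \<le> 1"
    "\<forall>j<s. \<forall>t\<in>D. e j t = (\<Sum>i<s. ip D (e i) (e j) * e i t)"
    "\<forall>j<s. \<forall>t\<in>D. b j t = (\<Sum>i<s. ip D (e i) (b j) * e i t)" by blast
  note e = e0[rule_format]
  define r where "r t = b s t - (\<Sum>i<s. ip D (e i) (b s) * e i t)" for t
  define N where "N = nrm D r"
  \<comment> \<open>For N = 0 the quotient \<open>1 / N\<close> is 0, so f is the zero vector and
    satisfies the frame identities trivially.\<close>
  define f where "f t = of_real (1 / N) * r t" for t
  \<comment> \<open>The remainder is orthogonal to everything the old frame reproduces, so appending
    f only adds a zero coefficient there (\<open>keep\<close>).\<close>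
  have ip_rv: "ip D r v = 0" if "\<And>t. t \<in> D \<Longrightarrow> v t = (\<Sum>i<s. ip D (e i) v * e i t)" for v
  proof -
    have "ip D v r = ip D v (b s) - (\<Sum>i<s. ip D (e i) (b s) * ip D v (e i))"
      by (simp add: r_def[abs_def] ip_diff_right ip_sum_right ip_scale_right)
    also have "(\<Sum>i<s. ip D (e i) (b s) * ip D v (e i)) = cnj (ip D (b s) (\<lambda>t. \<Sum>i<s. ip D (e i) v * e i t))"
      by (simp add: ip_sum_right ip_scale_right cnj_ip) (simp add: mult.commute)
    also have "ip D (b s) (\<lambda>t. \<Sum>i<s. ip D (e i) v * e i t) = ip D (b s) v"
      using that by (intro ip_cong) auto
    finally have "ip D v r = 0" by (simp add: cnj_ip)
    then show ?thesis by (metis cnj_ip complex_cnj_zero)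
  qed
  have ip_f: "ip D f v = of_real (1 / N) * ip D r v" for v
    by (simp add: f_def[abs_def] ip_def sum_distrib_left mult.assoc)
  have keep: "v t = (\<Sum>i<Suc s. ip D ((e(s := f)) i) v * (e(s := f)) i t)"
    if "\<And>t. t \<in> D \<Longrightarrow> v t = (\<Sum>i<s. ip D (e i) v * e i t)" "t \<in> D" for v t
    using that(1)[OF that(2)] ip_rv[OF that(1)] by (simp add: ip_f)
  have re: "ip D r (e i) = 0" if "i < s" for i using ip_rv[of "e i"] e(2)[OF that] by blast
  have er: "ip D (e i) r = 0" if "i < s" for i using re[OF that] cnj_ip[of D r "e i"] by simp
  have rb: "ip D r (b s) = of_real (N\<^sup>2)"
  proof -
    have "ip D r (b s) = ip D r (\<lambda>t. r t + (\<Sum>i<s. ip D (e i) (b s) * e i t))" by (simp add: r_def)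
    also have "\<dots> = ip D r r + (\<Sum>i<s. ip D (e i) (b s) * ip D r (e i))"
      by (simp add: ip_add_right ip_sum_right ip_scale_right)
    finally show ?thesis using re by (simp add: ip_self N_def)
  qed
  have r0: "r t = 0" if "N = 0" "t \<in> D" for t
    using that assms nrm_power2[of D r] by (simp add: N_def sum_nonneg_eq_0_iff)
  have nf: "nrm D f \<le> 1"
    unfolding f_def[abs_def] nrm_scale using N_def by (simp add: norm_divide divide_simps)
  have ff: "f t = ip D f f * f t" if "t \<in> D" for t
  proof (cases "N = 0")
    case True then show ?thesis by (simp add: f_def)
  next
    case False
    then have "ip D f f = 1"
      unfolding ip_self f_def[abs_def] nrm_scale using N_def by (simp add: norm_divide divide_simps)
    then show ?thesis by simp
  qed
  have ef: "ip D (e i) f = 0" if "i < s" for i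
    unfolding f_def[abs_def] ip_scale_right by (simp add: er[OF that])
  have fb: "ip D f (b s) * f t = r t" if "t \<in> D" for t
    using r0 that unfolding ip_f rb by (cases "N = 0") (auto simp: f_def power2_eq_square)
  have "\<forall>i<Suc s. nrm D ((e(s := f)) i) \<le> 1" using e(1) nf by (auto simp: less_Suc_eq)
  moreover have "\<forall>j<Suc s. \<forall>t\<in>D. (e(s := f)) j t = (\<Sum>i<Suc s. ip D ((e(s := f)) i) ((e(s := f)) j) * (e(s := f)) i t)"
  proof (intro allI impI ballI)
    fix j t assume j: "j < Suc s" and t: "t \<in> D"
    show "(e(s := f)) j t = (\<Sum>i<Suc s. ip D ((e(s := f)) i) ((e(s := f)) j) * (e(s := f)) i t)"
    proof (cases "j < s")
      case True
      then show ?thesis using keep[of "e j" t] e(2)[OF True] t by (simp del: sum.lessThan_Suc)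
    next
      case False
      then have "j = s" using j by simp
      then show ?thesis using ef ff[OF t] by simp
    qed
  qed
  moreover have "\<forall>j<Suc s. \<forall>t\<in>D. b j t = (\<Sum>i<Suc s. ip D ((e(s := f)) i) (b j) * (e(s := f)) i t)"
  proof (intro allI impI ballI)
    fix j t assume j: "j < Suc s" and t: "t \<in> D"
    show "b j t = (\<Sum>i<Suc s. ip D ((e(s := f)) i) (b j) * (e(s := f)) i t)"
    proof (cases "j < s")
      case True
      then show ?thesis using keep[of "b j" t] e(3)[OF True] t by (simp del: sum.lessThan_Suc)
    next
      case False
      then have "j = s" using j by simp
      then show ?thesis using fb[OF t] by (simp add: r_def)
    qed
  qed
  ultimately show ?case by blast
qed

text \<open>Parseval on the span, then Cauchy-Schwarz for the frame coefficients. The gain is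
  uniformity: v may depend on z, yet z enters through s numbers that do not involve v.\<close>

lemma span_frame:
  fixes s :: nat
  assumes "finite D"
  obtains e where "\<And>i. i < s \<Longrightarrow> nrm D (e i) \<le> 1"
    "\<And>v z c. (\<And>t. t \<in> D \<Longrightarrow> v t = (\<Sum>i<s. c i * b i t)) \<Longrightarrow>
       cmod (ip D z v) \<le> sqrt (\<Sum>i<s. (cmod (ip D (e i) z))\<^sup>2) * nrm D v"
proof -
  obtain e where e0: "\<forall>i<s. nrm D (e i) \<le> 1"
    "\<forall>j<s. \<forall>t\<in>D. b j t = (\<Sum>i<s. ip D (e i) (b j) * e i t)"
    using gram_schmidt_frame[OF assms, of s b] by blast
  note e = e0[rule_format]
  have "cmod (ip D z v) \<le> sqrt (\<Sum>i<s. (cmod (ip D (e i) z))\<^sup>2) * nrm D v"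
    if v: "\<And>t. t \<in> D \<Longrightarrow> v t = (\<Sum>i<s. c i * b i t)" for v z c
  proof -
    have ipv: "ip D u v = (\<Sum>j<s. c j * ip D u (b j))" for u
      using ip_cong[of D u u v "\<lambda>t. \<Sum>i<s. c i * b i t"] v by (simp add: ip_sum_right ip_scale_right)
    have vt: "v t = (\<Sum>i<s. ip D (e i) v * e i t)" if "t \<in> D" for t
    proof -
      have "v t = (\<Sum>j<s. c j * (\<Sum>i<s. ip D (e i) (b j) * e i t))"
        using v[OF that] e(2)[OF _ that] by simp
      also have "\<dots> = (\<Sum>i<s. (\<Sum>j<s. c j * ip D (e i) (b j)) * e i t)"
        unfolding sum_distrib_left sum_distrib_right by (subst sum.swap) (simp add: mult.assoc)
      finally show ?thesis by (simp add: ipv)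
    qed
    have ex: "ip D u v = (\<Sum>i<s. ip D (e i) v * ip D u (e i))" for u
      using ip_cong[of D u u v "\<lambda>t. \<Sum>i<s. ip D (e i) v * e i t"] vt by (simp add: ip_sum_right ip_scale_right)
    have "ip D v v = (\<Sum>i<s. ip D (e i) v * cnj (ip D (e i) v))" unfolding ex[of v] by (simp add: cnj_ip)
    also have "\<dots> = of_real (\<Sum>i<s. (cmod (ip D (e i) v))\<^sup>2)" by (simp add: complex_norm_square del: of_real_power)
    finally have P: "(nrm D v)\<^sup>2 = (\<Sum>i<s. (cmod (ip D (e i) v))\<^sup>2)" unfolding ip_self of_real_eq_iff .
    have "cmod (ip D z v) \<le> (\<Sum>i<s. \<bar>cmod (ip D (e i) z)\<bar> * \<bar>cmod (ip D (e i) v)\<bar>)"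
      unfolding ex[of z] by (rule order.trans[OF norm_sum])
        (simp add: norm_mult mult.commute complex_mod_cnj[of "ip D z _", symmetric, unfolded cnj_ip])
    also have "\<dots> \<le> L2_set (\<lambda>i. cmod (ip D (e i) z)) {..<s} * L2_set (\<lambda>i. cmod (ip D (e i) v)) {..<s}"
      by (rule L2_set_mult_ineq)
    also have "L2_set (\<lambda>i. cmod (ip D (e i) v)) {..<s} = nrm D v"
      unfolding L2_set_def P[symmetric] by simp
    finally show ?thesis by (simp add: L2_set_def)
  qed
  then show ?thesis using that e(1) by blast
qed

lemma harmonic_spanned:
  obtains b where "\<And>x. x \<in> harmonic_osc_at s \<omega> \<Longrightarrow> \<exists>c. \<forall>t. x t = (\<Sum>i<s. c i * b i t)"
  using kernel_spanned[of "\<lambda>k. exp (\<i> * complex_of_real (\<omega> k))" s]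
  unfolding harmonic_osc_at_def by auto

section \<open>Gaussian vectors\<close>

abbreviation "std_normal \<equiv> density lborel std_normal_density"

lemma prob_space_std_normal: "prob_space std_normal"
  by (rule prob_space_normal_density) simp

lemma nn_integral_normal_density: "0 < \<sigma> \<Longrightarrow> (\<integral>\<^sup>+x. ennreal (normal_density \<mu> \<sigma> x) \<partial>lborel) = 1"
  using prob_space.emeasure_space_1[OF prob_space_normal_density[of \<sigma> \<mu>]] by (simp add: emeasure_density)

lemma std_normal_laplace: "(\<integral>\<^sup>+x. ennreal (exp (c * x)) \<partial>std_normal) = ennreal (exp (c\<^sup>2 / 2))"
proof -
  have "std_normal_density x * exp (c * x) = exp (c\<^sup>2 / 2) * normal_density c 1 x" for x
    by (simp add: normal_density_def power2_eq_square algebra_simps diff_divide_distrib add_divide_distrib flip: exp_add)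
  then have "(\<integral>\<^sup>+x. ennreal (exp (c * x)) \<partial>std_normal) = (\<integral>\<^sup>+x. ennreal (exp (c\<^sup>2 / 2)) * ennreal (normal_density c 1 x) \<partial>lborel)"
    by (simp add: nn_integral_density flip: ennreal_mult)
  then show ?thesis by (simp add: nn_integral_cmult nn_integral_normal_density)
qed

text \<open>The rate 1 / 8 is below the critical 1 / 2; the tilted density is, up to the constant 2
  / sqrt 3, a Gaussian density of variance 4 / 3.\<close>

lemma std_normal_exp_square: "(\<integral>\<^sup>+x. ennreal (exp (x\<^sup>2 / 8)) \<partial>std_normal) = ennreal (2 / sqrt 3)"
proof -
  have "sqrt 8 = 2 * sqrt 2" using real_sqrt_mult[of 4 2] by simp
  then have "std_normal_density x * exp (x\<^sup>2 / 8) = (2 / sqrt 3) * normal_density 0 (2 / sqrt 3) x" for x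
    by (simp add: normal_density_def power_divide real_sqrt_divide real_sqrt_mult field_simps flip: exp_add)
  then have "(\<integral>\<^sup>+x. ennreal (exp (x\<^sup>2 / 8)) \<partial>std_normal) = (\<integral>\<^sup>+x. ennreal (2 / sqrt 3) * ennreal (normal_density 0 (2 / sqrt 3) x) \<partial>lborel)"
    by (simp add: nn_integral_density del: ennreal_mult flip: ennreal_mult)
  then show ?thesis by (simp add: nn_integral_cmult nn_integral_normal_density del: ennreal_mult)
qed

lemma measurable_Complex: "(\<lambda>(a, b). Complex a b) \<in> std_normal \<Otimes>\<^sub>M std_normal \<rightarrow>\<^sub>M borel"
  unfolding Complex_eq by (simp add: case_prod_beta)

lemma sets_complex_gaussian [measurable_cong, simp]: "sets complex_gaussian = sets borel"
  by (simp add: complex_gaussian_def)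

lemma space_complex_gaussian [simp]: "space complex_gaussian = UNIV"
  by (simp add: complex_gaussian_def)

lemma nn_integral_complex_gaussian:
  assumes [measurable]: "f \<in> borel_measurable borel"
  shows "(\<integral>\<^sup>+z. f z \<partial>complex_gaussian) = (\<integral>\<^sup>+x. (\<integral>\<^sup>+y. f (Complex x y) \<partial>std_normal) \<partial>std_normal)"
proof -
  interpret prob_space std_normal by (rule prob_space_std_normal)
  have [measurable]: "(\<lambda>p. Complex (fst p) (snd p)) \<in> std_normal \<Otimes>\<^sub>M std_normal \<rightarrow>\<^sub>M borel"
    using measurable_Complex by (simp add: case_prod_beta)
  have "(\<integral>\<^sup>+z. f z \<partial>complex_gaussian) = (\<integral>\<^sup>+p. f (Complex (fst p) (snd p)) \<partial>(std_normal \<Otimes>\<^sub>M std_normal))"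
    unfolding complex_gaussian_def by (subst nn_integral_distr) (use measurable_Complex in \<open>auto simp: case_prod_beta\<close>)
  then show ?thesis by (subst (asm) nn_integral_fst[symmetric]) auto
qed

lemma prob_space_complex_gaussian: "prob_space complex_gaussian"
proof -
  interpret prob_space std_normal by (rule prob_space_std_normal)
  interpret pair_prob_space std_normal std_normal by unfold_locales
  show ?thesis unfolding complex_gaussian_def by (rule prob_space_distr[OF measurable_Complex])
qed

lemma complex_gaussian_laplace:
  "(\<integral>\<^sup>+z. ennreal (exp (Re (c * z))) \<partial>complex_gaussian) = ennreal (exp ((cmod c)\<^sup>2 / 2))"
proof -
  have "(\<integral>\<^sup>+z. ennreal (exp (Re (c * z))) \<partial>complex_gaussian)
     = (\<integral>\<^sup>+x. (\<integral>\<^sup>+y. ennreal (exp (Re c * x)) * ennreal (exp (- Im c * y)) \<partial>std_normal) \<partial>std_normal)"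
    by (subst nn_integral_complex_gaussian) (simp_all flip: ennreal_mult exp_add)
  also have "\<dots> = ennreal (exp ((Re c)\<^sup>2 / 2)) * ennreal (exp ((- Im c)\<^sup>2 / 2))"
    using std_normal_laplace[of "- Im c"]
    by (simp add: nn_integral_cmult nn_integral_multc std_normal_laplace)
  also have "\<dots> = ennreal (exp ((cmod c)\<^sup>2 / 2))"
    by (simp add: cmod_power2 add_divide_distrib exp_add flip: ennreal_mult)
  finally show ?thesis .
qed

text \<open>Two real coordinates give (2 / sqrt 3)^2 = 4 / 3, the prefactor of all sum-of-squares
  tails below.\<close>

lemma complex_gaussian_exp_square:
  "(\<integral>\<^sup>+z. ennreal (exp ((cmod z)\<^sup>2 / 8)) \<partial>complex_gaussian) = ennreal (4 / 3)"
proof -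
  have "(\<integral>\<^sup>+z. ennreal (exp ((cmod z)\<^sup>2 / 8)) \<partial>complex_gaussian)
     = (\<integral>\<^sup>+x. (\<integral>\<^sup>+y. ennreal (exp (x\<^sup>2 / 8)) * ennreal (exp (y\<^sup>2 / 8)) \<partial>std_normal) \<partial>std_normal)"
    by (subst nn_integral_complex_gaussian) (simp_all add: cmod_power2 add_divide_distrib flip: ennreal_mult exp_add)
  also have "\<dots> = ennreal (2 / sqrt 3) * ennreal (2 / sqrt 3)"
    by (simp add: nn_integral_cmult nn_integral_multc std_normal_exp_square del: ennreal_mult)
  also have "\<dots> = ennreal (4 / 3)"
    by (subst ennreal_mult[symmetric]) auto
  finally show ?thesis .
qed

section \<open>Vectors of independent complex Gaussians\<close>

abbreviation gaussian_vector :: "int set \<Rightarrow> signal measure" where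
  "gaussian_vector J \<equiv> PiM J (\<lambda>_. complex_gaussian)"

interpretation gaussian: product_prob_space "\<lambda>_::int. complex_gaussian" J for J
  by (intro product_prob_spaceI prob_space_complex_gaussian)

lemma measurable_coordinate:
  "s \<in> J \<Longrightarrow> (\<lambda>\<zeta>. \<zeta> s) \<in> borel_measurable (gaussian_vector J)"
  using measurable_component_singleton[of s J "\<lambda>_. complex_gaussian"] by simp

lemma borel_measurable_cnj: "cnj \<in> borel_measurable borel"
  by (intro borel_measurable_continuous_onI continuous_intros)

lemma measurable_linear_form [measurable]:
  assumes "A \<subseteq> J"
  shows "(\<lambda>\<zeta>. \<Sum>s\<in>A. c s * \<zeta> s) \<in> borel_measurable (gaussian_vector J)"
  using assms by (intro borel_measurable_sum borel_measurable_times measurable_coordinate borel_measurable_const) auto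

lemma linear_form_laplace:
  assumes "finite J"
  shows "(\<integral>\<^sup>+\<zeta>. ennreal (exp (Re (\<Sum>s\<in>J. c s * \<zeta> s))) \<partial>gaussian_vector J) = ennreal (exp ((\<Sum>s\<in>J. (cmod (c s))\<^sup>2) / 2))"
proof -
  have "(\<integral>\<^sup>+\<zeta>. ennreal (exp (Re (\<Sum>s\<in>J. c s * \<zeta> s))) \<partial>gaussian_vector J)
    = (\<integral>\<^sup>+\<zeta>. (\<Prod>s\<in>J. ennreal (exp (Re (c s * \<zeta> s)))) \<partial>gaussian_vector J)"
    using assms by (simp add: exp_sum prod_ennreal del: Re_complex_of_real times_complex.sel)
  also have "\<dots> = (\<Prod>s\<in>J. ennreal (exp ((cmod (c s))\<^sup>2 / 2)))"
    using assms by (subst gaussian.product_nn_integral_prod) (auto simp: complex_gaussian_laplace simp del: times_complex.sel)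
  also have "\<dots> = ennreal (exp ((\<Sum>s\<in>J. (cmod (c s))\<^sup>2) / 2))"
    using assms by (simp add: prod_ennreal exp_sum sum_divide_distrib)
  finally show ?thesis .
qed

text \<open>The square is linearized by averaging over an auxiliary Gaussian \<open>g\<close>:
  \<open>exp (\<bar>w\<bar>\<^sup>2 / 2)\<close> is the mean of \<open>exp (Re (w g))\<close>.\<close>

lemma linear_form_exp_square:
  assumes J: "finite J" and T: "T = (\<Sum>s\<in>J. (cmod (c s))\<^sup>2)" "0 < T"
  shows "(\<integral>\<^sup>+\<zeta>. ennreal (exp ((cmod (\<Sum>s\<in>J. c s * \<zeta> s))\<^sup>2 / (8 * T))) \<partial>gaussian_vector J) = ennreal (4 / 3)"
proof -
  interpret G: prob_space complex_gaussian by (rule prob_space_complex_gaussian)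
  interpret P: pair_sigma_finite "gaussian_vector J" complex_gaussian
    by unfold_locales
  \<comment> \<open>Scaled so that averaging exp (Re (r l g)) over g gives exp (|l|^2 / (8 T)) for
    the linear form l. After the exchange of integrals the coefficients \<open>r * g * c s\<close>
    have total energy |g|^2 / 4, whatever c is.\<close>
  define r where "r = complex_of_real (1 / (2 * sqrt T))"
  have r: "(cmod r)\<^sup>2 = 1 / (4 * T)" using T(2) by (simp add: r_def norm_divide power_divide power_mult_distrib)
  have "(\<integral>\<^sup>+\<zeta>. ennreal (exp ((cmod (\<Sum>s\<in>J. c s * \<zeta> s))\<^sup>2 / (8 * T))) \<partial>gaussian_vector J)
    = (\<integral>\<^sup>+\<zeta>. (\<integral>\<^sup>+g. ennreal (exp (Re (r * (\<Sum>s\<in>J. c s * \<zeta> s) * g))) \<partial>complex_gaussian) \<partial>gaussian_vector J)"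
    by (intro nn_integral_cong, subst complex_gaussian_laplace) (simp add: norm_mult power_mult_distrib r)
  also have "\<dots> = (\<integral>\<^sup>+g. (\<integral>\<^sup>+\<zeta>. ennreal (exp (Re (r * (\<Sum>s\<in>J. c s * \<zeta> s) * g))) \<partial>gaussian_vector J) \<partial>complex_gaussian)"
    by (rule P.Fubini'[symmetric]) (measurable, auto)
  also have "\<dots> = (\<integral>\<^sup>+g. ennreal (exp ((cmod g)\<^sup>2 / 8)) \<partial>complex_gaussian)"
  proof (rule nn_integral_cong)
    fix g :: complex
    have "r * (\<Sum>s\<in>J. c s * \<zeta> s) * g = (\<Sum>s\<in>J. (r * g * c s) * \<zeta> s)" for \<zeta> :: signal
      by (simp add: sum_distrib_left sum_distrib_right mult_ac)
    moreover have "(\<Sum>s\<in>J. (cmod (r * g * c s))\<^sup>2) = (cmod g)\<^sup>2 / 4"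
      using T(2) by (simp add: norm_mult power_mult_distrib r T(1)[symmetric] flip: sum_distrib_left sum_divide_distrib)
    ultimately show "(\<integral>\<^sup>+\<zeta>. ennreal (exp (Re (r * (\<Sum>s\<in>J. c s * \<zeta> s) * g))) \<partial>gaussian_vector J) = ennreal (exp ((cmod g)\<^sup>2 / 8))"
      using linear_form_laplace[OF J, of "\<lambda>s. r * g * c s"] by (simp del: times_complex.sel)
  qed
  finally show ?thesis by (simp only: complex_gaussian_exp_square)
qed

lemma exp_markov:
  assumes [measurable]: "f \<in> borel_measurable M" and K: "(\<integral>\<^sup>+x. ennreal (exp (f x)) \<partial>M) \<le> ennreal K" "0 \<le> K"
  shows "emeasure M {x\<in>space M. y \<le> f x} \<le> ennreal (K * exp (- y))"
proof -
  have "emeasure M {x\<in>space M. y \<le> f x} = (\<integral>\<^sup>+x. indicator {x\<in>space M. y \<le> f x} x \<partial>M)"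
    by simp
  also have "\<dots> \<le> (\<integral>\<^sup>+x. ennreal (exp (- y)) * ennreal (exp (f x)) \<partial>M)"
  proof (rule nn_integral_mono)
    fix x
    show "indicator {x\<in>space M. y \<le> f x} x \<le> ennreal (exp (- y)) * ennreal (exp (f x))"
      by (auto simp: indicator_def simp flip: ennreal_mult exp_add ennreal_1 intro!: ennreal_leI)
  qed
  also have "\<dots> = ennreal (exp (- y)) * (\<integral>\<^sup>+x. ennreal (exp (f x)) \<partial>M)" by (rule nn_integral_cmult) simp
  also have "\<dots> \<le> ennreal (exp (- y)) * ennreal K" by (intro mult_left_mono K) simp
  finally show ?thesis using K by (simp add: mult.commute flip: ennreal_mult)
qed

text \<open>Jensen's inequality with weights proportional to the variances reduces the exponential
  moment of the sum of squares to that of a single linear form.\<close>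

lemma sum_squares_tail:
  fixes a :: "'i \<Rightarrow> int \<Rightarrow> complex"
  assumes J: "finite J" and D: "finite D" and T: "(\<Sum>t\<in>D. \<Sum>s\<in>J. (cmod (a t s))\<^sup>2) \<le> T" and x: "0 \<le> x"
  shows "emeasure (gaussian_vector J) {\<zeta>\<in>space (gaussian_vector J). 8 * T * x < (\<Sum>t\<in>D. (cmod (\<Sum>s\<in>J. a t s * \<zeta> s))\<^sup>2)}
    \<le> ennreal (4 / 3 * exp (- x))"
proof -
  define \<tau> where "\<tau> t = (\<Sum>s\<in>J. (cmod (a t s))\<^sup>2)" for t
  \<comment> \<open>Rows of zero variance vanish identically; dropping them makes the weights
    \<open>\<tau> t / T0\<close> and the divisions by \<open>\<tau> t\<close> meaningful.\<close>
  define E where "E = {t\<in>D. \<tau> t \<noteq> 0}"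
  define l where "l \<zeta> t = (\<Sum>s\<in>J. a t s * \<zeta> s)" for \<zeta> :: signal and t
  define T0 where "T0 = sum \<tau> E"
  have \<tau>0: "0 \<le> \<tau> t" for t by (simp add: \<tau>_def sum_nonneg)
  have E: "finite E" using D by (simp add: E_def)
  have \<tau>E: "0 < \<tau> t" if "t \<in> E" for t using \<tau>0[of t] that by (auto simp: E_def)
  have "l \<zeta> t = 0" if "\<tau> t = 0" for \<zeta> t
    using that J by (simp add: \<tau>_def l_def sum_nonneg_eq_0_iff)
  then have sumE: "(\<Sum>t\<in>D. (cmod (l \<zeta> t))\<^sup>2) = (\<Sum>t\<in>E. (cmod (l \<zeta> t))\<^sup>2)" for \<zeta>
    using D by (intro sum.mono_neutral_right) (auto simp: E_def)
  have "T0 = sum \<tau> D" unfolding T0_def using D by (intro sum.mono_neutral_left) (auto simp: E_def)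
  then have T0T: "T0 \<le> T" using T by (simp add: \<tau>_def)
  show ?thesis
  proof (cases "E = {}")
    case True
    then have "0 \<le> T" using T0T by (simp add: T0_def)
    then have "{\<zeta>\<in>space (gaussian_vector J). 8 * T * x < (\<Sum>t\<in>D. (cmod (\<Sum>s\<in>J. a t s * \<zeta> s))\<^sup>2)} = {}"
      using sumE x unfolding l_def True by (auto simp: not_less)
    then show ?thesis by (metis emeasure_empty zero_le)
  next
    case False
    then have T0: "0 < T0" unfolding T0_def using E \<tau>E by (intro sum_pos) auto
    have [measurable]: "(\<lambda>\<zeta>. l \<zeta> t) \<in> borel_measurable (gaussian_vector J)" for t
      unfolding l_def by (rule measurable_linear_form) simp
    define f where "f \<zeta> = (\<Sum>t\<in>E. (cmod (l \<zeta> t))\<^sup>2) / (8 * T0)" for \<zeta>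
    have [measurable]: "f \<in> borel_measurable (gaussian_vector J)" unfolding f_def by measurable
    have jensen: "exp (f \<zeta>) \<le> (\<Sum>t\<in>E. \<tau> t / T0 * exp ((cmod (l \<zeta> t))\<^sup>2 / (8 * \<tau> t)))" for \<zeta>
    proof -
      have "f \<zeta> = (\<Sum>t\<in>E. (\<tau> t / T0) *\<^sub>R ((cmod (l \<zeta> t))\<^sup>2 / (8 * \<tau> t)))"
        unfolding f_def sum_divide_distrib
      proof (rule sum.cong[OF refl])
        fix t assume "t \<in> E"
        then show "(cmod (l \<zeta> t))\<^sup>2 / (8 * T0) = (\<tau> t / T0) *\<^sub>R ((cmod (l \<zeta> t))\<^sup>2 / (8 * \<tau> t))"
          using \<tau>E[of t] T0 by simp
      qed
      also have "exp \<dots> \<le> (\<Sum>t\<in>E. \<tau> t / T0 * exp ((cmod (l \<zeta> t))\<^sup>2 / (8 * \<tau> t)))"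
        using E False T0 \<tau>0 by (intro convex_on_sum[OF _ _ exp_convex]) (auto simp: T0_def simp flip: sum_divide_distrib)
      finally show ?thesis .
    qed
    have "(\<integral>\<^sup>+\<zeta>. ennreal (exp (f \<zeta>)) \<partial>gaussian_vector J)
      \<le> (\<integral>\<^sup>+\<zeta>. (\<Sum>t\<in>E. ennreal (\<tau> t / T0) * ennreal (exp ((cmod (l \<zeta> t))\<^sup>2 / (8 * \<tau> t)))) \<partial>gaussian_vector J)"
    proof (rule nn_integral_mono)
      fix \<zeta>
      have "ennreal (exp (f \<zeta>)) \<le> ennreal (\<Sum>t\<in>E. \<tau> t / T0 * exp ((cmod (l \<zeta> t))\<^sup>2 / (8 * \<tau> t)))"
        by (intro ennreal_leI jensen)
      also have "\<dots> = (\<Sum>t\<in>E. ennreal (\<tau> t / T0) * ennreal (exp ((cmod (l \<zeta> t))\<^sup>2 / (8 * \<tau> t))))"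
        using T0 \<tau>0 by (simp flip: ennreal_mult)
      finally show "ennreal (exp (f \<zeta>)) \<le> (\<Sum>t\<in>E. ennreal (\<tau> t / T0) * ennreal (exp ((cmod (l \<zeta> t))\<^sup>2 / (8 * \<tau> t))))" .
    qed
    also have "\<dots> = (\<Sum>t\<in>E. ennreal (\<tau> t / T0) * (\<integral>\<^sup>+\<zeta>. ennreal (exp ((cmod (l \<zeta> t))\<^sup>2 / (8 * \<tau> t))) \<partial>gaussian_vector J))"
      by (simp add: nn_integral_sum nn_integral_cmult)
    also have "\<dots> = (\<Sum>t\<in>E. ennreal (\<tau> t / T0) * ennreal (4 / 3))"
      unfolding l_def using \<tau>E by (intro sum.cong refl arg_cong2[where f = times] linear_form_exp_square[OF J]) (auto simp: \<tau>_def)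
    also have "\<dots> = ennreal ((\<Sum>t\<in>E. \<tau> t / T0) * (4 / 3))"
      using T0 \<tau>0 unfolding sum_distrib_right by (simp flip: ennreal_mult)
    also have "(\<Sum>t\<in>E. \<tau> t / T0) = 1" using T0 by (simp add: T0_def flip: sum_divide_distrib)
    finally have "emeasure (gaussian_vector J) {\<zeta>\<in>space (gaussian_vector J). x \<le> f \<zeta>} \<le> ennreal (4 / 3 * exp (- x))"
      by (intro exp_markov) auto
    moreover have "x \<le> f \<zeta>" if "8 * T * x < (\<Sum>t\<in>D. (cmod (\<Sum>s\<in>J. a t s * \<zeta> s))\<^sup>2)" for \<zeta>
    proof -
      have "8 * T0 * x \<le> 8 * T * x" using T0T x by (intro mult_right_mono) auto
      also have "\<dots> < (\<Sum>t\<in>E. (cmod (l \<zeta> t))\<^sup>2)" using that sumE[of \<zeta>] by (simp add: l_def)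
      finally show ?thesis using T0 by (simp add: f_def field_simps)
    qed
    ultimately show ?thesis
      by (elim order.trans[OF emeasure_mono, rotated 2]) auto
  qed
qed

text \<open>Integrating over the last coordinate first removes exactly the last summand.\<close>

lemma exp_martingale:
  fixes b :: "int \<Rightarrow> int \<Rightarrow> complex"
  assumes "finite J"
  shows "(\<integral>\<^sup>+\<zeta>. ennreal (exp (\<Sum>t\<in>J. Re (cnj (\<zeta> t) * (\<Sum>s\<in>{s\<in>J. s < t}. b t s * \<zeta> s))
            - (cmod (\<Sum>s\<in>{s\<in>J. s < t}. b t s * \<zeta> s))\<^sup>2 / 2)) \<partial>gaussian_vector J) = 1"
  using assms
proof (induction J rule: finite_linorder_max_induct)
  case empty
  then show ?case by (simp add: PiM_empty nn_integral_count_space_finite emeasure_count_space)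
next
  case (insert k A)
  define \<Phi> where "\<Phi> J \<zeta> = (\<Sum>t\<in>J. Re (cnj (\<zeta> t) * (\<Sum>s\<in>{s\<in>J. s < t}. b t s * \<zeta> s))
            - (cmod (\<Sum>s\<in>{s\<in>J. s < t}. b t s * \<zeta> s))\<^sup>2 / 2)" for J and \<zeta> :: signal
  define w where "w \<zeta> = (\<Sum>s\<in>A. b k s * \<zeta> s)" for \<zeta> :: signal
  have kA: "k \<notin> A" using insert by auto
  have [measurable]: "\<Phi> J \<in> borel_measurable (gaussian_vector J)" for J
    unfolding \<Phi>_def
    by (intro borel_measurable_sum borel_measurable_diff borel_measurable_divide borel_measurable_power
        borel_measurable_norm borel_measurable_const measurable_compose[OF _ borel_measurable_Re] borel_measurable_times
        measurable_compose[OF _ borel_measurable_cnj] measurable_coordinate measurable_linear_form) auto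
  \<comment> \<open>Since k exceeds every index in A, the inner sums for t in A never see the new
    coordinate y. It occurs only in the summand of k, linearly.\<close>
  have split: "\<Phi> (insert k A) (\<zeta>(k := y)) = \<Phi> A \<zeta> + (Re (cnj (w \<zeta>) * y) - (cmod (w \<zeta>))\<^sup>2 / 2)" for \<zeta> y
  proof -
    have 1: "{s\<in>insert k A. s < k} = A" using insert by auto
    have 2: "{s\<in>insert k A. s < t} = {s\<in>A. s < t}" if "t \<in> A" for t using insert(2) that by auto
    have 3: "(\<Sum>s\<in>B. c s * (\<zeta>(k := y)) s) = (\<Sum>s\<in>B. c s * \<zeta> s)" if "B \<subseteq> A" for B and c :: "int \<Rightarrow> complex"
      using that kA by (intro sum.cong) auto
    have 4: "(\<Sum>s\<in>{s\<in>insert k A. s < k}. b k s * (\<zeta>(k := y)) s) = w \<zeta>"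
      unfolding 1 w_def by (rule 3) simp
    have 5: "(\<Sum>s\<in>{s\<in>insert k A. s < t}. b t s * (\<zeta>(k := y)) s) = (\<Sum>s\<in>{s\<in>A. s < t}. b t s * \<zeta> s)" if "t \<in> A" for t
      unfolding 2[OF that] by (rule 3) auto
    have "\<Phi> (insert k A) (\<zeta>(k := y)) = (Re (cnj y * w \<zeta>) - (cmod (w \<zeta>))\<^sup>2 / 2)
       + (\<Sum>t\<in>A. Re (cnj ((\<zeta>(k := y)) t) * (\<Sum>s\<in>{s\<in>insert k A. s < t}. b t s * (\<zeta>(k := y)) s))
            - (cmod (\<Sum>s\<in>{s\<in>insert k A. s < t}. b t s * (\<zeta>(k := y)) s))\<^sup>2 / 2)"
      unfolding \<Phi>_def sum.insert[OF insert(1) kA] 4 by simp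
    also have "(\<Sum>t\<in>A. Re (cnj ((\<zeta>(k := y)) t) * (\<Sum>s\<in>{s\<in>insert k A. s < t}. b t s * (\<zeta>(k := y)) s))
            - (cmod (\<Sum>s\<in>{s\<in>insert k A. s < t}. b t s * (\<zeta>(k := y)) s))\<^sup>2 / 2) = \<Phi> A \<zeta>"
      unfolding \<Phi>_def
    proof (rule sum.cong[OF refl])
      fix t assume t: "t \<in> A"
      then have "(\<zeta>(k := y)) t = \<zeta> t" using kA by auto
      then show "Re (cnj ((\<zeta>(k := y)) t) * (\<Sum>s\<in>{s\<in>insert k A. s < t}. b t s * (\<zeta>(k := y)) s))
            - (cmod (\<Sum>s\<in>{s\<in>insert k A. s < t}. b t s * (\<zeta>(k := y)) s))\<^sup>2 / 2
          = Re (cnj (\<zeta> t) * (\<Sum>s\<in>{s\<in>A. s < t}. b t s * \<zeta> s)) - (cmod (\<Sum>s\<in>{s\<in>A. s < t}. b t s * \<zeta> s))\<^sup>2 / 2"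
        unfolding 5[OF t] by simp
    qed
    finally show ?thesis by (simp add: mult.commute del: fun_upd_apply)
  qed
  have "(\<integral>\<^sup>+\<zeta>. ennreal (exp (\<Phi> (insert k A) \<zeta>)) \<partial>gaussian_vector (insert k A))
     = (\<integral>\<^sup>+\<zeta>. (\<integral>\<^sup>+y. ennreal (exp (\<Phi> (insert k A) (\<zeta>(k := y)))) \<partial>complex_gaussian) \<partial>gaussian_vector A)"
    using insert kA by (intro gaussian.product_nn_integral_insert) auto
  also have "\<dots> = (\<integral>\<^sup>+\<zeta>. ennreal (exp (\<Phi> A \<zeta>)) \<partial>gaussian_vector A)"
  proof (rule nn_integral_cong)
    fix \<zeta> :: signal
    have "(\<integral>\<^sup>+y. ennreal (exp (\<Phi> (insert k A) (\<zeta>(k := y)))) \<partial>complex_gaussian)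
      = (\<integral>\<^sup>+y. ennreal (exp (\<Phi> A \<zeta> - (cmod (w \<zeta>))\<^sup>2 / 2)) * ennreal (exp (Re (cnj (w \<zeta>) * y))) \<partial>complex_gaussian)"
      unfolding split by (intro nn_integral_cong) (simp add: algebra_simps del: times_complex.sel flip: ennreal_mult exp_add)
    \<comment> \<open>The Laplace transform at \<open>cnj (w \<zeta>)\<close> is exactly the inverse
      of the compensator.\<close>
    also have "\<dots> = ennreal (exp (\<Phi> A \<zeta> - (cmod (w \<zeta>))\<^sup>2 / 2)) * ennreal (exp ((cmod (cnj (w \<zeta>)))\<^sup>2 / 2))"
      by (subst nn_integral_cmult) (simp, simp only: complex_gaussian_laplace)
    also have "\<dots> = ennreal (exp (\<Phi> A \<zeta>))" by (simp flip: ennreal_mult exp_add)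
    finally show "(\<integral>\<^sup>+y. ennreal (exp (\<Phi> (insert k A) (\<zeta>(k := y)))) \<partial>complex_gaussian) = ennreal (exp (\<Phi> A \<zeta>))" .
  qed
  finally show ?case using insert.IH by (simp add: \<Phi>_def)
qed

section \<open>Delayed filtering of the noise\<close>

text \<open>Measurability is built in for the union bounds, and \<open>0 \<le> p\<close> keeps
  \<open>ennreal\<close> additive. The error event of the risk is later bounded by inclusion in such
  an event.\<close>

definition unlikely :: "'a measure \<Rightarrow> ('a \<Rightarrow> bool) \<Rightarrow> real \<Rightarrow> bool" where
  "unlikely M P p \<longleftrightarrow> 0 \<le> p \<and> {x\<in>space M. P x} \<in> sets M \<and> emeasure M {x\<in>space M. P x} \<le> ennreal p"

lemma unlikely_mono: "unlikely M P p \<Longrightarrow> p \<le> q \<Longrightarrow> unlikely M P q"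
  unfolding unlikely_def by (auto intro: order.trans ennreal_leI)

lemma unlikely_disj:
  assumes "unlikely M P p" "unlikely M Q q"
  shows "unlikely M (\<lambda>x. P x \<or> Q x) (p + q)"
proof -
  have eq: "{x\<in>space M. P x \<or> Q x} = {x\<in>space M. P x} \<union> {x\<in>space M. Q x}" by auto
  have "emeasure M {x\<in>space M. P x \<or> Q x} \<le> emeasure M {x\<in>space M. P x} + emeasure M {x\<in>space M. Q x}"
    unfolding eq using assms by (intro emeasure_subadditive) (auto simp: unlikely_def)
  also have "\<dots> \<le> ennreal p + ennreal q" using assms by (intro add_mono) (auto simp: unlikely_def)
  finally have "emeasure M {x\<in>space M. P x \<or> Q x} \<le> ennreal (p + q)"
    using assms by (simp add: unlikely_def)
  moreover have "{x\<in>space M. P x \<or> Q x} \<in> sets M"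
    unfolding eq using assms by (intro sets.Un) (auto simp: unlikely_def)
  ultimately show ?thesis using assms by (simp add: unlikely_def)
qed

lemma unlikely_bex:
  assumes "finite I" "\<And>i. i \<in> I \<Longrightarrow> unlikely M (P i) p"
  shows "unlikely M (\<lambda>x. \<exists>i\<in>I. P i x) (real (card I) * p)"
  using assms
proof (induction I)
  case empty
  then show ?case by (simp add: unlikely_def)
next
  case (insert i I)
  then have "unlikely M (\<lambda>x. P i x \<or> (\<exists>i\<in>I. P i x)) (p + real (card I) * p)"
    by (intro unlikely_disj) auto
  then show ?case using insert(1,2) by (simp add: algebra_simps)
qed

lemma sum_squares_unlikely:
  fixes a :: "'i \<Rightarrow> int \<Rightarrow> complex"
  assumes "finite J" "finite D" "(\<Sum>t\<in>D. \<Sum>s\<in>J. (cmod (a t s))\<^sup>2) \<le> T" "0 \<le> x"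
  shows "unlikely (gaussian_vector J) (\<lambda>\<zeta>. 8 * T * x < (\<Sum>t\<in>D. (cmod (\<Sum>s\<in>J. a t s * \<zeta> s))\<^sup>2)) (4 / 3 * exp (- x))"
proof -
  have [measurable]: "(\<lambda>\<zeta>. \<Sum>s\<in>J. a t s * \<zeta> s) \<in> borel_measurable (gaussian_vector J)" for t
    by (rule measurable_linear_form) simp
  show ?thesis using sum_squares_tail[OF assms] unfolding unlikely_def by simp
qed

text \<open>The operator \<phi> * \<Delta>^m z as a finite sum, which makes it linear in both
  arguments without summability questions; for filters it is the convolution itself.\<close>

definition delay :: "nat \<Rightarrow> signal \<Rightarrow> signal \<Rightarrow> signal" where
  "delay m \<phi> z = (\<lambda>t. \<Sum>\<tau>\<in>{- int m..int m}. \<phi> \<tau> * z (t - int m - \<tau>))"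

lemma convolution_shift_eq_delay:
  assumes "\<phi> \<in> filters m"
  shows "convolution \<phi> (shift (int m) z) = delay m \<phi> z"
  by (simp add: delay_def fun_eq_iff convolution_filter[OF assms] shift_def algebra_simps)

lemma delay_add_signal: "delay m \<phi> (\<lambda>t. u t + v t) = (\<lambda>t. delay m \<phi> u t + delay m \<phi> v t)"
  by (simp add: delay_def ring_distribs sum.distrib)

lemma delay_scale_signal: "delay m \<phi> (\<lambda>t. c * u t) = (\<lambda>t. c * delay m \<phi> u t)"
  by (simp add: delay_def sum_distrib_left mult.left_commute)

lemma delay_diff_filter: "delay m (\<lambda>\<tau>. \<phi> \<tau> - \<psi> \<tau>) z t = delay m \<phi> z t - delay m \<psi> z t"
  by (simp add: delay_def ring_distribs sum_subtractf)

lemma delay_dft: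
  assumes "\<phi> \<in> filters m"
  shows "delay m \<phi> z t = (\<Sum>k=1..2*m+1. dft m \<phi> k * delay m (dft_atom m k) z t)"
proof -
  have "delay m \<phi> z t = (\<Sum>\<tau>\<in>{- int m..int m}. \<Sum>k=1..2*m+1. dft m \<phi> k * (dft_atom m k \<tau> * z (t - int m - \<tau>)))"
    unfolding delay_def
    by (subst dft_inversion[OF assms]) (simp only: sum_distrib_right mult.assoc)
  then show ?thesis
    unfolding delay_def sum_distrib_left by (subst (asm) sum.swap)
qed

lemma filters_diff: "\<phi> \<in> filters m \<Longrightarrow> \<psi> \<in> filters m \<Longrightarrow> (\<lambda>\<tau>. \<phi> \<tau> - \<psi> \<tau>) \<in> filters m"
  by (auto simp: filters_def)

lemma dft_norm1_diff: "dft_norm1 m (\<lambda>\<tau>. \<phi> \<tau> - \<psi> \<tau>) \<le> dft_norm1 m \<phi> + dft_norm1 m \<psi>"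
proof -
  have "dft m (\<lambda>\<tau>. \<phi> \<tau> - \<psi> \<tau>) k = dft m \<phi> k - dft m \<psi> k" for k
    by (simp only: dft_def right_diff_distrib sum_subtractf)
  then show ?thesis
    unfolding dft_norm1_def sum.distrib[symmetric] by (intro sum_mono) (simp add: norm_triangle_ineq4)
qed

lemma dft_norm1_nonneg: "0 \<le> dft_norm1 m \<phi>"
  by (simp add: dft_norm1_def sum_nonneg)

text \<open>This form admits filters chosen from the data: B concerns 2 m + 1 fixed atoms, and
  \<phi> enters only through its norm.\<close>

lemma nrm_delay_le:
  assumes "\<phi> \<in> filters m" "\<And>k. k \<in> {1..2*m+1} \<Longrightarrow> nrm D (delay m (dft_atom m k) z) \<le> B"
  shows "nrm D (delay m \<phi> z) \<le> dft_norm1 m \<phi> * B"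
proof -
  have "nrm D (delay m \<phi> z) = nrm D (\<lambda>t. \<Sum>k=1..2*m+1. dft m \<phi> k * delay m (dft_atom m k) z t)"
    by (simp only: delay_dft[OF assms(1), abs_def])
  also have "\<dots> \<le> (\<Sum>k=1..2*m+1. nrm D (\<lambda>t. dft m \<phi> k * delay m (dft_atom m k) z t))"
    by (rule nrm_sum)
  also have "\<dots> \<le> (\<Sum>k=1..2*m+1. cmod (dft m \<phi> k) * B)"
    unfolding nrm_scale by (intro sum_mono mult_left_mono assms(2)) auto
  finally show ?thesis by (simp only: dft_norm1_def sum_distrib_right)
qed

lemma ip_delay_le:
  assumes "\<phi> \<in> filters m" "\<And>k. k \<in> {1..2*m+1} \<Longrightarrow> cmod (ip D u (delay m (dft_atom m k) z)) \<le> B"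
  shows "cmod (ip D u (delay m \<phi> z)) \<le> dft_norm1 m \<phi> * B"
proof -
  have "ip D u (delay m \<phi> z) = (\<Sum>k=1..2*m+1. dft m \<phi> k * ip D u (delay m (dft_atom m k) z))"
    by (simp only: delay_dft[OF assms(1), abs_def] ip_sum_right ip_scale_right)
  also have "cmod \<dots> \<le> (\<Sum>k=1..2*m+1. cmod (dft m \<phi> k) * cmod (ip D u (delay m (dft_atom m k) z)))"
    by (rule order.trans[OF norm_sum]) (simp only: norm_mult order.refl)
  also have "\<dots> \<le> (\<Sum>k=1..2*m+1. cmod (dft m \<phi> k) * B)"
    by (intro sum_mono mult_left_mono assms(2)) auto
  finally show ?thesis by (simp only: dft_norm1_def sum_distrib_right)
qed

text \<open>Filtering combines translates, and the kernel of p(\<Delta>) is translation invariant.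
  So even a data-dependent filter keeps the harmonic part in a space fixed by \<omega>.\<close>

lemma delay_harmonic:
  assumes "x \<in> harmonic_osc_at s \<omega>"
  shows "delay m \<phi> x \<in> harmonic_osc_at s \<omega>"
proof -
  define p where "p = (\<Prod>k=1..s. [:1, - exp (\<i> * complex_of_real (\<omega> k)):])"
  have "poly_shift p (delay m \<phi> x) t = (\<Sum>\<tau>\<in>{- int m..int m}. \<phi> \<tau> * poly_shift p x (t - (int m + \<tau>)))" for t
    using poly_shift_translate[of p x] unfolding delay_def poly_shift_sum_signal poly_shift_scale_signal
    by (simp add: diff_diff_eq)
  then show ?thesis using assms unfolding harmonic_osc_at_def p_def[symmetric] by (auto simp: fun_eq_iff)
qed

lemma seminorm2_eq_nrm: "seminorm2 n (shift (- int m) f) = nrm (window m n) f"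
  unfolding seminorm2_def nrm_def L2_set_def window_def shift_def
  by (intro arg_cong[where f = sqrt] sum.reindex_bij_witness[of _ "\<lambda>t. t - int m" "\<lambda>t. t + int m"]) auto

lemma residual_eq_nrm:
  assumes "\<phi> \<in> filters m"
  shows "residual m n y \<phi> = nrm (window m n) (\<lambda>t. y t - delay m \<phi> y t)"
  by (simp add: residual_def seminorm2_eq_nrm convolution_shift_eq_delay[OF assms])

text \<open>Each of the 2 m + 1 taps has modulus at most 1 / sqrt (2 m + 1) and sees \<epsilon>
  through a translated window, controlled by the class condition at -\<tau>.\<close>

lemma nrm_delay_atom_le:
  assumes e: "\<And>\<tau>. \<tau> \<in> {- int m..int m} \<Longrightarrow> seminorm2 n (shift (- \<tau>) \<epsilon>) \<le> b"
  shows "nrm (window m n) (delay m (dft_atom m k) \<epsilon>) \<le> sqrt (2 * real m + 1) * b"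
proof -
  have "nrm (window m n) (\<lambda>t. \<epsilon> (t - int m - \<tau>)) = seminorm2 n (shift (- (- \<tau>)) \<epsilon>)" for \<tau>
    using seminorm2_eq_nrm[of n m "\<lambda>t. \<epsilon> (t - int m - \<tau>)"] by (simp add: shift_def)
  then have *: "nrm (window m n) (\<lambda>t. \<epsilon> (t - int m - \<tau>)) \<le> b" if "\<tau> \<in> {- int m..int m}" for \<tau>
    using e[of "- \<tau>"] that by simp
  have "nrm (window m n) (delay m (dft_atom m k) \<epsilon>) \<le> (\<Sum>\<tau>\<in>{- int m..int m}. nrm (window m n) (\<lambda>t. dft_atom m k \<tau> * \<epsilon> (t - int m - \<tau>)))"
    unfolding delay_def by (rule nrm_sum)
  also have "\<dots> \<le> (\<Sum>\<tau>\<in>{- int m..int m}. 1 / sqrt (2 * real m + 1) * b)"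
    unfolding nrm_scale using * by (intro sum_mono mult_mono cmod_dft_atom_le) auto
  also have "\<dots> = ((2 * real m + 1) / sqrt (2 * real m + 1)) * b"
    by simp
  also have "(2 * real m + 1) / sqrt (2 * real m + 1) = sqrt (2 * real m + 1)"
    by (rule real_div_sqrt) simp
  finally show ?thesis .
qed

text \<open>For t in the window and |\<tau>| \<le> m the index t - m - \<tau> is an observed one, so
  the default 0 in \<open>observe\<close> never enters.\<close>

lemma delay_observe:
  assumes "t \<in> window m n"
  shows "delay m \<phi> (observe m n \<sigma> x \<zeta>) t = delay m \<phi> x t + of_real \<sigma> * delay m \<phi> \<zeta> t"
proof -
  have "observe m n \<sigma> x \<zeta> (t - int m - \<tau>) = x (t - int m - \<tau>) + of_real \<sigma> * \<zeta> (t - int m - \<tau>)" if "\<tau> \<in> {- int m..int m}" for \<tau>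
    using that assms by (auto simp: observe_def window_def)
  then have "delay m \<phi> (observe m n \<sigma> x \<zeta>) t = delay m \<phi> (\<lambda>t. x t + of_real \<sigma> * \<zeta> t) t"
    unfolding delay_def by (intro sum.cong) auto
  then show ?thesis by (simp only: delay_add_signal delay_scale_signal)
qed

lemma observe_window:
  "t \<in> window m n \<Longrightarrow> observe m n \<sigma> x \<zeta> t = x t + of_real \<sigma> * \<zeta> t"
  by (auto simp: observe_def window_def)

section \<open>Delayed noise as linear forms in the observed noise\<close>

definition obs :: "nat \<Rightarrow> nat \<Rightarrow> int set" where
  "obs m n = {- int (m + n)..int (m + n)}"

lemma finite_obs [simp]: "finite (obs m n)"
  by (simp add: obs_def)

lemma finite_window [simp]: "finite (window m n)"
  by (simp add: window_def)

lemma card_window [simp]: "card (window m n) = 2 * n + 1"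
  by (simp add: window_def)

lemma window_subset: "window m n \<subseteq> obs m n"
  by (auto simp: window_def obs_def)

text \<open>Substitution s = t - m - \<tau>: the taps reach exactly the indices from t - 2 m to t.
  The two-argument F serves both for the forms and for the energies of their coefficients.\<close>

lemma sum_obs_eq:
  assumes t: "t \<in> window m n" and F: "\<And>\<tau> s. \<tau> \<notin> {- int m..int m} \<Longrightarrow> F \<tau> s = 0"
  shows "(\<Sum>s\<in>obs m n. F (t - int m - s) s) = (\<Sum>\<tau>\<in>{- int m..int m}. F \<tau> (t - int m - \<tau>))"
proof -
  have "(\<Sum>s\<in>obs m n. F (t - int m - s) s) = (\<Sum>s\<in>{t - 2 * int m..t}. F (t - int m - s) s)"
    using t by (intro sum.mono_neutral_right) (auto simp: window_def obs_def intro!: F)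
  also have "\<dots> = (\<Sum>\<tau>\<in>{- int m..int m}. F \<tau> (t - int m - \<tau>))"
    by (rule sum.reindex_bij_witness[of _ "\<lambda>\<tau>. t - int m - \<tau>" "\<lambda>s. t - int m - s"]) auto
  finally show ?thesis .
qed

lemma delay_linear_form:
  assumes "\<phi> \<in> filters m" "t \<in> window m n"
  shows "delay m \<phi> \<zeta> t = (\<Sum>s\<in>obs m n. \<phi> (t - int m - s) * \<zeta> s)"
  unfolding delay_def using assms
  by (subst sum_obs_eq[where F = "\<lambda>\<tau> s. \<phi> \<tau> * \<zeta> s"]) (auto simp: filters_def)

lemma sum_coeff_le:
  assumes "\<phi> \<in> filters m" "t \<in> window m n" "\<And>\<tau>. cmod (\<phi> \<tau>) \<le> B / sqrt (2 * real m + 1)"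
  shows "(\<Sum>s\<in>obs m n. (cmod (\<phi> (t - int m - s)))\<^sup>2) \<le> B\<^sup>2"
proof -
  have "(\<Sum>s\<in>obs m n. (cmod (\<phi> (t - int m - s)))\<^sup>2) = (\<Sum>\<tau>\<in>{- int m..int m}. (cmod (\<phi> \<tau>))\<^sup>2)"
    using assms(1,2) by (subst sum_obs_eq[where F = "\<lambda>\<tau> s. (cmod (\<phi> \<tau>))\<^sup>2"]) (auto simp: filters_def)
  also have "\<dots> \<le> (\<Sum>\<tau>\<in>{- int m..int m}. B\<^sup>2 / (2 * real m + 1))"
  proof (rule sum_mono)
    fix \<tau>
    have "(cmod (\<phi> \<tau>))\<^sup>2 \<le> (B / sqrt (2 * real m + 1))\<^sup>2" by (intro power_mono assms(3)) auto
    then show "(cmod (\<phi> \<tau>))\<^sup>2 \<le> B\<^sup>2 / (2 * real m + 1)" by (simp add: power_divide)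
  qed
  also have "\<dots> = B\<^sup>2" by (simp add: add.commute)
  finally show ?thesis .
qed

lemma cmod_ip_linear_form:
  "cmod (ip (window m n) v \<zeta>) = cmod (\<Sum>s\<in>obs m n. (if s \<in> window m n then cnj (v s) else 0) * \<zeta> s)"
proof -
  have "(\<Sum>s\<in>obs m n. (if s \<in> window m n then cnj (v s) else 0) * \<zeta> s) = ip (window m n) v \<zeta>"
    unfolding ip_def using window_subset by (intro sum.mono_neutral_cong_right) auto
  then show ?thesis by simp
qed

lemma sum_ip_coeff:
  "(\<Sum>s\<in>obs m n. (cmod (if s \<in> window m n then cnj (v s) else 0))\<^sup>2) = (nrm (window m n) v)\<^sup>2"
  unfolding nrm_power2 using window_subset by (intro sum.mono_neutral_cong_right) auto

lemma ip_tail: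
  assumes "nrm (window m n) v \<le> E" "0 \<le> x"
  shows "unlikely (gaussian_vector (obs m n)) (\<lambda>\<zeta>. 8 * E\<^sup>2 * x < (cmod (ip (window m n) v \<zeta>))\<^sup>2)
    (4 / 3 * exp (- x))"
proof -
  have "(nrm (window m n) v)\<^sup>2 \<le> E\<^sup>2" using assms by (intro power_mono) auto
  then have T: "(\<Sum>t\<in>{()}. \<Sum>s\<in>obs m n. (cmod (if s \<in> window m n then cnj (v s) else 0))\<^sup>2) \<le> E\<^sup>2"
    by (simp only: sum_ip_coeff sum_constant) simp
  show ?thesis
    using sum_squares_unlikely[OF _ _ T assms(2)] by (simp add: cmod_ip_linear_form)
qed

lemma frame_tail:
  assumes "\<And>i. i < (r::nat) \<Longrightarrow> nrm (window m n) (e i) \<le> 1" "0 \<le> x"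
  shows "unlikely (gaussian_vector (obs m n)) (\<lambda>\<zeta>. 8 * real r * x < (\<Sum>i<r. (cmod (ip (window m n) (e i) \<zeta>))\<^sup>2))
    (4 / 3 * exp (- x))"
proof -
  have "(\<Sum>i<r. (nrm (window m n) (e i))\<^sup>2) \<le> (\<Sum>i<r. 1)"
    using assms by (intro sum_mono) (simp add: power_le_one)
  then have T: "(\<Sum>i<r. \<Sum>s\<in>obs m n. (cmod (if s \<in> window m n then cnj (e i s) else 0))\<^sup>2) \<le> real r"
    by (simp only: sum_ip_coeff) simp
  show ?thesis
    using sum_squares_unlikely[OF _ _ T assms(2)] by (simp add: cmod_ip_linear_form)
qed

lemma delay_tail:
  assumes \<phi>: "\<phi> \<in> filters m" "\<And>\<tau>. cmod (\<phi> \<tau>) \<le> B / sqrt (2 * real m + 1)" and x: "0 \<le> x"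
  shows "unlikely (gaussian_vector (obs m n)) (\<lambda>\<zeta>. 8 * ((2 * real n + 1) * B\<^sup>2) * x < (nrm (window m n) (delay m \<phi> \<zeta>))\<^sup>2)
    (4 / 3 * exp (- x))"
proof -
  have T: "(\<Sum>t\<in>window m n. \<Sum>s\<in>obs m n. (cmod (\<phi> (t - int m - s)))\<^sup>2) \<le> (2 * real n + 1) * B\<^sup>2"
    using sum_mono[OF sum_coeff_le[OF \<phi>(1) _ \<phi>(2)], of "window m n" "\<lambda>t. t"] by (simp add: add.commute)
  have "(nrm (window m n) (delay m \<phi> \<zeta>))\<^sup>2 = (\<Sum>t\<in>window m n. (cmod (\<Sum>s\<in>obs m n. \<phi> (t - int m - s) * \<zeta> s))\<^sup>2)" for \<zeta>
    unfolding nrm_power2 using delay_linear_form[OF \<phi>(1)] by (intro sum.cong) auto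
  then show ?thesis
    using sum_squares_unlikely[OF _ _ T x] by simp
qed

section \<open>The strictly causal part of a delayed filter\<close>

definition causal :: "nat \<Rightarrow> nat \<Rightarrow> signal \<Rightarrow> signal \<Rightarrow> signal" where
  "causal m n \<phi> \<zeta> t = (\<Sum>s\<in>{s\<in>obs m n. s < t}. \<phi> (t - int m - s) * \<zeta> s)"

text \<open>Because of the delay, noise at s = t is met by the tap -m, and s > t would need a tap
  below -m. Without the diagonal only strictly earlier noise is left, as the martingale argument
  requires.\<close>

lemma delay_causal:
  assumes \<phi>: "\<phi> \<in> filters m" and t: "t \<in> window m n"
  shows "delay m \<phi> \<zeta> t = causal m n \<phi> \<zeta> t + \<phi> (- int m) * \<zeta> t"
proof -
  have z: "\<phi> (t - int m - s) = 0" if "t < s" for s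
    using \<phi> that by (auto simp: filters_def)
  have "delay m \<phi> \<zeta> t = (\<Sum>s\<in>insert t {s\<in>obs m n. s < t}. \<phi> (t - int m - s) * \<zeta> s)"
    unfolding delay_linear_form[OF assms] using z t window_subset[of m n]
    by (intro sum.mono_neutral_right) (auto simp: linorder_neq_iff)
  then show ?thesis by (simp add: causal_def add.commute)
qed

lemma causal_tail:
  assumes \<phi>: "\<phi> \<in> filters m" "\<And>\<tau>. cmod (\<phi> \<tau>) \<le> 1 / sqrt (2 * real m + 1)" and x: "0 \<le> x"
  shows "unlikely (gaussian_vector (obs m n)) (\<lambda>\<zeta>. 8 * (2 * real n + 1) * x < (nrm (window m n) (causal m n \<phi> \<zeta>))\<^sup>2)
    (4 / 3 * exp (- x))"
proof -
  define a where "a t s = (if s < t then \<phi> (t - int m - s) else 0)" for t s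
  have "(\<Sum>s\<in>obs m n. (cmod (a t s))\<^sup>2) \<le> 1" if "t \<in> window m n" for t
    using order.trans[OF sum_mono sum_coeff_le[OF \<phi>(1) that \<phi>(2)]] by (force simp: a_def)
  then have T: "(\<Sum>t\<in>window m n. \<Sum>s\<in>obs m n. (cmod (a t s))\<^sup>2) \<le> 2 * real n + 1"
    using sum_mono[of "window m n" "\<lambda>t. \<Sum>s\<in>obs m n. (cmod (a t s))\<^sup>2" "\<lambda>_. 1"] by (simp add: add.commute)
  have "causal m n \<phi> \<zeta> t = (\<Sum>s\<in>obs m n. a t s * \<zeta> s)" for t \<zeta>
    unfolding causal_def a_def by (intro sum.mono_neutral_cong_left) auto
  then show ?thesis
    using sum_squares_unlikely[OF _ _ T x] by (simp add: nrm_power2)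
qed

lemma window_tail:
  assumes x: "0 \<le> x"
  shows "unlikely (gaussian_vector (obs m n)) (\<lambda>\<zeta>. 8 * (2 * real n + 1) * x < (nrm (window m n) \<zeta>)\<^sup>2)
    (4 / 3 * exp (- x))"
proof -
  define a where "a t s = (if s = t then 1 else (0::complex))" for t s :: int
  have [simp]: "t \<in> window m n \<Longrightarrow> t \<in> obs m n" for t using window_subset by blast
  have 1: "(\<Sum>s\<in>obs m n. (cmod (a t s))\<^sup>2) = 1" if "t \<in> window m n" for t
  proof -
    have "(\<Sum>s\<in>obs m n. (cmod (a t s))\<^sup>2) = (\<Sum>s\<in>obs m n. if s = t then 1 else 0)"
      by (intro sum.cong) (auto simp: a_def)
    then show ?thesis using \<open>t \<in> window m n \<Longrightarrow> t \<in> obs m n\<close>[OF that] by (simp only: sum.delta finite_obs if_True)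
  qed
  have T: "(\<Sum>t\<in>window m n. \<Sum>s\<in>obs m n. (cmod (a t s))\<^sup>2) \<le> 2 * real n + 1"
    using sum.cong[OF refl 1, of "window m n"] by simp
  have 2: "(\<Sum>s\<in>obs m n. a t s * \<zeta> s) = \<zeta> t" if "t \<in> window m n" for t \<zeta>
  proof -
    have "(\<Sum>s\<in>obs m n. a t s * \<zeta> s) = (\<Sum>s\<in>obs m n. if s = t then \<zeta> s else 0)"
      by (intro sum.cong) (auto simp: a_def)
    then show ?thesis using \<open>t \<in> window m n \<Longrightarrow> t \<in> obs m n\<close>[OF that] by (simp only: sum.delta finite_obs if_True)
  qed
  have "(nrm (window m n) \<zeta>)\<^sup>2 = (\<Sum>t\<in>window m n. (cmod (\<Sum>s\<in>obs m n. a t s * \<zeta> s))\<^sup>2)" for \<zeta>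
    unfolding nrm_power2 by (intro sum.cong refl) (simp only: 2)
  then show ?thesis
    using sum_squares_unlikely[OF _ _ T x] by simp
qed

text \<open>An instance of \<open>exp_martingale\<close> with coefficients c \<phi> on the rows of
  the window and 0 on the other rows. The scalar c fixes the scale of the deviation and its
  direction in the complex plane.\<close>

lemma causal_martingale_tail:
  fixes c :: complex and \<phi> :: signal and m n :: nat
  defines "f \<equiv> \<lambda>\<zeta>. Re (c * ip (window m n) \<zeta> (causal m n \<phi> \<zeta>)) - (cmod c)\<^sup>2 * (nrm (window m n) (causal m n \<phi> \<zeta>))\<^sup>2 / 2"
  shows "unlikely (gaussian_vector (obs m n)) (\<lambda>\<zeta>. x \<le> f \<zeta>)
    (exp (- x))"
proof -
  define b where "b t s = (if t \<in> window m n then c * \<phi> (t - int m - s) else 0)" for t s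
  define v where "v \<zeta> t = (\<Sum>s\<in>{s\<in>obs m n. s < t}. b t s * \<zeta> s)" for \<zeta> t
  have v: "v \<zeta> t = (if t \<in> window m n then c * causal m n \<phi> \<zeta> t else 0)" for \<zeta> t
    by (simp add: v_def b_def causal_def sum_distrib_left mult.assoc)
  have "(\<Sum>t\<in>obs m n. Re (cnj (\<zeta> t) * v \<zeta> t) - (cmod (v \<zeta> t))\<^sup>2 / 2)
     = (\<Sum>t\<in>window m n. Re (cnj (\<zeta> t) * (c * causal m n \<phi> \<zeta> t)) - (cmod (c * causal m n \<phi> \<zeta> t))\<^sup>2 / 2)" for \<zeta>
    using window_subset by (intro sum.mono_neutral_cong_right) (auto simp: v)
  also have "\<dots> \<zeta> = f \<zeta>" for \<zeta>
    unfolding f_def ip_scale_right[symmetric] nrm_power2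
    by (simp add: ip_def sum_subtractf sum_distrib_left sum_divide_distrib norm_mult power_mult_distrib del: times_complex.sel)
  finally have f: "(\<Sum>t\<in>obs m n. Re (cnj (\<zeta> t) * v \<zeta> t) - (cmod (v \<zeta> t))\<^sup>2 / 2) = f \<zeta>" for \<zeta> .
  have [measurable]: "f \<in> borel_measurable (gaussian_vector (obs m n))"
    unfolding f[symmetric, abs_def] v_def
    by (intro borel_measurable_sum borel_measurable_diff borel_measurable_divide borel_measurable_power
        borel_measurable_norm borel_measurable_const measurable_compose[OF _ borel_measurable_Re] borel_measurable_times
        measurable_compose[OF _ borel_measurable_cnj] measurable_coordinate measurable_linear_form) auto
  have "(\<integral>\<^sup>+\<zeta>. ennreal (exp (f \<zeta>)) \<partial>gaussian_vector (obs m n)) = 1"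
    unfolding f[symmetric] v_def by (rule exp_martingale) simp
  then have "emeasure (gaussian_vector (obs m n)) {\<zeta>\<in>space (gaussian_vector (obs m n)). x \<le> f \<zeta>} \<le> ennreal (exp (- x))"
    using exp_markov[of f "gaussian_vector (obs m n)" 1 x] by simp
  then show ?thesis by (simp add: unlikely_def)
qed

text \<open>The bounds for \<phi> and for the frame are single events and cost only l; those needed
  at all frequencies at once cost L. Keeping the two levels apart is what leaves ln (1 / \<alpha>)
  alone in the leading term of \<open>chi_con\<close>.\<close>

lemma noise_bounds:
  assumes m: "10 \<le> m" and \<alpha>: "0 < \<alpha>" "\<alpha> \<le> 1/2"
    and e: "\<And>i. i < (r::nat) \<Longrightarrow> nrm (window m n) (e i) \<le> 1"
    and \<phi>: "\<phi> \<in> filters m"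
    and E: "\<And>k. nrm (window m n) (delay m (dft_atom m k) \<epsilon>) \<le> E"
  defines "l \<equiv> ln (1 / \<alpha>)" and "L \<equiv> ln (real (m + n) / \<alpha>)"
  obtains bad where "unlikely (gaussian_vector (obs m n)) bad \<alpha>"
    "\<And>\<zeta>. \<not> bad \<zeta> \<Longrightarrow> (nrm (window m n) (delay m \<phi> \<zeta>))\<^sup>2 \<le> 40 * (2 * real n + 1) * (dft_norm1 m \<phi>)\<^sup>2 * l"
    "\<And>\<zeta>. \<not> bad \<zeta> \<Longrightarrow> (\<Sum>i<r. (cmod (ip (window m n) (e i) \<zeta>))\<^sup>2) \<le> 40 * real r * l"
    "\<And>\<zeta> k. \<not> bad \<zeta> \<Longrightarrow> k \<in> {1..2*m+1} \<Longrightarrow> nrm (window m n) (delay m (dft_atom m k) \<zeta>) \<le> 12 * sqrt ((2 * real n + 1) * L)"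
    "\<And>\<zeta> k. \<not> bad \<zeta> \<Longrightarrow> k \<in> {1..2*m+1} \<Longrightarrow> cmod (ip (window m n) \<zeta> (delay m (dft_atom m k) \<epsilon>)) \<le> 6 * E * sqrt L"
    "\<And>\<zeta> k. \<not> bad \<zeta> \<Longrightarrow> k \<in> {1..2*m+1} \<Longrightarrow> cmod (ip (window m n) \<zeta> (delay m (dft_atom m k) \<zeta>))
       \<le> 40 * L * (sqrt (2 * real n + 1) + (2 * real n + 1) / sqrt (2 * real m + 1))"
proof -
  define W where "W = window m n"
  define P where "P = gaussian_vector (obs m n)"
  define R where "R = 2 * real n + 1"
  define S where "S = sqrt (2 * real m + 1)"
  \<comment> \<open>The four directions 1, i, -1, -i bound real and imaginary part from both sides.
    The modulus 1 / sqrt R is tuned to the energy: up to 32 R L of it yields a compensator of 16 L,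
    comparable with the deviation 4 L.\<close>
  define c where "c j = complex_of_real (1 / sqrt R) * \<i> ^ j" for j :: nat
  have R: "1 \<le> R" by (simp add: R_def)
  have S: "1 \<le> S" by (simp add: S_def)
  have l0: "0 \<le> l" unfolding l_def using \<alpha> by (intro ln_ge_zero) (simp add: field_simps)
  have mn: "1 \<le> real (m + n) / \<alpha>" using m \<alpha> by (simp add: field_simps)
  have L0: "0 \<le> L" unfolding L_def using mn by (intro ln_ge_zero)
  have E0: "0 \<le> E" using E[of 0] nrm_nonneg order.trans by blast
  define cau where "cau k = causal m n (dft_atom m k)" for k
  define A1 where "A1 \<zeta> \<longleftrightarrow> 8 * (R * (dft_norm1 m \<phi>)\<^sup>2) * (5 * l) < (nrm W (delay m \<phi> \<zeta>))\<^sup>2" for \<zeta>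
  define A2 where "A2 \<zeta> \<longleftrightarrow> 8 * real r * (5 * l) < (\<Sum>i<r. (cmod (ip W (e i) \<zeta>))\<^sup>2)" for \<zeta>
  define A3 where "A3 \<zeta> \<longleftrightarrow> 8 * R * (4 * L) < (nrm W \<zeta>)\<^sup>2" for \<zeta>
  define B1 where "B1 k \<zeta> \<longleftrightarrow> 8 * R * (4 * L) < (nrm W (cau k \<zeta>))\<^sup>2" for k \<zeta>
  define B2 where "B2 k \<zeta> \<longleftrightarrow> 8 * E\<^sup>2 * (4 * L) < (cmod (ip W (delay m (dft_atom m k) \<epsilon>) \<zeta>))\<^sup>2" for k \<zeta>
  define B3 where "B3 k j \<zeta> \<longleftrightarrow> 4 * L \<le> Re (c j * ip W \<zeta> (cau k \<zeta>)) - (cmod (c j))\<^sup>2 * (nrm W (cau k \<zeta>))\<^sup>2 / 2" for k j \<zeta>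
  define bad where "bad \<zeta> \<longleftrightarrow> (A1 \<zeta> \<or> A2 \<zeta>) \<or> (A3 \<zeta> \<or> (\<exists>k\<in>{1..2*m+1}. (B1 k \<zeta> \<or> B2 k \<zeta>) \<or> (\<exists>j\<in>{..<4}. B3 k j \<zeta>)))" for \<zeta>
  have at: "dft_atom m k \<in> filters m" "cmod (dft_atom m k \<tau>) \<le> 1 / sqrt (2 * real m + 1)" for k \<tau>
    by (rule dft_atom_in_filters, rule cmod_dft_atom_le)
  have uA1: "unlikely P A1 (4 / 3 * exp (- (5 * l)))"
    unfolding P_def A1_def W_def R_def by (rule delay_tail[OF \<phi> cmod_filter_le[OF \<phi>]]) (use l0 in simp)
  have uA2: "unlikely P A2 (4 / 3 * exp (- (5 * l)))"
    unfolding P_def A2_def W_def by (rule frame_tail[OF e]) (use l0 in simp_all)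
  have uA3: "unlikely P A3 (4 / 3 * exp (- (4 * L)))"
    unfolding P_def A3_def W_def R_def by (rule window_tail) (use L0 in simp)
  have uB1: "unlikely P (B1 k) (4 / 3 * exp (- (4 * L)))" for k
    unfolding P_def B1_def W_def R_def cau_def by (rule causal_tail[OF at]) (use L0 in simp)
  have uB2: "unlikely P (B2 k) (4 / 3 * exp (- (4 * L)))" for k
    unfolding P_def B2_def W_def by (rule ip_tail[OF E]) (use L0 in simp)
  have uB3: "unlikely P (B3 k j) (exp (- (4 * L)))" for k j
    unfolding P_def B3_def W_def cau_def by (rule causal_martingale_tail)
  define q where "q = exp (- (4 * L))"
  have uB: "unlikely P (\<lambda>\<zeta>. (B1 k \<zeta> \<or> B2 k \<zeta>) \<or> (\<exists>j\<in>{..<4}. B3 k j \<zeta>)) ((4 / 3 * q + 4 / 3 * q) + real (card {..<4::nat}) * q)" for k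
    unfolding q_def by (intro unlikely_disj unlikely_bex uB1 uB2 uB3) simp
  have u: "unlikely P bad ((4 / 3 * exp (- (5 * l)) + 4 / 3 * exp (- (5 * l)))
      + (4 / 3 * q + real (card {1..2*m+1}) * ((4 / 3 * q + 4 / 3 * q) + real (card {..<4::nat}) * q)))"
    unfolding bad_def by (intro unlikely_disj unlikely_bex uB uA1 uA2 uA3[folded q_def]) simp
  have el: "exp (- (5 * l)) \<le> \<alpha> / 16"
  proof -
    have "exp (- (5 * l)) = exp (- l) ^ 5" by (simp flip: exp_of_nat_mult)
    also have "exp (- l) = \<alpha>" using \<alpha> by (simp add: l_def ln_div)
    also have "\<alpha> ^ 5 = \<alpha> * \<alpha> ^ 4" by (simp add: eval_nat_numeral)
    also have "\<dots> \<le> \<alpha> * (1/2) ^ 4" using \<alpha> by (intro mult_left_mono power_mono) auto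
    finally show ?thesis by (simp add: eval_nat_numeral)
  qed
  \<comment> \<open>The multiple 4 of L yields (\<alpha> / m)^4. As m \<ge> 10, three powers of m
    give the factor 1000 and the fourth pays for the union over frequencies.\<close>
  have qL: "q \<le> \<alpha> / (1000 * real m)"
  proof -
    have "q = exp (- L) ^ 4" by (simp add: q_def flip: exp_of_nat_mult)
    also have "exp (- L) = \<alpha> / real (m + n)" using \<alpha> m by (simp add: L_def exp_minus)
    also have "\<dots> ^ 4 \<le> (\<alpha> / real m) ^ 4" using \<alpha> m by (intro power_mono divide_left_mono) auto
    also have "\<dots> = \<alpha> * (\<alpha> ^ 3 * (1 / (real m) ^ 4))" by (simp add: eval_nat_numeral)
    also have "\<dots> \<le> \<alpha> * (1 * (1 / (1000 * real m)))"
    proof (intro mult_left_mono mult_mono divide_left_mono)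
      have "(10::real) ^ 3 * real m \<le> real m ^ 3 * real m" using m by (intro mult_right_mono power_mono) auto
      then show "1000 * real m \<le> real m ^ 4" by (simp add: eval_nat_numeral)
    qed (use \<alpha> m in \<open>auto intro!: power_le_one\<close>)
    finally show ?thesis by simp
  qed
  have "10 \<le> real m" using m by simp
  then have m30: "4 / 3 + (2 * real m + 1) * (20 / 3) \<le> 30 * real m" by (simp add: field_simps)
  \<comment> \<open>Each frequency costs 4 / 3 + 4 / 3 + 4 = 20 / 3 times q; the two events at level
    l together cost at most \<alpha> / 6.\<close>
  have "(4 / 3 * exp (- (5 * l)) + 4 / 3 * exp (- (5 * l)))
      + (4 / 3 * q + real (card {1..2*m+1}) * ((4 / 3 * q + 4 / 3 * q) + real (card {..<4::nat}) * q))
     = 8 / 3 * exp (- (5 * l)) + (4 / 3 + (2 * real m + 1) * (20 / 3)) * q"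
    by (simp add: algebra_simps)
  also have "\<dots> \<le> 8 / 3 * (\<alpha> / 16) + (30 * real m) * (\<alpha> / (1000 * real m))"
    using el qL m30 by (intro add_mono mult_mono) (simp_all add: q_def)
  also have "\<dots> \<le> \<alpha>" using m \<alpha> by (simp add: field_simps)
  finally have unl: "unlikely P bad \<alpha>" by (rule unlikely_mono[OF u])
  have nz: "nrm W \<zeta> \<le> 6 * sqrt (R * L)" if "\<not> bad \<zeta>" for \<zeta>
  proof (rule power2_le_imp_le)
    have "(nrm W \<zeta>)\<^sup>2 \<le> 32 * (R * L)" using that by (auto simp: bad_def A3_def not_less)
    also have "\<dots> \<le> (6 * sqrt (R * L))\<^sup>2" using R L0 by (simp add: power_mult_distrib)
    finally show "(nrm W \<zeta>)\<^sup>2 \<le> (6 * sqrt (R * L))\<^sup>2" .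
  qed (use R L0 in simp)
  have cz2: "(nrm W (cau k \<zeta>))\<^sup>2 \<le> 32 * R * L" if "\<not> bad \<zeta>" "k \<in> {1..2*m+1}" for \<zeta> k
    using that by (auto simp: bad_def B1_def not_less mult.assoc)
  have cz: "nrm W (cau k \<zeta>) \<le> 6 * sqrt (R * L)" if "\<not> bad \<zeta>" "k \<in> {1..2*m+1}" for \<zeta> k
  proof (rule power2_le_imp_le)
    have "32 * R * L \<le> (6 * sqrt (R * L))\<^sup>2" using R L0 by (simp add: power_mult_distrib)
    with cz2[OF that] show "(nrm W (cau k \<zeta>))\<^sup>2 \<le> (6 * sqrt (R * L))\<^sup>2" by (rule order.trans)
  qed (use R L0 in simp)
  have dc: "delay m (dft_atom m k) \<zeta> t = cau k \<zeta> t + dft_atom m k (- int m) * \<zeta> t" if "t \<in> W" for k \<zeta> t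
    unfolding cau_def using that by (intro delay_causal at) (simp add: W_def)
  have a1: "cmod (dft_atom m k (- int m)) \<le> 1 / S" for k unfolding S_def by (rule at)
  have a2: "1 / S \<le> 1" using S by simp
  have g1: "(nrm W (delay m \<phi> \<zeta>))\<^sup>2 \<le> 40 * R * (dft_norm1 m \<phi>)\<^sup>2 * l" if "\<not> bad \<zeta>" for \<zeta>
    using that by (auto simp: bad_def A1_def not_less)
  have g2: "(\<Sum>i<r. (cmod (ip W (e i) \<zeta>))\<^sup>2) \<le> 40 * real r * l" if "\<not> bad \<zeta>" for \<zeta>
    using that by (auto simp: bad_def A2_def not_less)
  have g3: "nrm W (delay m (dft_atom m k) \<zeta>) \<le> 12 * sqrt (R * L)" if "\<not> bad \<zeta>" "k \<in> {1..2*m+1}" for \<zeta> k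
  proof -
    have "nrm W (delay m (dft_atom m k) \<zeta>) = nrm W (\<lambda>t. cau k \<zeta> t + dft_atom m k (- int m) * \<zeta> t)"
      by (intro nrm_cong dc)
    also have "\<dots> \<le> nrm W (cau k \<zeta>) + cmod (dft_atom m k (- int m)) * nrm W \<zeta>"
      using nrm_triangle[of W "cau k \<zeta>" "\<lambda>t. dft_atom m k (- int m) * \<zeta> t"] by (simp add: nrm_scale)
    also have "\<dots> \<le> 6 * sqrt (R * L) + 1 * (6 * sqrt (R * L))"
      using cz[OF that] nz[OF that(1)] order.trans[OF a1 a2] by (intro add_mono mult_mono) auto
    finally show ?thesis by simp
  qed
  have g4: "cmod (ip W \<zeta> (delay m (dft_atom m k) \<epsilon>)) \<le> 6 * E * sqrt L" if "\<not> bad \<zeta>" "k \<in> {1..2*m+1}" for \<zeta> k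
  proof (rule power2_le_imp_le)
    have "cmod (ip W \<zeta> (delay m (dft_atom m k) \<epsilon>)) = cmod (ip W (delay m (dft_atom m k) \<epsilon>) \<zeta>)"
      by (metis cnj_ip complex_mod_cnj)
    then have "(cmod (ip W \<zeta> (delay m (dft_atom m k) \<epsilon>)))\<^sup>2 \<le> 32 * (E\<^sup>2 * L)"
      using that by (auto simp: bad_def B2_def not_less)
    also have "\<dots> \<le> (6 * E * sqrt L)\<^sup>2" using L0 by (simp add: power_mult_distrib)
    finally show "(cmod (ip W \<zeta> (delay m (dft_atom m k) \<epsilon>)))\<^sup>2 \<le> (6 * E * sqrt L)\<^sup>2" .
  qed (use E0 L0 in simp)
  have g5: "cmod (ip W \<zeta> (delay m (dft_atom m k) \<zeta>)) \<le> 40 * L * (sqrt R + R / S)" if "\<not> bad \<zeta>" "k \<in> {1..2*m+1}" for \<zeta> k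
  proof -
    define z where "z = ip W \<zeta> (cau k \<zeta>)"
    have cR: "(cmod (c j))\<^sup>2 = 1 / R" for j
      using R by (simp add: c_def norm_mult norm_power norm_divide power_divide)
    have re: "Re (c j * z) \<le> 20 * L" if "j < 4" for j
    proof -
      have "\<not> B3 k j \<zeta>"
        using \<open>\<not> bad \<zeta>\<close> \<open>k \<in> {1..2*m+1}\<close> that unfolding bad_def by blast
      then have "Re (c j * z) < 4 * L + (cmod (c j))\<^sup>2 * (nrm W (cau k \<zeta>))\<^sup>2 / 2"
        unfolding B3_def z_def by linarith
      also have "(cmod (c j))\<^sup>2 * (nrm W (cau k \<zeta>))\<^sup>2 / 2 \<le> (1 / R) * (32 * R * L) / 2"
        unfolding cR using cz2[OF \<open>\<not> bad \<zeta>\<close> \<open>k \<in> {1..2*m+1}\<close>] R by (intro divide_right_mono mult_left_mono) auto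
      also have "\<dots> = 16 * L" using R by simp
      finally show ?thesis by simp
    qed
    have R0: "0 < sqrt R" using R by simp
    have "Re z / sqrt R \<le> 20 * L" "- Re z / sqrt R \<le> 20 * L" "Im z / sqrt R \<le> 20 * L" "- Im z / sqrt R \<le> 20 * L"
      using re[of 0] re[of 2] re[of 3] re[of 1] by (simp_all add: c_def eval_nat_numeral)
    then have "Re z \<le> 20 * L * sqrt R" "- Re z \<le> 20 * L * sqrt R" "Im z \<le> 20 * L * sqrt R" "- Im z \<le> 20 * L * sqrt R"
      unfolding pos_divide_le_eq[OF R0] by blast+
    then have "\<bar>Re z\<bar> \<le> 20 * L * sqrt R" "\<bar>Im z\<bar> \<le> 20 * L * sqrt R"
      by (simp_all add: abs_le_iff)
    then have z: "cmod z \<le> 40 * L * sqrt R" using cmod_le[of z] by linarith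
    have "ip W \<zeta> (delay m (dft_atom m k) \<zeta>) = ip W \<zeta> (\<lambda>t. cau k \<zeta> t + dft_atom m k (- int m) * \<zeta> t)"
      by (intro ip_cong refl dc)
    \<comment> \<open>The diagonal term costs the whole noise energy, of order R L, but carries a
      tap of size at most 1 / S; hence the summand R / S.\<close>
    also have "\<dots> = z + dft_atom m k (- int m) * of_real ((nrm W \<zeta>)\<^sup>2)"
      by (simp only: ip_add_right ip_scale_right ip_self z_def)
    also have "cmod \<dots> \<le> cmod z + cmod (dft_atom m k (- int m)) * (nrm W \<zeta>)\<^sup>2"
      by (rule order.trans[OF norm_triangle_ineq]) (simp add: norm_mult norm_power)
    also have "\<dots> \<le> 40 * L * sqrt R + (1 / S) * (32 * R * L)"
      using z a1 that(1) by (intro add_mono mult_mono) (auto simp: bad_def A3_def not_less S_def)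
    also have "\<dots> \<le> 40 * L * (sqrt R + R / S)"
      using L0 R S by (simp add: algebra_simps divide_right_mono)
    finally show ?thesis .
  qed
  show ?thesis
    by (rule that[OF unl[unfolded P_def] g1[unfolded W_def R_def] g2[unfolded W_def] g3[unfolded W_def R_def]
          g4[unfolded W_def] g5[unfolded W_def R_def S_def]])
qed

section \<open>The basic inequality\<close>

lemma nrm_add_power2: "(nrm D (\<lambda>t. u t + v t))\<^sup>2 = (nrm D u)\<^sup>2 + 2 * Re (ip D v u) + (nrm D v)\<^sup>2"
proof -
  have "(cmod (u t + v t))\<^sup>2 = (cmod (u t))\<^sup>2 + 2 * Re (cnj (v t) * u t) + (cmod (v t))\<^sup>2" for t
    unfolding cmod_power2 by (simp add: power2_eq_square algebra_simps)
  then show ?thesis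
    by (simp add: nrm_power2 ip_def sum.distrib sum_distrib_left del: times_complex.sel)
qed

lemma ip_scale_left: "ip D (\<lambda>t. c * u t) v = cnj c * ip D u v"
  by (simp add: ip_def sum_distrib_left mult.assoc)

lemma harmonic_frame:
  obtains e where "\<And>i. i < s \<Longrightarrow> nrm (window m n) (e i) \<le> 1"
    "\<And>v z. v \<in> harmonic_osc_at s \<omega> \<Longrightarrow>
       cmod (ip (window m n) z v) \<le> sqrt (\<Sum>i<s. (cmod (ip (window m n) (e i) z))\<^sup>2) * nrm (window m n) v"
proof -
  obtain b where b: "\<And>x. x \<in> harmonic_osc_at s \<omega> \<Longrightarrow> \<exists>c. \<forall>t. x t = (\<Sum>i<s. c i * b i t)"
    using harmonic_spanned[of s \<omega>] by blast
  obtain e where e: "\<And>i. i < s \<Longrightarrow> nrm (window m n) (e i) \<le> 1"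
    "\<And>v z c. (\<And>t. t \<in> window m n \<Longrightarrow> v t = (\<Sum>i<s. c i * b i t)) \<Longrightarrow>
       cmod (ip (window m n) z v) \<le> sqrt (\<Sum>i<s. (cmod (ip (window m n) (e i) z))\<^sup>2) * nrm (window m n) v"
    using span_frame[OF finite_window, of s m n b] by blast
  show ?thesis
  proof (rule that)
    fix v z assume "v \<in> harmonic_osc_at s \<omega>"
    then obtain c where "\<forall>t. v t = (\<Sum>i<s. c i * b i t)" using b by blast
    then show "cmod (ip (window m n) z v) \<le> sqrt (\<Sum>i<s. (cmod (ip (window m n) (e i) z))\<^sup>2) * nrm (window m n) v"
      by (intro e(2)) auto
  qed (use e in auto)
qed

text \<open>Subtracting the two squared residuals cancels the noise energy and leaves the cross term
  of the noise with the difference of the estimates. X reappears on the right, but only linearly;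
  \<open>absorb_linear\<close> removes it.\<close>

lemma basic_inequality:
  assumes \<phi>: "\<phi> \<in> filters m" "\<psi> \<in> filters m" and \<sigma>: "0 < \<sigma>"
    and x: "x = (\<lambda>t. xH t + \<epsilon> t)" and xH: "xH \<in> harmonic_osc_at s \<omega>" and rep: "delay m \<psi> xH = xH"
    and \<epsilon>: "nrm (window m n) \<epsilon> \<le> b" "\<And>k. nrm (window m n) (delay m (dft_atom m k) \<epsilon>) \<le> B"
    and P: "\<And>v. v \<in> harmonic_osc_at s \<omega> \<Longrightarrow> cmod (ip (window m n) \<zeta> v) \<le> P * nrm (window m n) v" "0 \<le> P"
    and G1: "nrm (window m n) (delay m \<psi> \<zeta>) \<le> G1"
    and G3: "\<And>k. k \<in> {1..2*m+1} \<Longrightarrow> nrm (window m n) (delay m (dft_atom m k) \<zeta>) \<le> G3"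
    and G4: "\<And>k. k \<in> {1..2*m+1} \<Longrightarrow> cmod (ip (window m n) \<zeta> (delay m (dft_atom m k) \<epsilon>)) \<le> G4"
    and G5: "\<And>k. k \<in> {1..2*m+1} \<Longrightarrow> cmod (ip (window m n) \<zeta> (delay m (dft_atom m k) \<zeta>)) \<le> G5"
  defines "y \<equiv> observe m n \<sigma> x \<zeta>" and "R \<equiv> dft_norm1 m \<phi> + dft_norm1 m \<psi>"
  defines "X \<equiv> nrm (window m n) (\<lambda>t. x t - delay m \<phi> y t)" and "A \<equiv> nrm (window m n) (\<lambda>t. x t - delay m \<psi> y t)"
  shows "X\<^sup>2 \<le> A\<^sup>2 + 2 * \<sigma> * (P * (X + A + R * B + \<sigma> * (R * G3)) + R * G4 + \<sigma> * (R * G5))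
      + ((residual m n y \<phi>)\<^sup>2 - (residual m n y \<psi>)\<^sup>2)"
    and "A \<le> b + dft_norm1 m \<psi> * B + \<sigma> * G1"
proof -
  define W where "W = window m n"
  define \<delta> where "\<delta> = (\<lambda>\<tau>. \<phi> \<tau> - \<psi> \<tau>)"
  have \<delta>: "\<delta> \<in> filters m" unfolding \<delta>_def by (rule filters_diff[OF \<phi>])
  have \<delta>R: "dft_norm1 m \<delta> \<le> R" unfolding \<delta>_def R_def by (rule dft_norm1_diff)
  have k1: "1 \<in> {1..2*m+1}" by simp
  have nn: "0 \<le> B" "0 \<le> G3" "0 \<le> G4" "0 \<le> G5"
    using \<epsilon>(2)[of 1] G3[OF k1] G4[OF k1] G5[OF k1] nrm_nonneg norm_ge_zero order.trans by blast+
  have dy: "delay m \<theta> y t = delay m \<theta> xH t + delay m \<theta> \<epsilon> t + of_real \<sigma> * delay m \<theta> \<zeta> t" if "t \<in> W" for \<theta> t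
    using that unfolding y_def W_def by (simp add: delay_observe x delay_add_signal)
  define w where "w t = delay m \<phi> y t - delay m \<psi> y t" for t
  have res: "(residual m n y \<theta>)\<^sup>2 = (nrm W (\<lambda>t. x t - delay m \<theta> y t))\<^sup>2
      + 2 * \<sigma> * Re (ip W \<zeta> (\<lambda>t. x t - delay m \<theta> y t)) + \<sigma>\<^sup>2 * (nrm W \<zeta>)\<^sup>2" if "\<theta> \<in> filters m" for \<theta>
  proof -
    have "residual m n y \<theta> = nrm W (\<lambda>t. (x t - delay m \<theta> y t) + of_real \<sigma> * \<zeta> t)"
      unfolding residual_eq_nrm[OF that] W_def by (intro nrm_cong) (simp add: y_def observe_window)
    then show ?thesis using \<sigma>
      by (simp add: nrm_add_power2 ip_scale_left nrm_scale power_mult_distrib del: times_complex.sel) simp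
  qed
  have "ip W \<zeta> w = ip W \<zeta> (\<lambda>t. (x t - delay m \<psi> y t) - (x t - delay m \<phi> y t))"
    unfolding w_def by simp
  also have "\<dots> = ip W \<zeta> (\<lambda>t. x t - delay m \<psi> y t) - ip W \<zeta> (\<lambda>t. x t - delay m \<phi> y t)"
    by (rule ip_diff_right)
  finally have "X\<^sup>2 = A\<^sup>2 + 2 * \<sigma> * Re (ip W \<zeta> w) + ((residual m n y \<phi>)\<^sup>2 - (residual m n y \<psi>)\<^sup>2)"
    unfolding res[OF \<phi>(1)] res[OF \<phi>(2)] X_def A_def W_def by (simp add: right_diff_distrib)
  also have "\<dots> \<le> A\<^sup>2 + 2 * \<sigma> * cmod (ip W \<zeta> w) + ((residual m n y \<phi>)\<^sup>2 - (residual m n y \<psi>)\<^sup>2)"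
    using \<sigma> complex_Re_le_cmod by simp
  finally have 1: "X\<^sup>2 \<le> A\<^sup>2 + 2 * \<sigma> * cmod (ip W \<zeta> w) + ((residual m n y \<phi>)\<^sup>2 - (residual m n y \<psi>)\<^sup>2)" .
  have wt: "w t = delay m \<delta> xH t + delay m \<delta> \<epsilon> t + of_real \<sigma> * delay m \<delta> \<zeta> t" if "t \<in> W" for t
    unfolding \<delta>_def delay_diff_filter w_def dy[OF that] by (simp add: algebra_simps)
  have n\<epsilon>: "nrm W (delay m \<delta> \<epsilon>) \<le> R * B"
    using nrm_delay_le[OF \<delta> \<epsilon>(2)] mult_right_mono[OF \<delta>R nn(1)] unfolding W_def by (rule order.trans)
  have n\<zeta>: "nrm W (delay m \<delta> \<zeta>) \<le> R * G3"
    using nrm_delay_le[OF \<delta> G3] mult_right_mono[OF \<delta>R nn(2)] unfolding W_def by (rule order.trans)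
  have i\<epsilon>: "cmod (ip W \<zeta> (delay m \<delta> \<epsilon>)) \<le> R * G4"
    using ip_delay_le[OF \<delta> G4] mult_right_mono[OF \<delta>R nn(3)] unfolding W_def by (rule order.trans)
  have i\<zeta>: "cmod (ip W \<zeta> (delay m \<delta> \<zeta>)) \<le> R * G5"
    using ip_delay_le[OF \<delta> G5] mult_right_mono[OF \<delta>R nn(4)] unfolding W_def by (rule order.trans)
  have "nrm W w = nrm W (\<lambda>t. (x t - delay m \<psi> y t) - (x t - delay m \<phi> y t))" by (simp add: w_def[abs_def])
  also have "\<dots> \<le> X + A" using nrm_diff[of W] unfolding X_def A_def W_def by (metis add.commute)
  finally have nw: "nrm W w \<le> X + A" .
  \<comment> \<open>The harmonic part of w has no bound of its own, as the oscillation may be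
    arbitrarily large. It is estimated as w minus the other two parts, with the norm of w at most X
    + A.\<close>
  have "nrm W (delay m \<delta> xH) = nrm W (\<lambda>t. (w t - delay m \<delta> \<epsilon> t) - of_real \<sigma> * delay m \<delta> \<zeta> t)"
    by (intro nrm_cong) (simp add: wt)
  also have "\<dots> \<le> nrm W w + nrm W (delay m \<delta> \<epsilon>) + \<sigma> * nrm W (delay m \<delta> \<zeta>)"
    using nrm_diff[of W "\<lambda>t. w t - delay m \<delta> \<epsilon> t" "\<lambda>t. of_real \<sigma> * delay m \<delta> \<zeta> t"] nrm_diff[of W w "delay m \<delta> \<epsilon>"] \<sigma>
    by (simp add: nrm_scale)
  also have "\<dots> \<le> X + A + R * B + \<sigma> * (R * G3)"
    using nw n\<epsilon> n\<zeta> \<sigma> by (intro add_mono mult_left_mono) auto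
  finally have nH: "nrm W (delay m \<delta> xH) \<le> X + A + R * B + \<sigma> * (R * G3)" .
  have "cmod (ip W \<zeta> (delay m \<delta> xH)) \<le> P * (X + A + R * B + \<sigma> * (R * G3))"
    using P(1)[OF delay_harmonic[OF xH, of m \<delta>]] mult_left_mono[OF nH P(2)] unfolding W_def by (rule order.trans)
  moreover have "ip W \<zeta> w = ip W \<zeta> (delay m \<delta> xH) + ip W \<zeta> (delay m \<delta> \<epsilon>) + of_real \<sigma> * ip W \<zeta> (delay m \<delta> \<zeta>)"
    unfolding ip_scale_right[symmetric] ip_add_right[symmetric] by (intro ip_cong refl wt)
  then have "cmod (ip W \<zeta> w) \<le> cmod (ip W \<zeta> (delay m \<delta> xH)) + cmod (ip W \<zeta> (delay m \<delta> \<epsilon>)) + \<sigma> * cmod (ip W \<zeta> (delay m \<delta> \<zeta>))"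
    using \<sigma> norm_triangle_ineq[of "ip W \<zeta> (delay m \<delta> xH) + ip W \<zeta> (delay m \<delta> \<epsilon>)" "of_real \<sigma> * ip W \<zeta> (delay m \<delta> \<zeta>)"]
      norm_triangle_ineq[of "ip W \<zeta> (delay m \<delta> xH)" "ip W \<zeta> (delay m \<delta> \<epsilon>)"] by (simp add: norm_mult)
  moreover have "\<sigma> * cmod (ip W \<zeta> (delay m \<delta> \<zeta>)) \<le> \<sigma> * (R * G5)" using i\<zeta> \<sigma> by simp
  ultimately have "cmod (ip W \<zeta> w) \<le> P * (X + A + R * B + \<sigma> * (R * G3)) + R * G4 + \<sigma> * (R * G5)"
    using i\<epsilon> by linarith
  then have "2 * \<sigma> * cmod (ip W \<zeta> w) \<le> 2 * \<sigma> * (P * (X + A + R * B + \<sigma> * (R * G3)) + R * G4 + \<sigma> * (R * G5))"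
    using \<sigma> by simp
  with 1 show "X\<^sup>2 \<le> A\<^sup>2 + 2 * \<sigma> * (P * (X + A + R * B + \<sigma> * (R * G3)) + R * G4 + \<sigma> * (R * G5))
      + ((residual m n y \<phi>)\<^sup>2 - (residual m n y \<psi>)\<^sup>2)" by linarith
  \<comment> \<open>\<open>xH\<close> cancels since \<psi> reproduces it; only perturbation and
    noise are left in the oracle error.\<close>
  have "A = nrm W (\<lambda>t. (\<epsilon> t - delay m \<psi> \<epsilon> t) - of_real \<sigma> * delay m \<psi> \<zeta> t)"
    unfolding A_def W_def[symmetric] by (intro nrm_cong) (simp add: dy rep x)
  also have "\<dots> \<le> nrm W \<epsilon> + nrm W (delay m \<psi> \<epsilon>) + \<sigma> * nrm W (delay m \<psi> \<zeta>)"
    using nrm_diff[of W "\<lambda>t. \<epsilon> t - delay m \<psi> \<epsilon> t" "\<lambda>t. of_real \<sigma> * delay m \<psi> \<zeta> t"] nrm_diff[of W \<epsilon> "delay m \<psi> \<epsilon>"] \<sigma>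
    by (simp add: nrm_scale)
  also have "\<dots> \<le> b + dft_norm1 m \<psi> * B + \<sigma> * G1"
    using \<epsilon> G1 \<sigma> nrm_delay_le[OF \<phi>(2) \<epsilon>(2)] unfolding W_def by (intro add_mono mult_left_mono) auto
  finally show "A \<le> b + dft_norm1 m \<psi> * B + \<sigma> * G1" .
qed

section \<open>Arithmetic of the two rates\<close>

lemma mult_le_eps_squares:
  fixes x y :: real
  shows "K * x * y \<le> x\<^sup>2 / 4 + K\<^sup>2 * y\<^sup>2"
proof -
  have "0 \<le> (x / 2 - K * y)\<^sup>2" by simp
  then show ?thesis by (simp add: power2_eq_square algebra_simps)
qed

text \<open>Young's inequality moves half of \<xi>^2 to the left. The numbers 12, 6 and 40 are the
  constants of \<open>noise_bounds\<close>.\<close>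

lemma absorb_linear:
  fixes \<xi> a p :: real
  assumes "\<xi>\<^sup>2 \<le> a\<^sup>2 + 2 * (p * (\<xi> + a + u + 12 * v) + (6 * w1 + 40 * w2)) + d"
  shows "\<xi>\<^sup>2 \<le> 4 * a\<^sup>2 + 6 * p\<^sup>2 + 4 * (p * u) + 48 * (p * v) + 24 * w1 + 160 * w2 + 2 * d"
proof -
  have "0 \<le> (\<xi> - 2 * p)\<^sup>2" "0 \<le> (a - p)\<^sup>2" by auto
  then have "4 * (p * \<xi>) \<le> \<xi>\<^sup>2 + 4 * p\<^sup>2" "2 * (p * a) \<le> a\<^sup>2 + p\<^sup>2"
    by (simp_all add: power2_eq_square algebra_simps)
  moreover have "\<xi>\<^sup>2 \<le> a\<^sup>2 + 2 * (p * \<xi>) + 2 * (p * a) + 2 * (p * u) + 24 * (p * v) + 12 * w1 + 80 * w2 + d"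
    using assms by (simp add: algebra_simps)
  ultimately show ?thesis by linarith
qed

text \<open>All quantities are normalized: \<xi> and a are losses divided by \<sigma>,
  \<open>No\<close> is sqrt (2 m + 1) times the norm of the oracle filter, N the same for the sum of
  both norms, d the difference of squared residuals over \<sigma>^2. Each term is bounded by a
  multiple of the squared target X^2, and the multiples add up to less than 50^2.\<close>

lemma constrained_arithmetic:
  fixes \<rho> s l L K \<kappa> N No a \<xi> :: real
  assumes pos: "0 \<le> s" "s \<le> \<rho>" "1 \<le> \<rho>" "0 \<le> l" "l \<le> L" "0 \<le> K" "0 \<le> \<kappa>" "0 \<le> \<xi>" "0 \<le> a"
    and N: "0 \<le> N" "N \<le> 2 * \<rho>" "0 \<le> No" "No \<le> \<rho>"
    and a: "a \<le> \<kappa> + No * \<kappa> + 7 * (K * No * sqrt l)"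
    and \<xi>: "\<xi>\<^sup>2 \<le> a\<^sup>2 + 2 * (7 * sqrt (s * l) * (\<xi> + a + N * \<kappa> + 12 * (N * K * sqrt L))
         + (6 * (N * \<kappa> * sqrt L) + 40 * (N * L * (K + K\<^sup>2)))) + d" and d: "d \<le> 0"
  shows "\<xi> \<le> 50 * (\<rho> * (K * sqrt l + \<kappa>) + (K + 1) * sqrt (\<rho> * L))"
proof -
  define X where "X = \<rho> * (K * sqrt l + \<kappa>) + (K + 1) * sqrt (\<rho> * L)"
  have L: "0 \<le> L" using pos by linarith
  have nn: "0 \<le> \<rho> * K * sqrt l" "0 \<le> \<rho> * \<kappa>" "0 \<le> K * sqrt (\<rho> * L)" "0 \<le> sqrt (\<rho> * L)"
    using pos L by auto
  have Xe: "X = \<rho> * K * sqrt l + \<rho> * \<kappa> + K * sqrt (\<rho> * L) + sqrt (\<rho> * L)"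
    by (simp add: X_def algebra_simps)
  have X1: "\<rho> * K * sqrt l \<le> X" "\<rho> * \<kappa> \<le> X" "(K + 1) * sqrt (\<rho> * L) \<le> X" "sqrt (\<rho> * L) \<le> X" "0 \<le> X"
    using nn unfolding Xe by (auto simp: algebra_simps)
  have sL: "sqrt L \<le> X"
  proof -
    have "1 * L \<le> \<rho> * L" using pos L by (intro mult_right_mono) auto
    then have "sqrt L \<le> sqrt (\<rho> * L)" by simp
    then show ?thesis using X1 by linarith
  qed
  have p: "sqrt (s * l) \<le> sqrt (\<rho> * L)"
    using pos L by (intro real_sqrt_le_mono mult_mono) auto
  have pX: "sqrt (s * l) \<le> X" using p X1 by linarith
  have p0: "0 \<le> sqrt (s * l)" using pos by simp
  \<comment> \<open>The two logarithms are exchanged: N K gets sqrt l, which fits the leading term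
    of X, and sqrt L goes with s, where the second term of X pays for it.\<close>
  have psL: "sqrt (s * l) * sqrt L = sqrt l * sqrt (s * L)" by (simp add: real_sqrt_mult)
  have sLX: "sqrt (s * L) \<le> X"
  proof -
    have "sqrt (s * L) \<le> sqrt (\<rho> * L)" using pos L by (intro real_sqrt_le_mono mult_right_mono) auto
    then show ?thesis using X1 by linarith
  qed
  have NkX: "N * \<kappa> \<le> 2 * X"
    using mult_right_mono[OF N(2) pos(7)] X1(2) by linarith
  have "a \<le> 9 * X"
  proof -
    have "No * \<kappa> \<le> X" using mult_right_mono[OF N(4) pos(7)] X1(2) by linarith
    moreover have "\<kappa> \<le> X" using mult_right_mono[OF pos(3) pos(7)] X1(2) by simp
    moreover have "K * No * sqrt l \<le> X"
      using mult_right_mono[OF mult_left_mono[OF N(4) pos(6)], of "sqrt l"] X1(1) pos by (simp add: mult.commute)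
    ultimately show ?thesis using a by linarith
  qed
  then have a2: "a\<^sup>2 \<le> 81 * X\<^sup>2" using pos(9) power_mono[of a "9 * X" 2] by (simp add: power_mult_distrib)
  have p2: "(7 * sqrt (s * l))\<^sup>2 \<le> 49 * X\<^sup>2"
    using power_mono[OF pX p0, of 2] by (simp add: power_mult_distrib)
  have pu: "7 * sqrt (s * l) * (N * \<kappa>) \<le> 14 * X\<^sup>2"
    using mult_mono[OF pX NkX X1(5)] N(1) pos(7) by (simp add: power2_eq_square mult_ac)
  have pv: "7 * sqrt (s * l) * (N * K * sqrt L) \<le> 14 * X\<^sup>2"
  proof -
    have "N * K * sqrt l \<le> 2 * X"
      using mult_right_mono[OF mult_right_mono[OF N(2) pos(6)], of "sqrt l"] X1(1) pos by simp
    from mult_mono[OF this sLX] have "N * K * sqrt l * sqrt (s * L) \<le> 2 * X * X"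
      using X1(5) pos L by simp
    moreover have "7 * sqrt (s * l) * (N * K * sqrt L) = 7 * (N * K * sqrt l * sqrt (s * L))"
      using psL by (metis (no_types, opaque_lifting) mult.assoc mult.commute mult.left_commute)
    ultimately show ?thesis unfolding power2_eq_square by linarith
  qed
  have w1: "N * \<kappa> * sqrt L \<le> 2 * X\<^sup>2"
    using mult_mono[OF NkX sL] X1(5) L by (simp add: power2_eq_square)
  \<comment> \<open>The quadratic noise form is linear in N, so it contributes only sqrt \<rho>,
    that is s rather than s^2, to the rate.\<close>
  have w2: "N * L * (K + K\<^sup>2) \<le> 2 * X\<^sup>2"
  proof -
    have "N * L * (K + K\<^sup>2) \<le> (2 * \<rho>) * L * (K + 1)\<^sup>2"
      using N pos L by (intro mult_mono mult_right_mono) (auto simp: power2_eq_square algebra_simps)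
    also have "\<dots> = 2 * ((K + 1) * sqrt (\<rho> * L))\<^sup>2" using pos L by (simp add: power_mult_distrib)
    also have "\<dots> \<le> 2 * X\<^sup>2" using X1(3) pos L by (intro mult_left_mono power_mono) auto
    finally show ?thesis .
  qed
  have "\<xi>\<^sup>2 \<le> 4 * a\<^sup>2 + 6 * (7 * sqrt (s * l))\<^sup>2 + 4 * (7 * sqrt (s * l) * (N * \<kappa>)) + 48 * (7 * sqrt (s * l) * (N * K * sqrt L))
      + 24 * (N * \<kappa> * sqrt L) + 160 * (N * L * (K + K\<^sup>2)) + 2 * d"
    by (rule absorb_linear[OF \<xi>])
  also have "\<dots> \<le> 2500 * X\<^sup>2" using a2 p2 pu pv w1 w2 d zero_le_power2[of X] by linarith
  finally have "\<xi>\<^sup>2 \<le> (50 * X)\<^sup>2" by (simp add: power_mult_distrib)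
  then have "\<xi> \<le> 50 * X" by (rule power2_le_imp_le) (use X1(5) in simp)
  then show ?thesis by (simp add: X_def)
qed

text \<open>Here N belongs to the fitted filter alone and is unbounded a priori. Terms linear in N
  are split by Young into a multiple of N^2 / 4, with weights totalling at most 4 Q, and a multiple
  of X^2; the former are absorbed by the - Q N^2 hidden in 2 d.\<close>

lemma penalized_arithmetic:
  fixes \<rho> s l L K \<kappa> N No a \<xi> :: real
  assumes pos: "0 \<le> s" "s \<le> \<rho>" "1 \<le> \<rho>" "0 \<le> l" "l \<le> L" "1 \<le> L" "0 \<le> K" "0 \<le> \<kappa>" "0 \<le> \<xi>" "0 \<le> a"
    and N: "0 \<le> N" "0 \<le> No" "No \<le> \<rho>"
    and a: "a \<le> \<kappa> + No * \<kappa> + 7 * (K * No * sqrt l)"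
    and Q: "Q = (K\<^sup>2 + 1) * L + \<kappa> * sqrt l + 1"
    and \<xi>: "\<xi>\<^sup>2 \<le> a\<^sup>2 + 2 * (7 * sqrt (s * l) * (\<xi> + a + (N + No) * \<kappa> + 12 * ((N + No) * K * sqrt L))
         + (6 * ((N + No) * \<kappa> * sqrt L) + 40 * ((N + No) * L * (K + K\<^sup>2)))) + d"
    and d: "d \<le> Q * No\<^sup>2 - Q * N\<^sup>2 / 2"
  shows "\<xi> \<le> 500 * (\<rho> * ((K + 1) * sqrt L + \<kappa>))"
proof -
  define X where "X = \<rho> * ((K + 1) * sqrt L + \<kappa>)"
  have L: "0 \<le> L" using pos by linarith
  define S where "S = sqrt (s * l)"
  have nn: "0 \<le> \<rho> * K * sqrt L" "0 \<le> \<rho> * \<kappa>" "0 \<le> \<rho> * sqrt L" using pos L by auto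
  have Xe: "X = \<rho> * K * sqrt L + \<rho> * sqrt L + \<rho> * \<kappa>" by (simp add: X_def algebra_simps)
  have X1: "\<rho> * K * sqrt L \<le> X" "\<rho> * sqrt L \<le> X" "\<rho> * \<kappa> \<le> X" "0 \<le> X" "\<rho> * ((K + 1) * sqrt L) \<le> X"
    using nn unfolding Xe by (auto simp: algebra_simps)
  have kX: "\<kappa> \<le> X" using mult_right_mono[OF pos(3) pos(8)] X1(3) by simp
  have sL: "sqrt L \<le> X" using mult_right_mono[OF pos(3), of "sqrt L"] X1(2) L by simp
  have rX: "\<rho> \<le> X"
  proof -
    have "\<rho> * 1 \<le> \<rho> * sqrt L" using pos by (intro mult_left_mono) auto
    then show ?thesis using X1(2) by simp
  qed
  have slL: "sqrt l \<le> sqrt L" using pos by simp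
  have S0: "0 \<le> S" using pos by (simp add: S_def)
  have S2: "S\<^sup>2 \<le> X\<^sup>2"
  proof -
    have "S\<^sup>2 = s * l" using pos by (simp add: S_def)
    also have "\<dots> \<le> \<rho> * L" using pos by (intro mult_mono) auto
    also have "\<dots> \<le> (\<rho> * \<rho>) * L" using pos L mult_left_mono[of 1 \<rho> \<rho>] by (intro mult_right_mono) auto
    also have "\<dots> = (\<rho> * sqrt L)\<^sup>2" using L by (simp add: power_mult_distrib power2_eq_square)
    also have "\<dots> \<le> X\<^sup>2" using X1(2) nn by (intro power_mono) auto
    finally show ?thesis .
  qed
  have SX: "S \<le> X" by (rule power2_le_imp_le[OF S2 X1(4)])
  have NoK: "No * K * sqrt L \<le> X"
    using mult_right_mono[OF mult_right_mono[OF N(3) pos(7)], of "sqrt L"] X1(1) L by simp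
  have Nok: "No * \<kappa> \<le> X" using mult_right_mono[OF N(3) pos(8)] X1(3) by linarith
  have "a \<le> 9 * X"
  proof -
    have "K * No * sqrt l \<le> No * K * sqrt L"
      using mult_left_mono[OF slL, of "K * No"] pos N by (simp add: mult_ac)
    then show ?thesis using a Nok kX NoK by linarith
  qed
  then have a2: "a\<^sup>2 \<le> 81 * X\<^sup>2" using pos(10) power_mono[of a "9 * X" 2] by (simp add: power_mult_distrib)
  have KL: "L * (K\<^sup>2 + 1) \<le> X\<^sup>2"
  proof -
    have "L * (K\<^sup>2 + 1) \<le> L * (K + 1)\<^sup>2" using L pos by (intro mult_left_mono) (auto simp: power2_eq_square algebra_simps)
    also have "\<dots> = ((K + 1) * sqrt L)\<^sup>2" using L by (simp add: power_mult_distrib)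
    also have "\<dots> \<le> (\<rho> * ((K + 1) * sqrt L))\<^sup>2"
      using pos L mult_right_mono[OF pos(3), of "(K + 1) * sqrt L"] by (intro power_mono) auto
    also have "\<dots> \<le> X\<^sup>2" using X1(5) pos L by (intro power_mono) auto
    finally show ?thesis .
  qed
  have KK: "K + K\<^sup>2 \<le> 2 * (K\<^sup>2 + 1)"
  proof -
    have "0 \<le> (K - 1)\<^sup>2" by simp
    then have "2 * K \<le> K\<^sup>2 + 1" by (simp add: power2_eq_square algebra_simps)
    then show ?thesis using zero_le_power2[of K] by argo
  qed
  \<comment> \<open>The weight \<kappa> sqrt l is kept in front because it is a summand of Q; sqrt s
    joins N in Young's inequality.\<close>
  have pu: "S * (N * \<kappa>) * 28 \<le> \<kappa> * sqrt l * (N\<^sup>2 / 4) + 784 * X\<^sup>2"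
  proof -
    have "S * (N * \<kappa>) * 28 = (\<kappa> * sqrt l) * (28 * N * sqrt s)" by (simp add: S_def real_sqrt_mult mult_ac)
    also have "\<dots> \<le> (\<kappa> * sqrt l) * (N\<^sup>2 / 4 + 28\<^sup>2 * (sqrt s)\<^sup>2)"
      using pos by (intro mult_left_mono mult_le_eps_squares) auto
    also have "\<dots> = \<kappa> * sqrt l * (N\<^sup>2 / 4) + 784 * (\<kappa> * (s * sqrt l))" using pos by (simp add: algebra_simps)
    also have "\<kappa> * (s * sqrt l) \<le> X * X"
      using kX X1 pos L slL by (intro mult_mono order.trans[OF mult_mono X1(2)]) auto
    finally show ?thesis by (simp add: power2_eq_square)
  qed
  have pv: "S * (N * K * sqrt L) * 336 \<le> K\<^sup>2 * L * (N\<^sup>2 / 4) + 112896 * X\<^sup>2"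
  proof -
    have "S * (N * K * sqrt L) * 336 = 336 * (N * K * sqrt L) * S" by simp
    also have "\<dots> \<le> (N * K * sqrt L)\<^sup>2 / 4 + 336\<^sup>2 * S\<^sup>2" by (rule mult_le_eps_squares)
    also have "\<dots> = K\<^sup>2 * L * (N\<^sup>2 / 4) + 112896 * S\<^sup>2" using L by (simp add: power_mult_distrib)
    finally show ?thesis using S2 by linarith
  qed
  have w1: "24 * (N * \<kappa> * sqrt L) \<le> L * (N\<^sup>2 / 4) + 576 * X\<^sup>2"
  proof -
    have "24 * (N * \<kappa> * sqrt L) = 24 * (N * sqrt L) * \<kappa>" by simp
    also have "\<dots> \<le> (N * sqrt L)\<^sup>2 / 4 + 24\<^sup>2 * \<kappa>\<^sup>2" by (rule mult_le_eps_squares)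
    also have "\<dots> = L * (N\<^sup>2 / 4) + 576 * \<kappa>\<^sup>2" using L by (simp add: power_mult_distrib)
    finally show ?thesis using power_mono[OF kX pos(8), of 2] by linarith
  qed
  have w2: "160 * (N * L * (K + K\<^sup>2)) \<le> L * (K\<^sup>2 + 1) * (N\<^sup>2 / 4) + 102400 * X\<^sup>2"
  proof -
    have "160 * (N * L * (K + K\<^sup>2)) \<le> 160 * (N * L * (2 * (K\<^sup>2 + 1)))"
      using N L KK by (intro mult_left_mono) auto
    also have "\<dots> = L * (K\<^sup>2 + 1) * (320 * N * 1)" by simp
    also have "\<dots> \<le> L * (K\<^sup>2 + 1) * (N\<^sup>2 / 4 + 320\<^sup>2 * 1\<^sup>2)"
      using L by (intro mult_left_mono mult_le_eps_squares) auto
    also have "\<dots> = L * (K\<^sup>2 + 1) * (N\<^sup>2 / 4) + 102400 * (L * (K\<^sup>2 + 1))" by (simp add: algebra_simps)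
    finally show ?thesis using KL by linarith
  qed
  have o1: "S * (No * \<kappa>) \<le> X\<^sup>2" using mult_mono[OF SX Nok X1(4)] N pos by (simp add: power2_eq_square)
  have o2: "S * (No * K * sqrt L) \<le> X\<^sup>2" using mult_mono[OF SX NoK X1(4)] N pos L by (simp add: power2_eq_square)
  have o3: "No * \<kappa> * sqrt L \<le> X\<^sup>2" using mult_mono[OF Nok sL X1(4)] L by (simp add: power2_eq_square)
  have o4: "No * L * (K + K\<^sup>2) \<le> X\<^sup>2"
  proof -
    have "\<rho> \<le> \<rho> * \<rho>" using mult_left_mono[of 1 \<rho> \<rho>] pos by simp
    then have "No \<le> \<rho> * \<rho>" using N by linarith
    then have "No * L * (K + K\<^sup>2) \<le> (\<rho> * \<rho>) * L * (K + 1)\<^sup>2"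
      using N pos L by (intro mult_mono mult_right_mono) (auto simp: power2_eq_square algebra_simps)
    also have "\<dots> = (\<rho> * ((K + 1) * sqrt L))\<^sup>2" using L by (simp add: power_mult_distrib power2_eq_square)
    also have "\<dots> \<le> X\<^sup>2" using X1(5) pos L by (intro power_mono) auto
    finally show ?thesis .
  qed
  have o5: "Q * No\<^sup>2 \<le> 3 * X\<^sup>2"
  proof -
    have Q0: "0 \<le> Q" unfolding Q using pos L by simp
    have "Q * No\<^sup>2 \<le> Q * \<rho>\<^sup>2" using Q0 N by (intro mult_left_mono power_mono) auto
    also have "\<dots> = \<rho>\<^sup>2 * L * (K\<^sup>2 + 1) + (\<rho> * \<kappa>) * (\<rho> * sqrt l) + \<rho>\<^sup>2"
      unfolding Q by (simp add: power2_eq_square algebra_simps)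
    also have "\<rho>\<^sup>2 * L * (K\<^sup>2 + 1) \<le> (\<rho> * ((K + 1) * sqrt L))\<^sup>2"
    proof -
      have "K\<^sup>2 + 1 \<le> (K + 1)\<^sup>2" using pos by (simp add: power2_eq_square algebra_simps)
      then have "\<rho>\<^sup>2 * L * (K\<^sup>2 + 1) \<le> \<rho>\<^sup>2 * L * (K + 1)\<^sup>2" using L by (intro mult_left_mono) auto
      then show ?thesis using L by (simp add: power_mult_distrib mult_ac)
    qed
    also have "\<dots> \<le> X\<^sup>2" using X1(5) pos L by (intro power_mono) auto
    also have "(\<rho> * \<kappa>) * (\<rho> * sqrt l) \<le> X * X"
    proof (rule mult_mono[OF X1(3) _ X1(4)])
      have "\<rho> * sqrt l \<le> \<rho> * sqrt L" using pos slL by (intro mult_left_mono) auto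
      then show "\<rho> * sqrt l \<le> X" using X1(2) by linarith
    qed (use pos in simp)
    also have "\<rho>\<^sup>2 \<le> X\<^sup>2" using rX pos by (intro power_mono) auto
    finally show ?thesis by (simp add: power2_eq_square)
  qed
  have "\<xi>\<^sup>2 \<le> 4 * a\<^sup>2 + 6 * (7 * S)\<^sup>2 + 4 * (7 * S * ((N + No) * \<kappa>)) + 48 * (7 * S * ((N + No) * K * sqrt L))
      + 24 * ((N + No) * \<kappa> * sqrt L) + 160 * ((N + No) * L * (K + K\<^sup>2)) + 2 * d"
    unfolding S_def by (rule absorb_linear[OF \<xi>])
  also have "\<dots> = 4 * a\<^sup>2 + 294 * S\<^sup>2 + (S * (N * \<kappa>) * 28 + 28 * (S * (No * \<kappa>)))
      + (S * (N * K * sqrt L) * 336 + 336 * (S * (No * K * sqrt L)))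
      + (24 * (N * \<kappa> * sqrt L) + 24 * (No * \<kappa> * sqrt L)) + (160 * (N * L * (K + K\<^sup>2)) + 160 * (No * L * (K + K\<^sup>2))) + 2 * d"
    by (simp add: power_mult_distrib algebra_simps)
  also have "\<dots> \<le> 250000 * X\<^sup>2"
  proof -
    \<comment> \<open>The four summands in the first bracket are the N^2 parts of \<open>pu\<close>,
      \<open>pv\<close>, \<open>w1\<close> and \<open>w2\<close>.\<close>
    have "Q * N\<^sup>2 = (\<kappa> * sqrt l * (N\<^sup>2 / 4) + K\<^sup>2 * L * (N\<^sup>2 / 4) + L * (N\<^sup>2 / 4) + L * (K\<^sup>2 + 1) * (N\<^sup>2 / 4))
      + (3 * (\<kappa> * sqrt l) + 2 * L * (K\<^sup>2 + 1) + 4) * (N\<^sup>2 / 4)"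
      unfolding Q by (simp add: field_simps)
    moreover have "0 \<le> (3 * (\<kappa> * sqrt l) + 2 * L * (K\<^sup>2 + 1) + 4) * (N\<^sup>2 / 4)" using pos L by auto
    ultimately have "\<kappa> * sqrt l * (N\<^sup>2 / 4) + K\<^sup>2 * L * (N\<^sup>2 / 4) + L * (N\<^sup>2 / 4) + L * (K\<^sup>2 + 1) * (N\<^sup>2 / 4) \<le> Q * N\<^sup>2" by linarith
    then show ?thesis
      using a2 S2 pu pv w1 w2 o1 o2 o3 o4 o5 d zero_le_power2[of X] by linarith
  qed
  finally have "\<xi>\<^sup>2 \<le> (500 * X)\<^sup>2" by (simp add: power_mult_distrib)
  then have "\<xi> \<le> 500 * X" by (rule power2_le_imp_le) (use X1(4) in simp)
  then show ?thesis by (simp add: X_def)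
qed

section \<open>Risk bounds\<close>

lemma kap_eq: "kap m n * sqrt (2 * real m + 1) = sqrt (2 * real n + 1)"
  by (simp add: kap_def real_sqrt_divide)

text \<open>The order of choice matters: \<psi>, \<open>bad\<close> and a are fixed from x and its
  frequencies, and \<phi> then ranges over all filters for each noise value, so it may be picked
  from the data.\<close>

lemma oracle_inequality:
  fixes m n s :: nat and \<kappa> \<sigma> \<alpha> :: real
  assumes m: "10 \<le> m" and s: "1 \<le> s" "2 * s \<le> m" "(real s)\<^sup>2 * ln (real m) \<le> real m"
    and \<kappa>: "0 \<le> \<kappa>" and \<sigma>: "0 < \<sigma>" and \<alpha>: "0 < \<alpha>" "\<alpha> \<le> 1/2"
    and x: "x \<in> nearly_harmonic \<sigma> m n s \<kappa>"
  defines "S \<equiv> sqrt (2 * real m + 1)" and "K \<equiv> kap m n"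
    and "l \<equiv> ln (1 / \<alpha>)" and "L \<equiv> ln (real (m + n) / \<alpha>)"
    and "\<xi> \<equiv> \<lambda>\<phi> \<zeta>. nrm (window m n) (\<lambda>t. x t - delay m \<phi> (observe m n \<sigma> x \<zeta>) t) / \<sigma>"
  obtains \<psi> bad a where "\<psi> \<in> filters m"
    "dft_norm1 m \<psi> \<le> 84 * exp 28 * (real s)\<^sup>2 * ln (real m) / S"
    "unlikely (gaussian_vector (obs m n)) bad \<alpha>"
    "\<And>\<zeta>. 0 \<le> a \<zeta>"
    "\<And>\<zeta>. \<not> bad \<zeta> \<Longrightarrow> a \<zeta> \<le> \<kappa> + S * dft_norm1 m \<psi> * \<kappa> + 7 * (K * (S * dft_norm1 m \<psi>) * sqrt l)"
    "\<And>\<zeta> \<phi> N. \<not> bad \<zeta> \<Longrightarrow> \<phi> \<in> filters m \<Longrightarrow> N = S * dft_norm1 m \<phi> + S * dft_norm1 m \<psi> \<Longrightarrow>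
       (\<xi> \<phi> \<zeta>)\<^sup>2 \<le> (a \<zeta>)\<^sup>2 + 2 * (7 * sqrt (real s * l) * (\<xi> \<phi> \<zeta> + a \<zeta> + N * \<kappa> + 12 * (N * K * sqrt L))
         + (6 * (N * \<kappa> * sqrt L) + 40 * (N * L * (K + K\<^sup>2))))
         + ((residual m n (observe m n \<sigma> x \<zeta>) \<phi>)\<^sup>2 - (residual m n (observe m n \<sigma> x \<zeta>) \<psi>)\<^sup>2) / \<sigma>\<^sup>2"
proof -
  obtain xH \<epsilon> \<omega> where x_eq: "x = (\<lambda>t. xH t + \<epsilon> t)" and xH: "xH \<in> harmonic_osc_at s \<omega>"
    and \<epsilon>: "\<And>\<tau>. \<tau> \<in> {- int m..int m} \<Longrightarrow> seminorm2 n (shift (- \<tau>) \<epsilon>) \<le> \<kappa> * \<sigma>"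
    using x unfolding nearly_harmonic_def harmonic_osc_def by blast
  obtain \<psi> where \<psi>: "\<psi> \<in> filters m" "dft_norm1 m \<psi> \<le> 84 * exp 28 * (real s)\<^sup>2 * ln (real m) / S"
    "\<And>x. x \<in> harmonic_osc_at s \<omega> \<Longrightarrow> convolution \<psi> (shift (int m) x) = x"
    using reproducing_filter[OF s, of \<omega>] unfolding S_def by blast
  have rep: "delay m \<psi> xH = xH" using \<psi>(3)[OF xH] by (simp add: convolution_shift_eq_delay[OF \<psi>(1)])
  obtain e where e: "\<And>i. i < s \<Longrightarrow> nrm (window m n) (e i) \<le> 1"
    "\<And>v z. v \<in> harmonic_osc_at s \<omega> \<Longrightarrow>
       cmod (ip (window m n) z v) \<le> sqrt (\<Sum>i<s. (cmod (ip (window m n) (e i) z))\<^sup>2) * nrm (window m n) v"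
    using harmonic_frame[of s m n \<omega>] by blast
  have E: "nrm (window m n) (delay m (dft_atom m k) \<epsilon>) \<le> S * (\<kappa> * \<sigma>)" for k
    unfolding S_def by (rule nrm_delay_atom_le[OF \<epsilon>])
  have E0: "nrm (window m n) \<epsilon> \<le> \<kappa> * \<sigma>"
    using \<epsilon>[of "int m"] by (simp add: seminorm2_eq_nrm)
  obtain bad where bad: "unlikely (gaussian_vector (obs m n)) bad \<alpha>"
    "\<And>\<zeta>. \<not> bad \<zeta> \<Longrightarrow> (nrm (window m n) (delay m \<psi> \<zeta>))\<^sup>2 \<le> 40 * (2 * real n + 1) * (dft_norm1 m \<psi>)\<^sup>2 * l"
    "\<And>\<zeta>. \<not> bad \<zeta> \<Longrightarrow> (\<Sum>i<s. (cmod (ip (window m n) (e i) \<zeta>))\<^sup>2) \<le> 40 * real s * l"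
    "\<And>\<zeta> k. \<not> bad \<zeta> \<Longrightarrow> k \<in> {1..2*m+1} \<Longrightarrow> nrm (window m n) (delay m (dft_atom m k) \<zeta>) \<le> 12 * sqrt ((2 * real n + 1) * L)"
    "\<And>\<zeta> k. \<not> bad \<zeta> \<Longrightarrow> k \<in> {1..2*m+1} \<Longrightarrow> cmod (ip (window m n) \<zeta> (delay m (dft_atom m k) \<epsilon>)) \<le> 6 * (S * (\<kappa> * \<sigma>)) * sqrt L"
    "\<And>\<zeta> k. \<not> bad \<zeta> \<Longrightarrow> k \<in> {1..2*m+1} \<Longrightarrow> cmod (ip (window m n) \<zeta> (delay m (dft_atom m k) \<zeta>))
       \<le> 40 * L * (sqrt (2 * real n + 1) + (2 * real n + 1) / sqrt (2 * real m + 1))"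
    by (rule noise_bounds[where r = s and e = e and n = n, OF m \<alpha> e(1) \<psi>(1) E, folded l_def L_def])
      (assumption, (rule that; assumption))
  have S1: "1 \<le> S" by (simp add: S_def)
  have K0: "0 \<le> K" by (simp add: K_def kap_def)
  have KS: "sqrt (2 * real n + 1) = K * S" by (simp add: K_def S_def kap_eq)
  have KS2: "2 * real n + 1 = K\<^sup>2 * S\<^sup>2"
    unfolding power_mult_distrib[symmetric] KS[symmetric] by simp
  have l0: "0 \<le> l" unfolding l_def using \<alpha> by (intro ln_ge_zero) (simp add: field_simps)
  define No where "No = S * dft_norm1 m \<psi>"
  have No0: "0 \<le> No" using S1 by (simp add: No_def dft_norm1_nonneg)
  define a where "a \<zeta> = nrm (window m n) (\<lambda>t. x t - delay m \<psi> (observe m n \<sigma> x \<zeta>) t) / \<sigma>" for \<zeta>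
  have P: "cmod (ip (window m n) \<zeta> v) \<le> 7 * sqrt (real s * l) * nrm (window m n) v"
    if "\<not> bad \<zeta>" "v \<in> harmonic_osc_at s \<omega>" for \<zeta> v
  proof -
    \<comment> \<open>The 7 rounds up the square root of the 40 in
      \<open>noise_bounds\<close>.\<close>
    have "(\<Sum>i<s. (cmod (ip (window m n) (e i) \<zeta>))\<^sup>2) \<le> 49 * (real s * l)"
      using bad(3)[OF that(1)] mult_nonneg_nonneg[OF of_nat_0_le_iff l0, of s] by linarith
    then have "sqrt (\<Sum>i<s. (cmod (ip (window m n) (e i) \<zeta>))\<^sup>2) \<le> sqrt (7\<^sup>2 * (real s * l))" by simp
    also have "\<dots> = 7 * sqrt (real s * l)" unfolding real_sqrt_mult real_sqrt_abs by simp
    finally show ?thesis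
      using e(2)[OF that(2), of \<zeta>] by (meson mult_right_mono nrm_nonneg order.trans)
  qed
  have G1: "nrm (window m n) (delay m \<psi> \<zeta>) \<le> 7 * (K * No * sqrt l)" if "\<not> bad \<zeta>" for \<zeta>
  proof (rule power2_le_imp_le)
    have "(nrm (window m n) (delay m \<psi> \<zeta>))\<^sup>2 \<le> 40 * (K * No)\<^sup>2 * l"
      using bad(2)[OF that] unfolding KS2 No_def by (simp add: power_mult_distrib mult_ac)
    also have "\<dots> \<le> (7 * (K * No * sqrt l))\<^sup>2" using l0 by (simp add: power_mult_distrib mult_right_mono)
    finally show "(nrm (window m n) (delay m \<psi> \<zeta>))\<^sup>2 \<le> (7 * (K * No * sqrt l))\<^sup>2" .
  qed (use K0 No0 l0 in simp)
  have G3: "12 * sqrt ((2 * real n + 1) * L) = S * (12 * (K * sqrt L))"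
    unfolding real_sqrt_mult KS by simp
  have G5: "40 * L * (sqrt (2 * real n + 1) + (2 * real n + 1) / sqrt (2 * real m + 1)) = S * (40 * (L * (K + K\<^sup>2)))"
  proof -
    have "(2 * real n + 1) / sqrt (2 * real m + 1) = K\<^sup>2 * S"
      unfolding KS2 S_def[symmetric] using S1 by (simp add: power2_eq_square)
    then show ?thesis unfolding KS by (simp add: algebra_simps)
  qed
  note bi = basic_inequality[OF _ \<psi>(1) \<sigma> x_eq xH rep E0 E P _ G1 bad(4)[unfolded G3] bad(5) bad(6)[unfolded G5]]
  have p0: "0 \<le> 7 * sqrt (real s * l)" using l0 by simp
  show ?thesis
  proof (rule that[OF \<psi>(1,2) bad(1)])
    show "0 \<le> a \<zeta>" for \<zeta> using \<sigma> by (simp add: a_def)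
    fix \<zeta> assume nb: "\<not> bad \<zeta>"
    have "a \<zeta> * \<sigma> \<le> \<kappa> * \<sigma> + dft_norm1 m \<psi> * (S * (\<kappa> * \<sigma>)) + \<sigma> * (7 * (K * No * sqrt l))"
      using bi(2)[OF \<psi>(1) nb _ p0 nb nb _ nb _ nb] nb \<sigma> by (simp add: a_def)
    also have "\<dots> = (\<kappa> + No * \<kappa> + 7 * (K * No * sqrt l)) * \<sigma>"
      by (simp add: No_def algebra_simps)
    finally show "a \<zeta> \<le> \<kappa> + S * dft_norm1 m \<psi> * \<kappa> + 7 * (K * (S * dft_norm1 m \<psi>) * sqrt l)"
      using \<sigma> by (simp add: No_def)
  next
    fix \<zeta> \<phi> N assume nb: "\<not> bad \<zeta>" and \<phi>: "\<phi> \<in> filters m" and N: "N = S * dft_norm1 m \<phi> + S * dft_norm1 m \<psi>"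
    define R where "R = dft_norm1 m \<phi> + dft_norm1 m \<psi>"
    define p where "p = 7 * sqrt (real s * l)"
    define d where "d = (residual m n (observe m n \<sigma> x \<zeta>) \<phi>)\<^sup>2 - (residual m n (observe m n \<sigma> x \<zeta>) \<psi>)\<^sup>2"
    have RS: "N = R * S" by (simp add: N R_def algebra_simps)
    have X: "nrm (window m n) (\<lambda>t. x t - delay m \<phi> (observe m n \<sigma> x \<zeta>) t) = \<sigma> * \<xi> \<phi> \<zeta>"
      "nrm (window m n) (\<lambda>t. x t - delay m \<psi> (observe m n \<sigma> x \<zeta>) t) = \<sigma> * a \<zeta>"
      using \<sigma> by (simp_all add: \<xi>_def a_def)
    have "(\<sigma> * \<xi> \<phi> \<zeta>)\<^sup>2 \<le> (\<sigma> * a \<zeta>)\<^sup>2 + 2 * \<sigma> * (p * (\<sigma> * \<xi> \<phi> \<zeta> + \<sigma> * a \<zeta> + R * (S * (\<kappa> * \<sigma>)) + \<sigma> * (R * (S * (12 * (K * sqrt L)))))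
        + R * (6 * (S * (\<kappa> * \<sigma>)) * sqrt L) + \<sigma> * (R * (S * (40 * (L * (K + K\<^sup>2)))))) + d"
      unfolding p_def R_def d_def X[symmetric] by (rule bi(1)[OF \<phi> nb _ p0 nb nb _ nb _ nb])
    also have "\<dots> = \<sigma>\<^sup>2 * ((a \<zeta>)\<^sup>2 + 2 * (p * (\<xi> \<phi> \<zeta> + a \<zeta> + N * \<kappa> + 12 * (N * K * sqrt L))
         + (6 * (N * \<kappa> * sqrt L) + 40 * (N * L * (K + K\<^sup>2)))) + d / \<sigma>\<^sup>2)"
      unfolding RS using \<sigma> by (simp add: power2_eq_square algebra_simps)
    finally show "(\<xi> \<phi> \<zeta>)\<^sup>2 \<le> (a \<zeta>)\<^sup>2 + 2 * (p * (\<xi> \<phi> \<zeta> + a \<zeta> + N * \<kappa> + 12 * (N * K * sqrt L))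
         + (6 * (N * \<kappa> * sqrt L) + 40 * (N * L * (K + K\<^sup>2)))) + d / \<sigma>\<^sup>2"
      using \<sigma> by (simp add: power_mult_distrib)
  qed
qed

text \<open>The risk counts errors \<ge> r, so outside \<open>bad\<close> a strict inequality is
  required. \<open>bad\<close> may vary with x, because the supremum is taken over
  probabilities.\<close>

lemma risk_le:
  assumes "\<And>x. x \<in> X \<Longrightarrow> \<exists>bad. unlikely (gaussian_vector (obs m n)) bad \<alpha> \<and>
      (\<forall>\<zeta>. \<not> bad \<zeta> \<longrightarrow> nrm D (\<lambda>t. x t - xhat (observe m n \<sigma> x \<zeta>) t) < r)"
  shows "risk m n \<sigma> D \<alpha> xhat X \<le> ereal r"
  unfolding risk_def
proof (rule Inf_lower, rule CollectI, rule exI[of _ r], intro conjI refl SUP_least)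
  fix x assume "x \<in> X"
  then obtain bad where bad: "unlikely (gaussian_vector (obs m n)) bad \<alpha>"
    "\<And>\<zeta>. \<not> bad \<zeta> \<Longrightarrow> nrm D (\<lambda>t. x t - xhat (observe m n \<sigma> x \<zeta>) t) < r" using assms by blast
  have M: "noise m n = gaussian_vector (obs m n)" by (simp add: noise_def obs_def)
  have "sqrt (\<Sum>t\<in>D. (cmod (xhat (observe m n \<sigma> x \<zeta>) t - x t))\<^sup>2) = nrm D (\<lambda>t. x t - xhat (observe m n \<sigma> x \<zeta>) t)" for \<zeta>
    by (simp add: nrm_def L2_set_def norm_minus_commute)
  then have "emeasure (noise m n) {\<zeta>\<in>space (noise m n). r \<le> sqrt (\<Sum>t\<in>D. (cmod (xhat (observe m n \<sigma> x \<zeta>) t - x t))\<^sup>2)}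
     \<le> emeasure (noise m n) {\<zeta>\<in>space (noise m n). bad \<zeta>}"
    using bad unfolding M unlikely_def by (intro emeasure_mono) (auto simp: not_less[symmetric])
  also have "\<dots> \<le> ennreal \<alpha>" using bad(1) unfolding M unlikely_def by blast
  finally show "emeasure (noise m n) {\<zeta>\<in>space (noise m n). r \<le> sqrt (\<Sum>t\<in>D. (cmod (xhat (observe m n \<sigma> x \<zeta>) t - x t))\<^sup>2)} \<le> ennreal \<alpha>" .
qed

text \<open>With u = m / s^2 one has ln m = 2 ln s + ln u, where the first term is at most u / 50 by
  hypothesis and the second at most u / 2.\<close>

lemma large_m:
  fixes m s :: nat
  assumes s: "1 \<le> s" and m: "real m \<ge> 100 * (real s)\<^sup>2 * ln (real s + 1)"
  shows "10 \<le> m" "2 * s \<le> m" "(real s)\<^sup>2 * ln (real m) \<le> real m"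
proof -
  have "ln 2 \<le> ln (real s + 1)" using s by simp
  with ln2_ge_two_thirds have l: "2/3 \<le> ln (real s + 1)" by linarith
  then have l2: "1/2 \<le> ln (real s + 1)" by linarith
  have "50 * (real s)\<^sup>2 \<le> 100 * (real s)\<^sup>2 * ln (real s + 1)"
    using mult_left_mono[OF l2, of "100 * (real s)\<^sup>2"] by simp
  with m have m50: "50 * (real s)\<^sup>2 \<le> real m" by linarith
  have "real s \<le> (real s)\<^sup>2" using s by (simp add: power2_eq_square)
  then have ms: "50 * real s \<le> real m" using m50 by linarith
  then show m10: "10 \<le> m" and "2 * s \<le> m" using s by linarith+
  define u where "u = real m / (real s)\<^sup>2"
  have mu: "real m = (real s)\<^sup>2 * u" using s by (simp add: u_def)
  have u: "100 * ln (real s + 1) \<le> u" using m s by (simp add: u_def field_simps)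
  then have u0: "0 < u" using l by linarith
  have "ln (u / 2) \<le> u / 2 - 1" using u0 by (intro ln_le_minus_one) simp
  then have "ln u \<le> u / 2" using u0 ln_2_less_1 by (simp add: ln_div)
  moreover have "ln (real m) = 2 * ln (real s) + ln u"
    unfolding mu using s u0 by (simp add: ln_mult ln_realpow)
  moreover have "ln (real s) \<le> ln (real s + 1)" using s by simp
  ultimately have "ln (real m) \<le> u" using u u0 by linarith
  then have "(real s)\<^sup>2 * ln (real m) \<le> (real s)\<^sup>2 * u" by (intro mult_left_mono) auto
  then show "(real s)\<^sup>2 * ln (real m) \<le> real m" using mu by simp
qed

lemma log_facts:
  assumes "10 \<le> m" "0 < \<alpha>" "\<alpha> \<le> 1/2"
  shows "1 \<le> ln (real m)" "0 \<le> ln (1 / \<alpha>)" "ln (1 / \<alpha>) \<le> ln (real (m + n) / \<alpha>)" "1 \<le> ln (real (m + n) / \<alpha>)"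
proof -
  have "exp 1 \<le> real m" using exp_le assms(1) by linarith
  then show m: "1 \<le> ln (real m)" using assms(1) by (simp add: ln_ge_iff)
  show "0 \<le> ln (1 / \<alpha>)" using assms by (intro ln_ge_zero) (simp add: field_simps)
  show "ln (1 / \<alpha>) \<le> ln (real (m + n) / \<alpha>)" using assms by (simp add: divide_right_mono)
  have "real m * \<alpha> \<le> real m + real n"
    using assms mult_left_mono[of \<alpha> 1 "real m"] by linarith
  then have "real m \<le> real (m + n) / \<alpha>" using assms by (simp add: field_simps)
  then have "ln (real m) \<le> ln (real (m + n) / \<alpha>)" using assms by simp
  then show "1 \<le> ln (real (m + n) / \<alpha>)" using m by linarith
qed

lemma risk_constrained:
  fixes m n s :: nat and \<kappa> \<sigma> \<alpha> C :: real
  assumes C: "84 * exp 28 \<le> C" and s: "1 \<le> s" and m: "real m \<ge> 100 * (real s)\<^sup>2 * ln (real s + 1)"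
    and \<kappa>: "0 \<le> \<kappa>" and \<sigma>: "0 < \<sigma>" and \<alpha>: "0 < \<alpha>" "\<alpha> \<le> 1/2"
    and sol: "\<And>y. con_solution m n (C * (real s)\<^sup>2 * ln (real m)) y (\<phi>hat y)"
  shows "risk m n \<sigma> (window m n) \<alpha> (filter_estimate m \<phi>hat) (nearly_harmonic \<sigma> m n s \<kappa>)
         \<le> ereal (51 * C * chi_con m n \<alpha> \<sigma> s \<kappa>)"
proof (rule risk_le)
  note lm = large_m[OF s m]
  define S where "S = sqrt (2 * real m + 1)"
  define K where "K = kap m n"
  define l where "l = ln (1 / \<alpha>)"
  define L where "L = ln (real (m + n) / \<alpha>)"
  define \<rho> where "\<rho> = C * (real s)\<^sup>2 * ln (real m)"
  have lg: "1 \<le> ln (real m)" "0 \<le> l" "l \<le> L" "1 \<le> L"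
    unfolding l_def L_def by (rule log_facts[OF lm(1) \<alpha>])+
  have S1: "1 \<le> S" by (simp add: S_def)
  have K0: "0 \<le> K" by (simp add: K_def kap_def)
  have "1 \<le> 84 * exp (28::real)" using exp_ge_add_one_self[of "28::real"] by linarith
  then have C1: "1 \<le> C" using C by linarith
  have s2: "1 \<le> (real s)\<^sup>2" using s by simp
  have "(real s)\<^sup>2 * 1 \<le> (C * (real s)\<^sup>2) * ln (real m)"
    using C1 lg mult_right_mono[OF C1, of "(real s)\<^sup>2"] by (intro mult_mono) auto
  then have \<rho>s: "(real s)\<^sup>2 \<le> \<rho>" by (simp add: \<rho>_def)
  then have \<rho>1: "1 \<le> \<rho>" using s2 by linarith
  have "real s \<le> (real s)\<^sup>2" using s by (simp add: power2_eq_square)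
  then have s\<rho>: "real s \<le> \<rho>" using \<rho>s by linarith
  define Y where "Y = \<rho> * (K * sqrt l + \<kappa>) + (K + 1) * sqrt (\<rho> * L)"
  have Y0: "0 < Y" unfolding Y_def using \<rho>1 K0 lg \<kappa> by (intro add_nonneg_pos mult_pos_pos) auto
  \<comment> \<open>sqrt \<rho> releases s and sqrt (ln m), which is the second summand of
    \<open>chi_con\<close>; sqrt C \<le> C lets both summands share one constant.\<close>
  have Ychi: "\<sigma> * Y \<le> C * chi_con m n \<alpha> \<sigma> s \<kappa>"
  proof -
    have "sqrt (\<rho> * L) = sqrt C * (real s * sqrt (ln (real m) * L))"
      by (simp add: \<rho>_def real_sqrt_mult)
    also have "\<dots> \<le> C * (real s * sqrt (ln (real m) * L))"
    proof (intro mult_right_mono)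
      have "sqrt C \<le> sqrt (C * C)" using C1 by (intro real_sqrt_le_mono) simp
      then show "sqrt C \<le> C" using C1 by simp
    qed (use lg in simp)
    finally have "(K + 1) * sqrt (\<rho> * L) \<le> (K + 1) * (C * (real s * sqrt (ln (real m) * L)))"
      using K0 by (intro mult_left_mono) auto
    then have "Y \<le> \<rho> * (K * sqrt l + \<kappa>) + (K + 1) * (C * (real s * sqrt (ln (real m) * L)))"
      by (simp add: Y_def)
    then have "\<sigma> * Y \<le> \<sigma> * (\<rho> * (K * sqrt l + \<kappa>) + (K + 1) * (C * (real s * sqrt (ln (real m) * L))))"
      using \<sigma> by simp
    also have "\<dots> = C * chi_con m n \<alpha> \<sigma> s \<kappa>"
      by (simp add: chi_con_def \<rho>_def K_def l_def L_def algebra_simps)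
    finally show ?thesis .
  qed
  fix x assume x: "x \<in> nearly_harmonic \<sigma> m n s \<kappa>"
  obtain \<psi> bad a where o: "\<psi> \<in> filters m"
    "dft_norm1 m \<psi> \<le> 84 * exp 28 * (real s)\<^sup>2 * ln (real m) / S"
    "unlikely (gaussian_vector (obs m n)) bad \<alpha>"
    "\<And>\<zeta>. 0 \<le> a \<zeta>"
    "\<And>\<zeta>. \<not> bad \<zeta> \<Longrightarrow> a \<zeta> \<le> \<kappa> + S * dft_norm1 m \<psi> * \<kappa> + 7 * (K * (S * dft_norm1 m \<psi>) * sqrt l)"
    "\<And>\<zeta> \<phi> N. \<not> bad \<zeta> \<Longrightarrow> \<phi> \<in> filters m \<Longrightarrow> N = S * dft_norm1 m \<phi> + S * dft_norm1 m \<psi> \<Longrightarrow>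
       (nrm (window m n) (\<lambda>t. x t - delay m \<phi> (observe m n \<sigma> x \<zeta>) t) / \<sigma>)\<^sup>2 \<le> (a \<zeta>)\<^sup>2
         + 2 * (7 * sqrt (real s * l) * (nrm (window m n) (\<lambda>t. x t - delay m \<phi> (observe m n \<sigma> x \<zeta>) t) / \<sigma> + a \<zeta> + N * \<kappa> + 12 * (N * K * sqrt L))
         + (6 * (N * \<kappa> * sqrt L) + 40 * (N * L * (K + K\<^sup>2))))
         + ((residual m n (observe m n \<sigma> x \<zeta>) \<phi>)\<^sup>2 - (residual m n (observe m n \<sigma> x \<zeta>) \<psi>)\<^sup>2) / \<sigma>\<^sup>2"
    by (rule oracle_inequality[OF lm(1) s lm(2,3) \<kappa> \<sigma> \<alpha> x, folded S_def K_def l_def L_def]) (rule that; assumption)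
  \<comment> \<open>This makes the oracle filter feasible for the constrained problem, which is
    where the lower bound on C comes from.\<close>
  have "84 * exp 28 * (real s)\<^sup>2 * ln (real m) \<le> \<rho>"
    unfolding \<rho>_def using C lg by (intro mult_right_mono) auto
  then have \<psi>\<rho>: "dft_norm1 m \<psi> \<le> \<rho> / S"
    using o(2) S1 by (meson divide_right_mono order.trans zero_le_one)
  then have No: "S * dft_norm1 m \<psi> \<le> \<rho>" using S1 by (simp add: field_simps)
  show "\<exists>bad. unlikely (gaussian_vector (obs m n)) bad \<alpha> \<and>
      (\<forall>\<zeta>. \<not> bad \<zeta> \<longrightarrow> nrm (window m n) (\<lambda>t. x t - filter_estimate m \<phi>hat (observe m n \<sigma> x \<zeta>) t) < 51 * C * chi_con m n \<alpha> \<sigma> s \<kappa>)"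
  proof (intro exI[of _ bad] conjI allI impI o(3))
    fix \<zeta> assume nb: "\<not> bad \<zeta>"
    define y where "y = observe m n \<sigma> x \<zeta>"
    have min: "\<phi>hat y \<in> filters m" "dft_norm1 m (\<phi>hat y) \<le> \<rho> / S"
      "(residual m n y (\<phi>hat y))\<^sup>2 \<le> (residual m n y \<psi>)\<^sup>2"
      using sol[of y] o(1) \<psi>\<rho> unfolding con_solution_def is_arg_min_def \<rho>_def[symmetric] S_def[symmetric] by (auto simp: not_less)
    define N where "N = S * dft_norm1 m (\<phi>hat y) + S * dft_norm1 m \<psi>"
    have N: "0 \<le> N" "N \<le> 2 * \<rho>"
      using min(2) No S1 unfolding N_def by (simp_all add: dft_norm1_nonneg field_simps)
    have "nrm (window m n) (\<lambda>t. x t - delay m (\<phi>hat y) y t) / \<sigma> \<le> 50 * Y"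
      unfolding Y_def
    proof (rule constrained_arithmetic[OF _ s\<rho> \<rho>1 lg(2,3) K0 \<kappa> _ o(4)[of \<zeta>] N _ No o(5)[OF nb]])
      show "((residual m n y (\<phi>hat y))\<^sup>2 - (residual m n y \<psi>)\<^sup>2) / \<sigma>\<^sup>2 \<le> 0"
        using min(3) by (simp add: divide_nonpos_nonneg)
      show "0 \<le> nrm (window m n) (\<lambda>t. x t - delay m (\<phi>hat y) y t) / \<sigma>" using \<sigma> by simp
    qed (use o(6)[OF nb min(1) N_def] S1 in \<open>auto simp: y_def dft_norm1_nonneg\<close>)
    then have "nrm (window m n) (\<lambda>t. x t - delay m (\<phi>hat y) y t) \<le> 50 * (\<sigma> * Y)"
      using \<sigma> by (simp add: field_simps)
    \<comment> \<open>The step from 50 to 51 buys strictness, thanks to Y > 0.\<close>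
    also have "\<dots> < 51 * (\<sigma> * Y)" using \<sigma> Y0 by simp
    also have "\<dots> \<le> 51 * (C * chi_con m n \<alpha> \<sigma> s \<kappa>)" using Ychi by simp
    finally show "nrm (window m n) (\<lambda>t. x t - filter_estimate m \<phi>hat (observe m n \<sigma> x \<zeta>) t) < 51 * C * chi_con m n \<alpha> \<sigma> s \<kappa>"
      unfolding filter_estimate_def y_def[symmetric] convolution_shift_eq_delay[OF min(1)] by simp
  qed
qed

lemma risk_penalized:
  fixes m n s :: nat and \<kappa> \<sigma> \<alpha> :: real
  assumes s: "1 \<le> s" and m: "real m \<ge> 100 * (real s)\<^sup>2 * ln (real s + 1)"
    and \<kappa>: "0 \<le> \<kappa>" and \<sigma>: "0 < \<sigma>" and \<alpha>: "0 < \<alpha>" "\<alpha> \<le> 1/2"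
    and sol: "\<And>y. pen_solution m n \<sigma> (sqrt (Q1 m n \<alpha> \<kappa>)) y (\<phi>hat y)"
  shows "risk m n \<sigma> (window m n) \<alpha> (filter_estimate m \<phi>hat) (nearly_harmonic \<sigma> m n s \<kappa>)
         \<le> ereal (501 * (84 * exp 28) * chi_pen m n \<alpha> \<sigma> s \<kappa>)"
proof (rule risk_le)
  note lm = large_m[OF s m]
  define S where "S = sqrt (2 * real m + 1)"
  define K where "K = kap m n"
  define l where "l = ln (1 / \<alpha>)"
  define L where "L = ln (real (m + n) / \<alpha>)"
  define C where "C = 84 * exp (28::real)"
  define \<rho> where "\<rho> = C * (real s)\<^sup>2 * ln (real m)"
  define Q where "Q = Q1 m n \<alpha> \<kappa>"
  have lg: "1 \<le> ln (real m)" "0 \<le> l" "l \<le> L" "1 \<le> L"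
    unfolding l_def L_def by (rule log_facts[OF lm(1) \<alpha>])+
  have S1: "1 \<le> S" by (simp add: S_def)
  have K0: "0 \<le> K" by (simp add: K_def kap_def)
  have C1: "1 \<le> C" unfolding C_def using exp_ge_add_one_self[of "28::real"] by linarith
  have s2: "1 \<le> (real s)\<^sup>2" using s by simp
  have "(real s)\<^sup>2 * 1 \<le> (C * (real s)\<^sup>2) * ln (real m)"
    using C1 lg mult_right_mono[OF C1, of "(real s)\<^sup>2"] by (intro mult_mono) auto
  then have \<rho>s: "(real s)\<^sup>2 \<le> \<rho>" by (simp add: \<rho>_def)
  then have \<rho>1: "1 \<le> \<rho>" using s2 by linarith
  have "real s \<le> (real s)\<^sup>2" using s by (simp add: power2_eq_square)
  then have s\<rho>: "real s \<le> \<rho>" using \<rho>s by linarith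
  have Q: "Q = (K\<^sup>2 + 1) * L + \<kappa> * sqrt l + 1" by (simp add: Q_def Q1_def K_def L_def l_def)
  have Q0: "0 \<le> Q" unfolding Q using lg \<kappa> by simp
  define Y where "Y = \<rho> * ((K + 1) * sqrt L + \<kappa>)"
  have "0 < (K + 1) * sqrt L" using K0 lg by simp
  then have Y0: "0 < Y" unfolding Y_def using \<rho>1 \<kappa> by (intro mult_pos_pos[of \<rho>] add_pos_nonneg) auto
  have Ychi: "\<sigma> * Y = C * chi_pen m n \<alpha> \<sigma> s \<kappa>"
    by (simp add: Y_def chi_pen_def \<rho>_def K_def L_def)
  fix x assume x: "x \<in> nearly_harmonic \<sigma> m n s \<kappa>"
  obtain \<psi> bad a where o: "\<psi> \<in> filters m"
    "dft_norm1 m \<psi> \<le> 84 * exp 28 * (real s)\<^sup>2 * ln (real m) / S"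
    "unlikely (gaussian_vector (obs m n)) bad \<alpha>"
    "\<And>\<zeta>. 0 \<le> a \<zeta>"
    "\<And>\<zeta>. \<not> bad \<zeta> \<Longrightarrow> a \<zeta> \<le> \<kappa> + S * dft_norm1 m \<psi> * \<kappa> + 7 * (K * (S * dft_norm1 m \<psi>) * sqrt l)"
    "\<And>\<zeta> \<phi> N. \<not> bad \<zeta> \<Longrightarrow> \<phi> \<in> filters m \<Longrightarrow> N = S * dft_norm1 m \<phi> + S * dft_norm1 m \<psi> \<Longrightarrow>
       (nrm (window m n) (\<lambda>t. x t - delay m \<phi> (observe m n \<sigma> x \<zeta>) t) / \<sigma>)\<^sup>2 \<le> (a \<zeta>)\<^sup>2
         + 2 * (7 * sqrt (real s * l) * (nrm (window m n) (\<lambda>t. x t - delay m \<phi> (observe m n \<sigma> x \<zeta>) t) / \<sigma> + a \<zeta> + N * \<kappa> + 12 * (N * K * sqrt L))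
         + (6 * (N * \<kappa> * sqrt L) + 40 * (N * L * (K + K\<^sup>2))))
         + ((residual m n (observe m n \<sigma> x \<zeta>) \<phi>)\<^sup>2 - (residual m n (observe m n \<sigma> x \<zeta>) \<psi>)\<^sup>2) / \<sigma>\<^sup>2"
    by (rule oracle_inequality[OF lm(1) s lm(2,3) \<kappa> \<sigma> \<alpha> x, folded S_def K_def l_def L_def]) (rule that; assumption)
  have "dft_norm1 m \<psi> \<le> \<rho> / S" using o(2) by (simp add: \<rho>_def C_def)
  then have No: "S * dft_norm1 m \<psi> \<le> \<rho>" using S1 by (simp add: field_simps)
  have S2: "S\<^sup>2 = 2 * real m + 1" by (simp add: S_def)
  show "\<exists>bad. unlikely (gaussian_vector (obs m n)) bad \<alpha> \<and>
      (\<forall>\<zeta>. \<not> bad \<zeta> \<longrightarrow> nrm (window m n) (\<lambda>t. x t - filter_estimate m \<phi>hat (observe m n \<sigma> x \<zeta>) t)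
         < 501 * (84 * exp 28) * chi_pen m n \<alpha> \<sigma> s \<kappa>)"
  proof (intro exI[of _ bad] conjI allI impI o(3))
    fix \<zeta> assume nb: "\<not> bad \<zeta>"
    define y where "y = observe m n \<sigma> x \<zeta>"
    have min: "\<phi>hat y \<in> filters m"
      "(residual m n y (\<phi>hat y))\<^sup>2 + \<sigma>\<^sup>2 * Q * (real m + 1) * (dft_norm1 m (\<phi>hat y))\<^sup>2
        \<le> (residual m n y \<psi>)\<^sup>2 + \<sigma>\<^sup>2 * Q * (real m + 1) * (dft_norm1 m \<psi>)\<^sup>2"
      using sol[of y] o(1) Q0 unfolding pen_solution_def is_arg_min_def Q_def[symmetric] by (auto simp: not_less)
    define N where "N = S * dft_norm1 m (\<phi>hat y) + S * dft_norm1 m \<psi>"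
    have d: "((residual m n y (\<phi>hat y))\<^sup>2 - (residual m n y \<psi>)\<^sup>2) / \<sigma>\<^sup>2
       \<le> Q * (S * dft_norm1 m \<psi>)\<^sup>2 - Q * (S * dft_norm1 m (\<phi>hat y))\<^sup>2 / 2"
    proof -
      have "((residual m n y (\<phi>hat y))\<^sup>2 - (residual m n y \<psi>)\<^sup>2) / \<sigma>\<^sup>2
        \<le> (\<sigma>\<^sup>2 * (Q * ((real m + 1) * (dft_norm1 m \<psi>)\<^sup>2) - Q * ((real m + 1) * (dft_norm1 m (\<phi>hat y))\<^sup>2))) / \<sigma>\<^sup>2"
        using min(2) by (intro divide_right_mono) (simp_all add: algebra_simps)
      also have "\<dots> = Q * ((real m + 1) * (dft_norm1 m \<psi>)\<^sup>2) - Q * ((real m + 1) * (dft_norm1 m (\<phi>hat y))\<^sup>2)"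
        using \<sigma> by simp
      \<comment> \<open>m + 1 lies between S^2 / 2 and S^2: the lower bound serves the fitted
        filter, the upper one the oracle.\<close>
      also have "\<dots> \<le> Q * (S\<^sup>2 * (dft_norm1 m \<psi>)\<^sup>2) - Q * ((S\<^sup>2 / 2) * (dft_norm1 m (\<phi>hat y))\<^sup>2)"
        unfolding S2 using Q0 by (intro diff_mono mult_left_mono mult_right_mono) auto
      finally show ?thesis by (simp add: power_mult_distrib)
    qed
    have "nrm (window m n) (\<lambda>t. x t - delay m (\<phi>hat y) y t) / \<sigma> \<le> 500 * Y"
      unfolding Y_def
    proof (rule penalized_arithmetic[OF _ s\<rho> \<rho>1 lg(2,3,4) K0 \<kappa> _ o(4)[of \<zeta>] _ _ No o(5)[OF nb] Q _ d])
      show "0 \<le> nrm (window m n) (\<lambda>t. x t - delay m (\<phi>hat y) y t) / \<sigma>" using \<sigma> by simp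
    qed (use o(6)[OF nb min(1)[unfolded y_def] refl] S1 in \<open>auto simp: y_def dft_norm1_nonneg\<close>)
    then have "nrm (window m n) (\<lambda>t. x t - delay m (\<phi>hat y) y t) \<le> 500 * (\<sigma> * Y)"
      using \<sigma> by (simp add: field_simps)
    also have "\<dots> < 501 * (\<sigma> * Y)" using \<sigma> Y0 by simp
    finally show "nrm (window m n) (\<lambda>t. x t - filter_estimate m \<phi>hat (observe m n \<sigma> x \<zeta>) t)
         < 501 * (84 * exp 28) * chi_pen m n \<alpha> \<sigma> s \<kappa>"
      unfolding filter_estimate_def y_def[symmetric] convolution_shift_eq_delay[OF min(1)] Ychi by (simp add: C_def)
  qed
qed

theorem proposition4p6:
  shows "\<exists>c C0 :: real. 0 < c \<and> 0 < C0 \<and>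
    (\<forall>C\<ge>C0. \<exists>C'>0. \<forall>(s::nat) (m::nat) (n::nat) (\<kappa>::real) (\<sigma>::real) (\<alpha>::real) (\<phi>hat :: signal \<Rightarrow> signal).
       1 \<le> s \<longrightarrow> real m \<ge> c * (real s)\<^sup>2 * ln (real s + 1) \<longrightarrow> 0 \<le> \<kappa> \<longrightarrow> 0 < \<sigma> \<longrightarrow>
       0 < \<alpha> \<longrightarrow> \<alpha> \<le> 1/2 \<longrightarrow>
       (\<forall>y. con_solution m n (C * (real s)\<^sup>2 * ln (real m)) y (\<phi>hat y)) \<longrightarrow>
       risk m n \<sigma> (window m n) \<alpha> (filter_estimate m \<phi>hat) (nearly_harmonic \<sigma> m n s \<kappa>)
         \<le> ereal (C' * chi_con m n \<alpha> \<sigma> s \<kappa>)) \<and>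
    (\<exists>C''>0. \<forall>(s::nat) (m::nat) (n::nat) (\<kappa>::real) (\<sigma>::real) (\<alpha>::real) (\<phi>hat :: signal \<Rightarrow> signal).
       1 \<le> s \<longrightarrow> real m \<ge> c * (real s)\<^sup>2 * ln (real s + 1) \<longrightarrow> 0 \<le> \<kappa> \<longrightarrow> 0 < \<sigma> \<longrightarrow>
       0 < \<alpha> \<longrightarrow> \<alpha> \<le> 1/2 \<longrightarrow>
       (\<forall>y. pen_solution m n \<sigma> (sqrt (Q1 m n \<alpha> \<kappa>)) y (\<phi>hat y)) \<longrightarrow>
       risk m n \<sigma> (window m n) \<alpha> (filter_estimate m \<phi>hat) (nearly_harmonic \<sigma> m n s \<kappa>)
         \<le> ereal (C'' * chi_pen m n \<alpha> \<sigma> s \<kappa>))"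
\<comment> \<open>100 is the threshold of \<open>large_m\<close>, and 84 e^28 is the norm constant
  of the reproducing filter.\<close>
proof (rule exI[of _ 100], rule exI[of _ "84 * exp 28"], intro conjI allI impI)
  fix C :: real assume C: "84 * exp 28 \<le> C"
  have "0 < 51 * C" using C exp_gt_zero[of "28::real"] by linarith
  then show "\<exists>C'>0. \<forall>(s::nat) (m::nat) (n::nat) (\<kappa>::real) (\<sigma>::real) (\<alpha>::real) (\<phi>hat :: signal \<Rightarrow> signal).
       1 \<le> s \<longrightarrow> real m \<ge> 100 * (real s)\<^sup>2 * ln (real s + 1) \<longrightarrow> 0 \<le> \<kappa> \<longrightarrow> 0 < \<sigma> \<longrightarrow>
       0 < \<alpha> \<longrightarrow> \<alpha> \<le> 1/2 \<longrightarrow>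
       (\<forall>y. con_solution m n (C * (real s)\<^sup>2 * ln (real m)) y (\<phi>hat y)) \<longrightarrow>
       risk m n \<sigma> (window m n) \<alpha> (filter_estimate m \<phi>hat) (nearly_harmonic \<sigma> m n s \<kappa>)
         \<le> ereal (C' * chi_con m n \<alpha> \<sigma> s \<kappa>)"
    using risk_constrained[OF C] by blast
next
  show "\<exists>C''>0. \<forall>(s::nat) (m::nat) (n::nat) (\<kappa>::real) (\<sigma>::real) (\<alpha>::real) (\<phi>hat :: signal \<Rightarrow> signal).
       1 \<le> s \<longrightarrow> real m \<ge> 100 * (real s)\<^sup>2 * ln (real s + 1) \<longrightarrow> 0 \<le> \<kappa> \<longrightarrow> 0 < \<sigma> \<longrightarrow>
       0 < \<alpha> \<longrightarrow> \<alpha> \<le> 1/2 \<longrightarrow>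
       (\<forall>y. pen_solution m n \<sigma> (sqrt (Q1 m n \<alpha> \<kappa>)) y (\<phi>hat y)) \<longrightarrow>
       risk m n \<sigma> (window m n) \<alpha> (filter_estimate m \<phi>hat) (nearly_harmonic \<sigma> m n s \<kappa>)
         \<le> ereal (C'' * chi_pen m n \<alpha> \<sigma> s \<kappa>)"
    using risk_penalized by (intro exI[of _ "501 * (84 * exp 28)"]) auto
qed simp_all

end
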